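(* Let $n\ge3$, let $\gamma\in(0,1)$, and let $\Omega\subset\mathbb{R}^n$ be an open set. Then $\lambda(\Omega)>0$ if and only if $r_{\Omega,\gamma}<\infty$.
   Context: $B_r$ denotes an open ball of radius $r>0$ in $\mathbb{R}^n$ (with arbitrary center) and $\bar B_r$ its closure. For an open set $\Omega\subset\mathbb{R}^n$, $\lambda(\Omega)$ is the bottom of the spectrum of the Dirichlet Laplacian $-\Delta$ in $\Omega$ (Friedrichs extension of $-\Delta$ on $C_0^\infty(\Omega)$), i.e. $$\lambda(\Omega)=\inf_{u\in C_0^\infty(\Omega),\,u\not\equiv0}\frac{\int_\Omega|\nabla u|^2dx}{\int_\Omega|u|^2dx}$$ (with $\lambda(\emptyset)=+\infty$). The Wiener capacity of a compact set $F\subset\mathbb{R}^n$ is $$\mathrm{cap}(F)=\inf\left\{\int_{\mathbb{R}^n}|\nabla u|^2dx \;:\; u:\mathbb{R}^n\to\mathbb{R}\text{ Lipschitz with compact support},\ u|_F=1\right\}.$$ For $\gamma\in(0,1)$, a compact set $F\subset\bar B_r$ is called $\gamma$-negligible (in $\bar B_r$) if $\mathrm{cap}(F)\le\gamma\,\mathrm{cap}(\bar B_r)$. The interior capacitary radius of $\Omega$ is $$r_{\Omega,\gamma}=\sup\{r>0 : \text{there is a ball } B_r \text{ such that } \bar B_r\setminus\Omega \text{ is } \gamma\text{-negligible in }\bar B_r\}\in[0,\infty]$$ (the supremum of the empty set being $0$). *)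

theory Defs
  imports "HOL-Analysis.Analysis"
begin

definition partial_exists :: "(real ^ 'n \<Rightarrow> real) \<Rightarrow> 'n \<Rightarrow> real ^ 'n \<Rightarrow> bool" where
  "partial_exists u i x \<longleftrightarrow> (\<lambda>t. u (x + t *\<^sub>R axis i 1)) field_differentiable (at 0)"

definition partial_deriv :: "'n \<Rightarrow> (real ^ 'n \<Rightarrow> real) \<Rightarrow> real ^ 'n \<Rightarrow> real" where
  "partial_deriv i u x = deriv (\<lambda>t. u (x + t *\<^sub>R axis i 1)) 0"

(* Where a partial derivative does not exist, deriv returns one fixed unspecified real number.
   For Lipschitz u this happens only on a Borel null set, so it does not affect the integrals
   below. *)
definition gradient :: "(real ^ 'n \<Rightarrow> real) \<Rightarrow> real ^ 'n \<Rightarrow> real ^ 'n" where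
  "gradient u x = (\<chi> i. partial_deriv i u x)"

fun Ck :: "nat \<Rightarrow> (real ^ 'n \<Rightarrow> real) \<Rightarrow> bool" where
  "Ck 0 u \<longleftrightarrow> continuous_on UNIV u"
| "Ck (Suc k) u \<longleftrightarrow> continuous_on UNIV u \<and>
     (\<forall>i. (\<forall>x. partial_exists u i x) \<and> Ck k (partial_deriv i u))"

definition smooth :: "(real ^ 'n \<Rightarrow> real) \<Rightarrow> bool" where
  "smooth u \<longleftrightarrow> (\<forall>k. Ck k u)"

definition supp :: "(real ^ 'n \<Rightarrow> real) \<Rightarrow> (real ^ 'n) set" where
  "supp u = closure {x. u x \<noteq> 0}"

(* Elements of C_0^infty(Omega) are represented by their extension by zero to the whole space. *)
definition test_functions :: "(real ^ 'n) set \<Rightarrow> (real ^ 'n \<Rightarrow> real) set" where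
  "test_functions \<Omega> = {u. smooth u \<and> compact (supp u) \<and> supp u \<subseteq> \<Omega>}"

(* Both integrals are finite and the denominator is nonzero for the admissible u; the infimum of
   the empty set in ennreal is infinity. *)
definition dirichlet_bottom :: "(real ^ 'n) set \<Rightarrow> ennreal" where
  "dirichlet_bottom \<Omega> =
     (INF u \<in> {u \<in> test_functions \<Omega>. \<exists>x. u x \<noteq> 0}.
        (\<integral>\<^sup>+x\<in>\<Omega>. ennreal ((norm (gradient u x))\<^sup>2) \<partial>lborel) /
        (\<integral>\<^sup>+x\<in>\<Omega>. ennreal (\<bar>u x\<bar>\<^sup>2) \<partial>lborel))"

definition wiener_cap :: "(real ^ 'n) set \<Rightarrow> ennreal" where
  "wiener_cap F =
     (INF u \<in> {u. (\<exists>L. L-lipschitz_on UNIV u) \<and> compact (supp u) \<and> (\<forall>x\<in>F. u x = 1)}.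
        \<integral>\<^sup>+x. ennreal ((norm (gradient u x))\<^sup>2) \<partial>lborel)"

definition negligible_in_cball :: "real \<Rightarrow> real ^ 'n \<Rightarrow> real \<Rightarrow> (real ^ 'n) set \<Rightarrow> bool" where
  "negligible_in_cball \<gamma> c r F \<longleftrightarrow>
     compact F \<and> F \<subseteq> cball c r \<and> wiener_cap F \<le> ennreal \<gamma> * wiener_cap (cball c r)"

(* The supremum of the empty set in ennreal is 0. *)
definition interior_cap_radius :: "real \<Rightarrow> (real ^ 'n) set \<Rightarrow> ennreal" where
  "interior_cap_radius \<gamma> \<Omega> =
     (SUP r \<in> {r. r > 0 \<and> (\<exists>c. negligible_in_cball \<gamma> c r (cball c r - \<Omega>))}. ennreal r)"

end

(* In both directions one may work with Lipschitz functions of compact support: mollification turns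
   them into smooth functions without increasing the Dirichlet integral.  Since the gradient takes a
   junk value where a partial derivative fails to exist, this needs that Lipschitz functions have
   partial derivatives almost everywhere.

   If r is larger than the interior capacitary radius, cap (cball y r - Omega) is bounded below by a
   positive constant for every y (Hardy's inequality shows that balls have positive capacity when
   n >= 3).  Testing this capacity with eta_y (1 - u / u(y)), for a cutoff eta_y around y, bounds
   u(y)^2 by local integrals of |grad u|^2 and of (u(y) - u(x))^2 around y.  Integrating over y gives
   the spectral gap, with no local Poincare inequality and no covering.

   Conversely, let F = cball c r - Omega be negligible and rescale to r = 1.  A nearly optimal u for
   cap F cannot be close to 1 in L^2 of the ball: otherwise its mollification, divided by a constant
   slightly below 1, would be admissible for a slightly smaller ball and too cheap for the scaling
   law of the capacity.  So eta (1 - u) has L^2 mass bounded below and energy bounded above, and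
   scaling back gives a Rayleigh quotient of order r^(-2). *)

theory Submission imports Defs begin

section \<open>Almost everywhere differentiability of Lipschitz functions\<close>

text \<open>Since gradients exist only almost everywhere, the calculus is carried out on difference
  quotients and passed to the limit. Translation invariance and dominated convergence give the
  vanishing integral of derivatives, hence integration by parts, and the L^2 bound of
  \<open>u (x + z) - u x\<close> by the energy; truncations are compared with the original function
  quotient by quotient. Existence of the derivatives rests on a measure comparison: on a set where
  quotients below p and above q > p both recur, an increasing map would multiply the measure by at
  most p and by at least q.

  From a finite radius to a spectral gap, the delicate term is \<open>(u y - u x)^2\<close>. For a
  single y its local integral is not controlled by the energy, but after integration over y it
  becomes an average of translation differences, and these are.

  In the converse gamma may be arbitrarily close to 1. The slack is turned into a radius t < 1 with
  \<open>t^n > gamma\<close>, and the width h and the mass bound delta are built from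
  \<open>s = 1 - t\<close>.\<close>

lemma bounded_no_limit_gap:
  fixes q :: "real \<Rightarrow> real"
  assumes bd: "\<And>t. \<bar>q t\<bar> \<le> M" and no: "\<not> (\<exists>l. (q \<longlongrightarrow> l) (at 0))"
  obtains a b where "a \<in> \<rat>" "b \<in> \<rat>" "a < b" "\<exists>\<^sub>F t in at 0. q t < a" "\<exists>\<^sub>F t in at 0. b < q t"
proof -
  let ?e = "\<lambda>t. ereal (q t)"
  let ?li = "Liminf (at 0) ?e" and ?ls = "Limsup (at (0::real)) ?e"
  have le: "?li \<le> ?ls" by (rule Liminf_le_Limsup) simp
  \<comment> \<open>The bound makes the lower limit finite; an infinite common limit in
    \<open>ereal\<close> would not contradict the absence of a real limit.\<close>
  have "- ereal M \<le> ?li"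
    using bd by (intro Liminf_bounded always_eventually) (auto simp: abs_le_iff minus_le_iff)
  moreover have "?ls \<le> ereal M"
    using bd by (intro Limsup_bounded always_eventually) (auto simp: abs_le_iff)
  ultimately have "\<bar>?li\<bar> \<noteq> \<infinity>" using le by auto
  then obtain r where r: "?li = ereal r" by auto
  have "?li \<noteq> ?ls"
  proof
    assume "?li = ?ls"
    then have "(?e \<longlongrightarrow> ereal r) (at 0)"
      using r by (intro Liminf_eq_Limsup) auto
    then show False using no by auto
  qed
  with le have "?li < ?ls" by simp
  obtain b' where b': "?li < ereal b'" "ereal b' < ?ls"
    using \<open>?li < ?ls\<close> ereal_dense2 by blast
  obtain a' where a': "?li < ereal a'" "ereal a' < ereal b'"
    using b' ereal_dense2 by blast
  obtain a'' where a'': "?li < ereal a''" "ereal a'' < ereal a'"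
    using a' ereal_dense2 by blast
  obtain a b where ab: "a \<in> \<rat>" "a'' < a" "a < a'" "b \<in> \<rat>" "a' < b" "b < b'"
    using a' a'' Rats_dense_in_real by (metis ereal_less_eq(3) linorder_not_le)
  have "\<exists>\<^sub>F t in at 0. q t < a"
  proof (rule ccontr)
    assume "\<not> ?thesis"
    then have "\<forall>\<^sub>F t in at 0. ereal a \<le> ?e t"
      by (simp add: not_frequently not_less)
    then have "ereal a \<le> ?li" by (rule Liminf_bounded)
    then show False using a'' ab(2) by (metis ereal_less(2) ereal_less_eq(3) less_ereal.simps(1) less_trans linorder_not_le)
  qed
  moreover have "\<exists>\<^sub>F t in at 0. b < q t"
  proof (rule ccontr)
    assume "\<not> ?thesis"
    then have "\<forall>\<^sub>F t in at 0. ?e t \<le> ereal b"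
      by (simp add: not_frequently not_less)
    then have "?ls \<le> ereal b" by (rule Limsup_bounded)
    then show False using b' ab(6) by (metis less_ereal.simps(1) less_trans linorder_not_le)
  qed
  ultimately show ?thesis using that ab by (meson less_trans)
qed

text \<open>Subadditivity in the form needed for Vitali coverings: these are indexed by pairs of
  endpoints, and the image intervals need not be disjoint.\<close>

lemma emeasure_UN_countable_le:
  assumes X[measurable]: "\<And>i. i \<in> I \<Longrightarrow> X i \<in> sets M" and I[simp]: "countable I"
  shows "emeasure M (\<Union>(X ` I)) \<le> (\<integral>\<^sup>+i. emeasure M (X i) \<partial>count_space I)"
proof -
  have le: "indicator (\<Union>(X ` I)) x \<le> (\<integral>\<^sup>+i. indicator (X i) x \<partial>count_space I)" for x
  proof (cases "x \<in> \<Union>(X ` I)")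
    case True
    then obtain j where j: "j \<in> I" "x \<in> X j" by auto
    have "(1::ennreal) = (\<integral>\<^sup>+i. indicator {j} i \<partial>count_space I)"
      using j by (subst nn_integral_indicator) (auto simp: one_ennreal_def[symmetric])
    also have "\<dots> \<le> (\<integral>\<^sup>+i. indicator (X i) x \<partial>count_space I)"
      using j by (intro nn_integral_mono) (auto split: split_indicator)
    finally show ?thesis using True by simp
  qed simp
  have "emeasure M (\<Union>(X ` I)) = (\<integral>\<^sup>+x. indicator (\<Union>(X ` I)) x \<partial>M)"
    by (rule nn_integral_indicator[symmetric]) (auto intro!: sets.countable_UN')
  also have "\<dots> \<le> (\<integral>\<^sup>+x. \<integral>\<^sup>+i. indicator (X i) x \<partial>count_space I \<partial>M)"
    by (intro nn_integral_mono le)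
  also have "\<dots> = (\<integral>\<^sup>+i. emeasure M (X i) \<partial>count_space I)"
    by (subst nn_integral_count_space_nn_integral) (simp_all cong: nn_integral_cong_simp)
  finally show ?thesis .
qed

text \<open>A Vitali covering selects countably many disjoint short intervals that cover A up to a
  null set and lie in an open U barely larger than A. The Lipschitz bound keeps the image of the
  null part null; monotonicity puts the rest inside the intervals \<open>{f a..f b}\<close>, whose
  total length is at most p times the measure of U.\<close>

lemma emeasure_image_le:
  fixes f :: "real \<Rightarrow> real"
  assumes lip: "L-lipschitz_on UNIV f" and mono: "mono f" and p: "0 < p"
    and A: "A \<in> sets borel" and fA: "f ` A \<in> sets borel"
    and cov: "\<And>x d. \<lbrakk>x \<in> A; 0 < d\<rbrakk> \<Longrightarrow> \<exists>a b. a < b \<and> b - a < d \<and> x \<in> {a..b} \<and> f b - f a \<le> p * (b - a)"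
  shows "emeasure lborel (f ` A) \<le> ennreal p * emeasure lborel A"
proof (rule ennreal_le_epsilon)
  fix e :: real assume e: "0 < e"
  obtain U where U: "open U" "A \<subseteq> U" "emeasure lborel (U - A) < ennreal (e / p)"
    using outer_regular_lborel[OF A, of "e/p"] e p by auto
  have Ub: "U \<in> sets lborel" using U by auto
  have UA: "emeasure lborel U \<le> emeasure lborel A + ennreal (e / p)"
  proof -
    have "emeasure lborel U = emeasure lborel (A \<union> (U - A))" using U by (simp add: Un_absorb1)
    also have "\<dots> \<le> emeasure lborel A + emeasure lborel (U - A)"
      using A Ub by (intro emeasure_subadditive) auto
    also have "\<dots> \<le> emeasure lborel A + ennreal (e / p)" using U by (intro add_mono) auto
    finally show ?thesis .
  qed
  define K where "K = {(a,b). a < b \<and> {a..b} \<subseteq> U \<and> f b - f a \<le> p * (b - a)}"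
  \<comment> \<open>The covering theorem speaks of closed balls, so each interval is described by
    its centre and radius.\<close>
  define c where "c = (\<lambda>(a,b). (a + b) / 2 :: real)"
  define r where "r = (\<lambda>(a,b). (b - a) / 2 :: real)"
  have cb: "cball (c i) (r i) = {fst i..snd i}" for i
    by (cases i) (auto simp: c_def r_def cball_eq_atLeastAtMost field_simps)
  have 1: "0 < r i" if "i \<in> K" for i using that by (auto simp: K_def r_def)
  have 2: "\<exists>i. i \<in> K \<and> x \<in> cball (c i) (r i) \<and> r i < d" if x: "x \<in> A" and d: "0 < d" for x d
  proof -
    obtain s where s: "s > 0" "ball x s \<subseteq> U" using U x by (meson openE subsetD)
    obtain a b where ab: "a < b" "b - a < min d s" "x \<in> {a..b}" "f b - f a \<le> p * (b - a)"
      using cov[OF x, of "min d s"] d s by auto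
    have "{a..b} \<subseteq> ball x s" using ab by (auto simp: dist_real_def)
    then have "(a,b) \<in> K" using ab s by (auto simp: K_def)
    moreover have "x \<in> cball (c (a,b)) (r (a,b))" using ab unfolding cb by auto
    moreover have "r (a,b) < d" using ab by (auto simp: r_def)
    ultimately show ?thesis by blast
  qed
  obtain C where C: "countable C" "C \<subseteq> K"
     "pairwise (\<lambda>i j. disjnt (cball (c i) (r i)) (cball (c j) (r j))) C"
     "negligible (A - (\<Union>i \<in> C. cball (c i) (r i)))"
    by (rule Vitali_covering_theorem_cballs[of K r A c, OF 1 2]) blast+
  let ?N = "A - (\<Union>i \<in> C. cball (c i) (r i))"
  have "negligible (f ` ?N)"
  proof (rule negligible_locally_Lipschitz_image[OF _ C(4)])
    show "DIM(real) \<le> DIM(real)" by simp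
    fix x
    show "\<exists>T B. open T \<and> x \<in> T \<and> (\<forall>y \<in> ?N \<inter> T. norm (f y - f x) \<le> B * norm (y - x))"
      by (rule exI[of _ UNIV], rule exI[of _ L]) (use lip in \<open>auto simp: lipschitz_on_def dist_norm\<close>)
  qed
  then have N: "f ` ?N \<in> null_sets lebesgue" by (simp add: negligible_iff_null_sets)
  have cov': "f ` A \<subseteq> f ` ?N \<union> (\<Union>i\<in>C. {f (fst i) .. f (snd i)})"
  proof
    fix y assume "y \<in> f ` A"
    then obtain x where x: "x \<in> A" "y = f x" by auto
    show "y \<in> f ` ?N \<union> (\<Union>i\<in>C. {f (fst i) .. f (snd i)})"
    proof (cases "x \<in> ?N")
      case False
      then obtain i where "i \<in> C" "x \<in> {fst i..snd i}" using x cb by auto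
      then show ?thesis using x monoD[OF mono] by (auto intro!: UnI2 bexI[of _ i])
    qed (use x in auto)
  qed
  have D: "disjoint_family_on (\<lambda>i. {fst i..snd i}) C"
    using C(3) unfolding cb by (auto simp: disjoint_family_on_def pairwise_def disjnt_def)
  have "emeasure lborel (f ` A) = emeasure lebesgue (f ` A)" using fA by simp
  also have "\<dots> \<le> emeasure lebesgue (f ` ?N \<union> (\<Union>i\<in>C. {f (fst i) .. f (snd i)}))"
    using N C(1) cov' by (intro emeasure_mono sets.Un null_setsD2[OF N] sets.countable_UN') auto
  also have "\<dots> = emeasure lebesgue (\<Union>i\<in>C. {f (fst i) .. f (snd i)})"
    using C(1) by (subst Un_commute, intro emeasure_Un_null_set N sets.countable_UN') auto
  also have "\<dots> \<le> (\<integral>\<^sup>+i. emeasure lebesgue {f (fst i) .. f (snd i)} \<partial>count_space C)"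
    using C(1) by (intro emeasure_UN_countable_le) auto
  also have "\<dots> \<le> (\<integral>\<^sup>+i. ennreal p * emeasure lborel {fst i .. snd i} \<partial>count_space C)"
  proof (intro nn_integral_mono)
    fix i assume "i \<in> space (count_space C)"
    then have "i \<in> K" using C by auto
    then have i: "fst i < snd i" "f (snd i) - f (fst i) \<le> p * (snd i - fst i)" by (auto simp: K_def)
    then have "f (fst i) \<le> f (snd i)" using mono by (auto simp: mono_def)
    then show "emeasure lebesgue {f (fst i) .. f (snd i)} \<le> ennreal p * emeasure lborel {fst i .. snd i}"
      using i p by (simp add: ennreal_mult'' [symmetric] ennreal_leI)
  qed
  also have "\<dots> = ennreal p * (\<integral>\<^sup>+i. emeasure lborel {fst i .. snd i} \<partial>count_space C)"
    by (rule nn_integral_cmult) simp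
  also have "(\<integral>\<^sup>+i. emeasure lborel {fst i .. snd i} \<partial>count_space C) = emeasure lborel (\<Union>i\<in>C. {fst i .. snd i})"
    using C(1) D by (intro emeasure_UN_countable[symmetric]) auto
  also have "\<dots> \<le> emeasure lborel U"
    using C(2) Ub by (intro emeasure_mono) (force simp: K_def)+
  also have "ennreal p * emeasure lborel U \<le> ennreal p * (emeasure lborel A + ennreal (e / p))"
    by (intro mult_left_mono UA) auto
  also have "\<dots> = ennreal p * emeasure lborel A + ennreal e"
    using p e by (simp add: distrib_left ennreal_mult''[symmetric])
  finally show "emeasure lborel (f ` A) \<le> ennreal p * emeasure lborel A + ennreal e"
    by (simp add: mult_left_mono)
qed

text \<open>For fixed nonzero h the quotient is continuous in x, so the union over all 0 < |h| <
  1/(n+1) is open, and the set is a countable intersection of open sets.\<close>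

lemma frequently_quotient_less_borel:
  fixes u :: "'a::euclidean_space \<Rightarrow> real"
  assumes u: "continuous_on UNIV u"
  shows "{x. \<exists>\<^sub>F h in at 0. (u (x + h *\<^sub>R e) - u x) / h < a} \<in> sets borel"
proof -
  let ?S = "\<lambda>h. {x. (u (x + h *\<^sub>R e) - u x) / h < a}"
  have o: "open (?S h)" if "h \<noteq> 0" for h
    by (intro open_Collect_less continuous_intros continuous_on_compose2[OF u]) (use that in auto)
  have "{x. \<exists>\<^sub>F h in at 0. (u (x + h *\<^sub>R e) - u x) / h < a} =
        (\<Inter>n::nat. \<Union>h\<in>{h. h \<noteq> 0 \<and> \<bar>h\<bar> < 1 / Suc n}. ?S h)" (is "?A = ?B")
  proof
    show "?A \<subseteq> ?B" by (force simp: frequently_at)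
    show "?B \<subseteq> ?A"
    proof
      fix x assume x: "x \<in> ?B"
      show "x \<in> ?A"
        unfolding mem_Collect_eq frequently_at
      proof (intro allI impI)
        fix d :: real assume "d > 0"
        then obtain n where "1 / Suc n < d" using nat_approx_posE by blast
        then show "\<exists>h\<in>UNIV. h \<noteq> 0 \<and> dist h 0 < d \<and> (u (x + h *\<^sub>R e) - u x) / h < a"
        proof -
          have "x \<in> (\<Union>h\<in>{h. h \<noteq> 0 \<and> \<bar>h\<bar> < 1 / Suc n}. ?S h)" using x by (rule INT_D) simp
          then obtain h where "h \<noteq> 0" "\<bar>h\<bar> < 1 / Suc n" "x \<in> ?S h" by blast
          then show ?thesis using \<open>1 / Suc n < d\<close> by (intro bexI[of _ h]) auto
        qed
      qed
    qed
  qed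
  also have "\<dots> \<in> sets borel"
    by (rule sets.countable_INT') (auto intro!: borel_open open_UN o)
  finally show ?thesis .
qed

lemma frequently_quotient_greater_borel:
  fixes u :: "'a::euclidean_space \<Rightarrow> real"
  assumes u: "continuous_on UNIV u"
  shows "{x. \<exists>\<^sub>F h in at 0. a < (u (x + h *\<^sub>R e) - u x) / h} \<in> sets borel"
proof -
  have "{x. \<exists>\<^sub>F h in at 0. ((\<lambda>x. - u x) (x + h *\<^sub>R e) - (\<lambda>x. - u x) x) / h < - a} \<in> sets borel"
    by (rule frequently_quotient_less_borel) (intro continuous_intros u)
  also have "{x. \<exists>\<^sub>F h in at 0. ((\<lambda>x. - u x) (x + h *\<^sub>R e) - (\<lambda>x. - u x) x) / h < - a} =
      {x. \<exists>\<^sub>F h in at 0. a < (u (x + h *\<^sub>R e) - u x) / h}"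
  proof -
    have "((\<lambda>x. - u x) (x + h *\<^sub>R e) - (\<lambda>x. - u x) x) / h = - ((u (x + h *\<^sub>R e) - u x) / h)" for x h
      by (simp add: minus_divide_left)
    then show ?thesis by simp
  qed
  finally show ?thesis .
qed

text \<open>Let F be increasing with inverse G. Intervals of small slope give |F(S)| <= p |S|;
  intervals of large slope, read through G, give |S| <= |F(S)| / q. Since p < q, a set S of finite
  measure must be null.\<close>

lemma lipschitz_oscillation_null:
  fixes f :: "real \<Rightarrow> real"
  assumes lip: "L-lipschitz_on UNIV f" and ab: "a < b"
  shows "{x. \<exists>\<^sub>F h in at 0. (f (x + h) - f x) / h < a} \<inter> {x. \<exists>\<^sub>F h in at 0. b < (f (x + h) - f x) / h}
     \<in> null_sets lborel" (is "?A \<inter> ?B \<in> _")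
proof -
  \<comment> \<open>Adding the slope L + 1 makes every increment of F at least the increment of its
    argument, so the inverse of F is 1-Lipschitz, while all quotients are shifted by the same
    constant.\<close>
  define F where "F = (\<lambda>t. f t + (L + 1) * t)"
  have L0: "0 \<le> L" using lip by (rule lipschitz_on_nonneg)
  have fl: "\<bar>f x - f y\<bar> \<le> L * \<bar>x - y\<bar>" for x y
    using lip by (auto simp: lipschitz_on_def dist_real_def)
  have F1: "t - s \<le> F t - F s" if "s \<le> t" for s t
  proof -
    have "\<bar>f t - f s\<bar> \<le> L * (t - s)" using fl[of t s] that by simp
    then show ?thesis by (simp add: F_def algebra_simps abs_le_iff)
  qed
  have F2: "F t - F s \<le> (2 * L + 1) * (t - s)" if "s \<le> t" for s t
  proof -
    have "\<bar>f t - f s\<bar> \<le> L * (t - s)" using fl[of t s] that by simp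
    then show ?thesis by (simp add: F_def algebra_simps abs_le_iff)
  qed
  have contf: "continuous_on UNIV f" using lip by (rule lipschitz_on_continuous_on)
  have contF: "continuous_on UNIV F" unfolding F_def by (intro continuous_intros contf)
  have sm: "strict_mono F"
    by (rule strict_monoI) (use F1 in \<open>smt (verit)\<close>)
  have mF: "mono F" using sm by (rule strict_mono_mono)
  have surjF: "\<exists>x. F x = y" for y
  proof -
    let ?c = "\<bar>F 0\<bar> + \<bar>y\<bar>"
    have "F (- ?c) \<le> y" using F1[of "- ?c" 0] abs_ge_zero[of y] abs_ge_zero[of "F 0"] abs_ge_self[of "F 0"] abs_ge_minus_self[of y] by linarith
    moreover have "y \<le> F ?c" using F1[of 0 ?c] abs_ge_zero[of y] abs_ge_zero[of "F 0"] abs_ge_minus_self[of "F 0"] abs_ge_self[of y] by linarith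
    moreover have "continuous_on {- ?c..?c} F" using contF continuous_on_subset by blast
    ultimately show ?thesis using IVT'[of F "- ?c" y ?c] abs_ge_zero[of y] abs_ge_zero[of "F 0"] by (metis add_nonneg_nonneg neg_le_0_iff_le order_trans)
  qed
  define G where "G = inv F"
  have bij: "bij F" using sm surjF by (auto simp: bij_def surj_def strict_mono_eq inj_def) metis
  have FG: "F (G y) = y" and GF: "G (F x) = x" for x y
    using bij by (auto simp: G_def bij_def surj_f_inv_f)
  have mG: "mono G"
    by (rule monoI) (metis FG sm strict_mono_less_eq)
  have lipG: "1-lipschitz_on UNIV G"
  proof (rule lipschitz_onI)
    fix x y
    show "dist (G x) (G y) \<le> 1 * dist x y"
      using F1[of "G x" "G y"] F1[of "G y" "G x"] monoD[OF mG, of x y] monoD[OF mG, of y x]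
      unfolding FG by (auto simp: dist_real_def abs_if)
  qed simp
  have lipF: "(2 * L + 1)-lipschitz_on UNIV F"
  proof (rule lipschitz_onI)
    fix x y
    show "dist (F x) (F y) \<le> (2 * L + 1) * dist x y"
      using F2[of x y] F2[of y x] monoD[OF mF, of x y] monoD[OF mF, of y x]
      by (auto simp: dist_real_def abs_if)
  qed (use L0 in simp)
  have quot: "(F (x + h) - F x) / h = (f (x + h) - f x) / h + (L + 1)" if "h \<noteq> 0" for x h
    using that by (simp add: F_def field_simps)
  have AB: "?A \<in> sets borel" "?B \<in> sets borel"
    using frequently_quotient_less_borel[OF contf, of 1 a] frequently_quotient_greater_borel[OF contf, of b 1] by auto
  define p where "p = a + L + 1"
  define q where "q = b + L + 1"
  have pq: "p < q" using ab by (simp add: p_def q_def)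
  have main: "?A \<inter> ?B \<inter> {- real m..real m} \<in> null_sets lborel" for m :: nat
  proof (cases "?A \<inter> ?B \<inter> {- real m..real m} = {}")
    case False
    let ?S = "?A \<inter> ?B \<inter> {- real m..real m}"
    have S: "?S \<in> sets borel" using AB by auto
    have FS_eq: "F ` X = G -` X" for X using FG GF by (auto simp: image_iff) metis
    have FS: "F ` ?S \<in> sets borel"
      unfolding FS_eq using measurable_sets[OF borel_measurable_continuous_onI[OF lipschitz_on_continuous_on[OF lipG]] S]
      by simp
    have GFS: "G ` (F ` ?S) = ?S" by (simp only: image_image GF image_ident)
    have A: "\<exists>s t. s < t \<and> t - s < d \<and> x \<in> {s..t} \<and> F t - F s \<le> p * (t - s)" if "x \<in> ?A" "d > 0" for x d
    proof -
      obtain h where h: "h \<noteq> 0" "\<bar>h\<bar> < d" "(f (x + h) - f x) / h < a"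
        using \<open>x \<in> ?A\<close> \<open>d > 0\<close> by (auto simp: frequently_at)
      then have *: "(F (x + h) - F x) / h \<le> p" using quot[of h x] by (simp add: p_def)
      show ?thesis
      proof (cases "h > 0")
        case True
        show ?thesis by (rule exI[of _ x], rule exI[of _ "x + h"]) (use h True * in \<open>auto simp: field_simps\<close>)
      next
        case False
        show ?thesis by (rule exI[of _ "x + h"], rule exI[of _ "x"]) (use h False * in \<open>auto simp: field_simps\<close>)
      qed
    qed
    have B: "\<exists>s t. s < t \<and> t - s < d \<and> x \<in> {s..t} \<and> q * (t - s) \<le> F t - F s" if "x \<in> ?B" "d > 0" for x d
    proof -
      obtain h where h: "h \<noteq> 0" "\<bar>h\<bar> < d" "b < (f (x + h) - f x) / h"
        using \<open>x \<in> ?B\<close> \<open>d > 0\<close> by (auto simp: frequently_at)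
      then have *: "q \<le> (F (x + h) - F x) / h" using quot[of h x] by (simp add: q_def)
      show ?thesis
      proof (cases "h > 0")
        case True
        show ?thesis by (rule exI[of _ x], rule exI[of _ "x + h"]) (use h True * in \<open>auto simp: field_simps\<close>)
      next
        case False
        show ?thesis by (rule exI[of _ "x + h"], rule exI[of _ "x"]) (use h False * in \<open>auto simp: field_simps\<close>)
      qed
    qed
    \<comment> \<open>A slope of at most p somewhere, against the lower slope bound 1 of F, forces p
      > 0. This needs a point of the set, which is why the empty case is split off.\<close>
    obtain x0 where "x0 \<in> ?A" using False by auto
    then obtain s t where "s < t" "F t - F s \<le> p * (t - s)" using A[of x0 1] by auto
    then have "0 < p * (t - s)" using F1[of s t] by linarith
    then have p0: "0 < p" using \<open>s < t\<close> by (simp add: zero_less_mult_iff)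
    have q0: "0 < q" using p0 pq by simp
    have 1: "emeasure lborel (F ` ?S) \<le> ennreal p * emeasure lborel ?S"
      by (rule emeasure_image_le[OF lipF mF p0 S FS]) (use A in auto)
    have 2: "emeasure lborel (G ` (F ` ?S)) \<le> ennreal (1/q) * emeasure lborel (F ` ?S)"
    proof (rule emeasure_image_le[OF lipG mG _ FS])
      show "G ` F ` ?S \<in> sets borel" unfolding GFS by (rule S)
      fix y d :: real assume "y \<in> F ` ?S" and d: "0 < d"
      then obtain x where x: "x \<in> ?B" "y = F x" by auto
      \<comment> \<open>The interval for G is \<open>{F s..F t}\<close>; dividing d by the Lipschitz
        constant \<open>2 * L + 1\<close> of F keeps it shorter than d.\<close>
      obtain s t where st: "s < t" "t - s < d / (2 * L + 1)" "x \<in> {s..t}" "q * (t - s) \<le> F t - F s"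
        using B[OF x(1), of "d / (2 * L + 1)"] d L0 by auto
      have "F t - F s \<le> (2 * L + 1) * (t - s)" using F2[of s t] st by simp
      also have "\<dots> < d" using st(2) L0 by (simp add: field_simps)
      finally have "F t - F s < d" .
      then show "\<exists>a b. a < b \<and> b - a < d \<and> y \<in> {a..b} \<and> G b - G a \<le> 1 / q * (b - a)"
        by (intro exI[of _ "F s"] exI[of _ "F t"])
           (use st q0 x monoD[OF mF] in \<open>auto simp: GF strict_monoD[OF sm] field_simps\<close>)
    qed (use q0 in simp)
    have "emeasure lborel ?S \<le> ennreal (1/q) * (ennreal p * emeasure lborel ?S)"
      using 2 mult_left_mono[OF 1, of "ennreal (1/q)"] unfolding GFS by simp
    also have "\<dots> = ennreal (p / q) * emeasure lborel ?S"
      using p0 q0 by (simp add: mult.assoc[symmetric] ennreal_mult''[symmetric])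
    finally have le: "emeasure lborel ?S \<le> ennreal (p / q) * emeasure lborel ?S" .
    \<comment> \<open>The cut to a bounded interval makes the measure finite, so that p < q forces
      it to be 0.\<close>
    have "emeasure lborel ?S \<le> emeasure lborel {- real m..real m}"
      by (rule emeasure_mono) auto
    then have "emeasure lborel ?S < \<infinity>" by (simp add: le_less_trans)
    then obtain r where r: "emeasure lborel ?S = ennreal r" "0 \<le> r"
      by (cases "emeasure lborel ?S") auto
    have "r \<le> p / q * r" using le p0 q0 r unfolding r(1)
      by (simp add: ennreal_mult''[symmetric] ennreal_le_iff)
    then have "q * r \<le> p * r" using q0 by (simp add: field_simps)
    then have "r = 0" using r(2) pq by (simp add: mult_le_cancel_right)
    then show ?thesis using r S by (auto intro!: null_setsI)
  qed auto
  have "?A \<inter> ?B = (\<Union>m::nat. ?A \<inter> ?B \<inter> {- real m..real m})"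
  proof -
    have "\<exists>m::nat. - real m \<le> x \<and> x \<le> real m" for x :: real
      using real_arch_simple[of "\<bar>x\<bar>"] by (metis abs_le_iff minus_le_iff)
    then show ?thesis by auto
  qed
  also have "\<dots> \<in> null_sets lborel" using main by (intro null_sets_UN)
  finally show ?thesis .
qed

lemma field_differentiable_quotient:
  fixes f :: "real \<Rightarrow> real"
  shows "f field_differentiable (at x) \<longleftrightarrow> (\<exists>l. ((\<lambda>h. (f (x + h) - f x) / h) \<longlongrightarrow> l) (at 0))"
  by (simp add: field_differentiable_def DERIV_def)

text \<open>Rational thresholds turn nondifferentiability into a countable union. This serves twice:
  for the null set on the line and for Borel measurability of the exceptional set in several
  variables.\<close>

lemma lipschitz_not_differentiable_iff:
  fixes f :: "real \<Rightarrow> real"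
  assumes lip: "L-lipschitz_on UNIV f"
  shows "\<not> f field_differentiable (at x) \<longleftrightarrow>
    (\<exists>a\<in>\<rat>. \<exists>b\<in>\<rat>. a < b \<and> (\<exists>\<^sub>F h in at 0. (f (x + h) - f x) / h < a) \<and> (\<exists>\<^sub>F h in at 0. b < (f (x + h) - f x) / h))"
    (is "_ \<longleftrightarrow> ?R")
proof
  assume "\<not> f field_differentiable (at x)"
  then have no: "\<not> (\<exists>l. ((\<lambda>h. (f (x + h) - f x) / h) \<longlongrightarrow> l) (at 0))"
    by (simp add: field_differentiable_quotient)
  have "\<bar>(f (x + h) - f x) / h\<bar> \<le> L" for h
    using lip lipschitz_onD[OF lip, of "x + h" x] lipschitz_on_nonneg[OF lip]
    by (cases "h = 0") (auto simp: dist_real_def field_simps)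
  from this no show ?R by (rule bounded_no_limit_gap) blast
next
  assume ?R
  then obtain a b where ab: "a < b" "\<exists>\<^sub>F h in at 0. (f (x + h) - f x) / h < a" "\<exists>\<^sub>F h in at 0. b < (f (x + h) - f x) / h"
    by blast
  show "\<not> f field_differentiable (at x)"
  proof
    assume "f field_differentiable (at x)"
    then obtain l where l: "((\<lambda>h. (f (x + h) - f x) / h) \<longlongrightarrow> l) (at 0)"
      by (auto simp: field_differentiable_quotient)
    have "l \<le> a"
    proof (rule ccontr)
      assume "\<not> l \<le> a"
      then have "\<forall>\<^sub>F h in at 0. a < (f (x + h) - f x) / h" using l by (intro order_tendstoD) auto
      then have "\<forall>\<^sub>F h in at 0. \<not> (f (x + h) - f x) / h < a" by (rule eventually_mono) simp
      then show False using ab(2) by (simp add: frequently_def)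
    qed
    moreover have "b \<le> l"
    proof (rule ccontr)
      assume "\<not> b \<le> l"
      then have "\<forall>\<^sub>F h in at 0. (f (x + h) - f x) / h < b" using l by (intro order_tendstoD) auto
      then have "\<forall>\<^sub>F h in at 0. \<not> b < (f (x + h) - f x) / h" by (rule eventually_mono) simp
      then show False using ab(3) by (simp add: frequently_def)
    qed
    ultimately show False using ab by simp
  qed
qed

lemma lipschitz_AE_differentiable_real:
  fixes f :: "real \<Rightarrow> real"
  assumes lip: "L-lipschitz_on UNIV f"
  shows "AE x in lborel. f field_differentiable (at x)"
proof -
  have "AE x in lborel. \<forall>ab\<in>\<rat>\<times>\<rat>. fst ab < snd ab \<longrightarrow> \<not> ((\<exists>\<^sub>F h in at 0. (f (x + h) - f x) / h < fst ab) \<and> (\<exists>\<^sub>F h in at 0. snd ab < (f (x + h) - f x) / h))"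
  proof (subst AE_ball_countable, intro countable_SIGMA countable_rat, intro ballI)
    fix ab :: "real \<times> real"
    show "AE x in lborel. fst ab < snd ab \<longrightarrow> \<not> ((\<exists>\<^sub>F h in at 0. (f (x + h) - f x) / h < fst ab) \<and> (\<exists>\<^sub>F h in at 0. snd ab < (f (x + h) - f x) / h))"
    proof (cases "fst ab < snd ab")
      case True
      show ?thesis by (rule AE_I'[OF lipschitz_oscillation_null[OF lip True]]) auto
    qed simp
  qed
  then show ?thesis
  proof (rule AE_mp, intro AE_I2 impI)
    fix x assume *: "\<forall>ab\<in>\<rat>\<times>\<rat>. fst ab < snd ab \<longrightarrow> \<not> ((\<exists>\<^sub>F h in at 0. (f (x + h) - f x) / h < fst ab) \<and> (\<exists>\<^sub>F h in at 0. snd ab < (f (x + h) - f x) / h))"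
    show "f field_differentiable (at x)"
      using lipschitz_not_differentiable_iff[OF lip, of x] * by fastforce
  qed
qed

section \<open>Partial derivatives of Lipschitz functions of several variables\<close>

lemma partial_exists_shift:
  "partial_exists u i (x + t *\<^sub>R axis i 1) \<longleftrightarrow> (\<lambda>s. u (x + s *\<^sub>R axis i 1)) field_differentiable (at t)"
proof -
  have *: "x + t *\<^sub>R axis i 1 + s *\<^sub>R axis i 1 = x + (t + s) *\<^sub>R axis i 1" for s
    by (simp add: scaleR_add_left)
  show ?thesis unfolding partial_exists_def field_differentiable_quotient * by simp
qed

lemma lipschitz_line:
  fixes u :: "real ^ 'n \<Rightarrow> real"
  assumes "L-lipschitz_on UNIV u"
  shows "L-lipschitz_on UNIV (\<lambda>t. u (x + t *\<^sub>R axis i 1))"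
proof (rule lipschitz_onI)
  fix s t :: real
  show "dist (u (x + s *\<^sub>R axis i 1)) (u (x + t *\<^sub>R axis i 1)) \<le> L * dist s t"
    using lipschitz_onD[OF assms, of "x + s *\<^sub>R axis i 1" "x + t *\<^sub>R axis i 1"]
    by (simp add: dist_norm scaleR_diff_left[symmetric])
qed (use lipschitz_on_nonneg[OF assms] in simp)

lemma partial_exists_borel:
  fixes u :: "real ^ 'n::finite \<Rightarrow> real"
  assumes lip: "L-lipschitz_on UNIV u"
  shows "{x. \<not> partial_exists u i x} \<in> sets borel"
proof -
  note cont = lipschitz_on_continuous_on[OF lip]
  have "{x. \<not> partial_exists u i x} = (\<Union>a\<in>\<rat>. \<Union>b\<in>{b\<in>\<rat>. a < b}.
     {x. \<exists>\<^sub>F h in at 0. (u (x + h *\<^sub>R axis i 1) - u x) / h < a} \<inter>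
     {x. \<exists>\<^sub>F h in at 0. b < (u (x + h *\<^sub>R axis i 1) - u x) / h})"
    unfolding partial_exists_def lipschitz_not_differentiable_iff[OF lipschitz_line[OF lip]]
    by (simp only: add_0_left scaleR_zero_left add_0_right) blast
  also have "\<dots> \<in> sets borel"
    by (intro sets.countable_UN' ballI sets.Int frequently_quotient_less_borel
         frequently_quotient_greater_borel cont countable_rat countable_subset[OF _ countable_rat]
         subsetI image_subsetI) auto
  finally show ?thesis .
qed

lemma nn_integral_translate:
  fixes f :: "'a::euclidean_space \<Rightarrow> ennreal"
  assumes [measurable]: "f \<in> borel_measurable borel"
  shows "(\<integral>\<^sup>+x. f (x + z) \<partial>lborel) = (\<integral>\<^sup>+x. f x \<partial>lborel)"
proof -
  have "(\<integral>\<^sup>+x. f x \<partial>lborel) = (\<integral>\<^sup>+x. f x \<partial>distr lborel borel ((+) z))"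
    by (simp add: lborel_distr_plus)
  also have "\<dots> = (\<integral>\<^sup>+x. f (x + z) \<partial>lborel)"
    by (subst nn_integral_distr) (auto simp: add.commute)
  finally show ?thesis by simp
qed

text \<open>Averaging the indicator of the exceptional set over unit translations in the coordinate
  direction reduces this to the one-dimensional case without splitting off a coordinate.\<close>

lemma lipschitz_AE_partial_exists:
  fixes u :: "real ^ 'n::finite \<Rightarrow> real"
  assumes lip: "L-lipschitz_on UNIV u"
  shows "AE x in lborel. partial_exists u i x"
proof -
  let ?N = "{x. \<not> partial_exists u i x}"
  have [measurable]: "?N \<in> sets borel" by (rule partial_exists_borel[OF lip])
  have "emeasure lborel ?N = (\<integral>\<^sup>+x. indicator ?N x \<partial>lborel)" by simp
  also have "\<dots> = (\<integral>\<^sup>+t. indicator {0..1} t * (\<integral>\<^sup>+x. indicator ?N x \<partial>lborel) \<partial>(lborel :: real measure))"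
    by (simp add: nn_integral_multc)
  also have "\<dots> = (\<integral>\<^sup>+t. indicator {0..1} t * (\<integral>\<^sup>+x. indicator ?N (x + t *\<^sub>R axis i 1) \<partial>lborel) \<partial>(lborel :: real measure))"
    by (subst nn_integral_translate) auto
  also have "\<dots> = (\<integral>\<^sup>+t. (\<integral>\<^sup>+x. indicator {0..1} t * indicator ?N (x + t *\<^sub>R axis i 1) \<partial>lborel) \<partial>(lborel :: real measure))"
    by (subst nn_integral_cmult) (auto, measurable)
  also have "\<dots> = (\<integral>\<^sup>+x. (\<integral>\<^sup>+t. indicator {0..1} t * indicator ?N (x + t *\<^sub>R axis i 1) \<partial>(lborel :: real measure)) \<partial>lborel)"
    by (rule lborel_pair.Fubini') measurable
  also have "\<dots> = (\<integral>\<^sup>+x. 0 \<partial>(lborel :: (real ^ 'n) measure))"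
  proof (rule nn_integral_cong)
    fix x :: "real ^ 'n"
    have "AE t in lborel. x + t *\<^sub>R axis i 1 \<notin> ?N"
      using lipschitz_AE_differentiable_real[OF lipschitz_line[OF lip, of x i]]
      by (simp add: partial_exists_shift)
    then have "(\<integral>\<^sup>+t. indicator {0..1} t * indicator ?N (x + t *\<^sub>R axis i 1) \<partial>(lborel :: real measure)) = (\<integral>\<^sup>+t. 0 \<partial>(lborel :: real measure))"
      by (intro nn_integral_cong_AE) (auto elim: AE_mp)
    then show "(\<integral>\<^sup>+t. indicator {0..1} t * indicator ?N (x + t *\<^sub>R axis i 1) \<partial>(lborel :: real measure)) = 0"
      by simp
  qed
  finally have "?N \<in> null_sets lborel" by (auto intro!: null_setsI)
  then show ?thesis by (rule AE_I') auto
qed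

section \<open>Lipschitz functions with compact support: energy and capacity\<close>

definition energy :: "(real ^ 'n::finite \<Rightarrow> real) \<Rightarrow> ennreal" where
  "energy u = (\<integral>\<^sup>+x. ennreal ((norm (gradient u x))\<^sup>2) \<partial>lborel)"

definition lip_comp :: "(real ^ 'n::finite \<Rightarrow> real) \<Rightarrow> bool" where
  "lip_comp u \<longleftrightarrow> (\<exists>L. L-lipschitz_on UNIV u) \<and> compact (supp u)"

text \<open>Carries the value of the derivative as an argument, so that the rules can be stated
  without \<open>deriv\<close>, whose value is unspecified where no derivative exists.\<close>

abbreviation has_partial :: "(real ^ 'n::finite \<Rightarrow> real) \<Rightarrow> 'n \<Rightarrow> real ^ 'n \<Rightarrow> real \<Rightarrow> bool" where
  "has_partial u i x l \<equiv> ((\<lambda>t. u (x + t *\<^sub>R axis i 1)) has_real_derivative l) (at 0)"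

lemma compact_supp_iff:
  fixes u :: "real ^ 'n::finite \<Rightarrow> real"
  shows "compact (supp u) \<longleftrightarrow> (\<exists>R. \<forall>x. R < norm x \<longrightarrow> u x = 0)"
proof
  assume "compact (supp u)"
  then have "bounded {x. u x \<noteq> 0}"
    unfolding supp_def by (meson bounded_subset closure_subset compact_imp_bounded)
  then show "\<exists>R. \<forall>x. R < norm x \<longrightarrow> u x = 0"
    unfolding bounded_iff by (metis (mono_tags) linorder_not_le mem_Collect_eq)
next
  assume "\<exists>R. \<forall>x. R < norm x \<longrightarrow> u x = 0"
  then have "bounded {x. u x \<noteq> 0}"
    unfolding bounded_iff by (metis (mono_tags) linorder_not_le mem_Collect_eq)
  then show "compact (supp u)"
    unfolding supp_def by (simp add: bounded_closure compact_eq_bounded_closed)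
qed

lemma lip_compI:
  assumes "L-lipschitz_on UNIV u" "\<And>x. R < norm x \<Longrightarrow> u x = 0"
  shows "lip_comp u"
  unfolding lip_comp_def compact_supp_iff using assms by blast

lemma lip_compE:
  fixes u :: "real ^ 'n::finite \<Rightarrow> real"
  assumes "lip_comp u"
  obtains L R where "L-lipschitz_on UNIV u" "0 \<le> L" "0 \<le> R" "\<And>x. R < norm x \<Longrightarrow> u x = 0"
proof -
  obtain L R where LR: "L-lipschitz_on UNIV u" "\<And>x. R < norm x \<Longrightarrow> u x = 0"
    using assms unfolding lip_comp_def compact_supp_iff by blast
  show ?thesis
    by (rule that[of L "max R 0"]) (use LR lipschitz_on_nonneg[OF LR(1)] in auto)
qed

lemma lip_comp_bounded:
  assumes "lip_comp u"
  obtains M where "0 \<le> M" "\<And>x. \<bar>u x\<bar> \<le> M"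
proof -
  obtain L R where LR: "L-lipschitz_on UNIV u" "0 \<le> L" "0 \<le> R" "\<And>x. R < norm x \<Longrightarrow> u x = 0"
    using assms by (rule lip_compE) blast
  have "\<bar>u x\<bar> \<le> \<bar>u 0\<bar> + L * R" for x
  proof (cases "R < norm x")
    case False
    have "\<bar>u x - u 0\<bar> \<le> L * norm x"
      using lipschitz_onD[OF LR(1), of x 0] by (simp add: dist_norm)
    also have "\<dots> \<le> L * R" using False LR by (intro mult_left_mono) auto
    finally show ?thesis by linarith
  qed (use LR in auto)
  then show ?thesis using that[of "\<bar>u 0\<bar> + L * R"] LR by force
qed

lemma lipschitz_on_realI:
  fixes u :: "'a::real_normed_vector \<Rightarrow> real"
  assumes "\<And>x y. \<bar>u x - u y\<bar> \<le> L * norm (x - y)" "0 \<le> L"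
  shows "L-lipschitz_on UNIV u"
  using assms by (intro lipschitz_onI) (auto simp: dist_norm)

lemma lipschitz_on_realD:
  fixes u :: "'a::real_normed_vector \<Rightarrow> real"
  assumes "L-lipschitz_on UNIV u"
  shows "\<bar>u x - u y\<bar> \<le> L * norm (x - y)"
  using lipschitz_onD[OF assms, of x y] by (simp add: dist_norm)

text \<open>The factor g may be unbounded. The splitting
  \<open>(u x - u y) * g x + u y * (g x - g y)\<close> uses the size of g only at x, and x may be
  taken in the ball outside which u vanishes.\<close>

lemma lip_comp_mult:
  fixes u g :: "real ^ 'n::finite \<Rightarrow> real"
  assumes u: "lip_comp u" and g: "M-lipschitz_on UNIV g"
  shows "lip_comp (\<lambda>x. u x * g x)"
proof -
  obtain L R where LR: "L-lipschitz_on UNIV u" "0 \<le> L" "0 \<le> R" "\<And>x. R < norm x \<Longrightarrow> u x = 0"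
    using u by (rule lip_compE) blast
  obtain B where B: "0 \<le> B" "\<And>x. \<bar>u x\<bar> \<le> B" using u by (rule lip_comp_bounded) blast
  have M: "0 \<le> M" using g by (rule lipschitz_on_nonneg)
  define G where "G = \<bar>g 0\<bar> + M * R"
  have G: "\<bar>g x\<bar> \<le> G" if "norm x \<le> R" for x
  proof -
    have "\<bar>g x - g 0\<bar> \<le> M * norm x" using lipschitz_on_realD[OF g, of x 0] by simp
    also have "\<dots> \<le> M * R" using that M by (intro mult_left_mono) auto
    finally show ?thesis by (simp add: G_def)
  qed
  have G0: "0 \<le> G" using M LR by (simp add: G_def)
  have main: "\<bar>u x * g x - u y * g y\<bar> \<le> (L * G + B * M) * norm (x - y)" if "norm x \<le> R" for x y
  proof -
    have "u x * g x - u y * g y = (u x - u y) * g x + u y * (g x - g y)" by (simp add: algebra_simps)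
    also have "\<bar>\<dots>\<bar> \<le> \<bar>u x - u y\<bar> * \<bar>g x\<bar> + \<bar>u y\<bar> * \<bar>g x - g y\<bar>"
      by (simp add: abs_mult[symmetric] abs_triangle_ineq)
    also have "\<dots> \<le> (L * norm (x - y)) * G + B * (M * norm (x - y))"
      using LR B M G[OF that] by (intro add_mono mult_mono lipschitz_on_realD[OF LR(1)] lipschitz_on_realD[OF g]) auto
    finally show ?thesis by (simp add: algebra_simps)
  qed
  show ?thesis
  proof (rule lip_compI[of "L * G + B * M" _ R])
    show "(L * G + B * M)-lipschitz_on UNIV (\<lambda>x. u x * g x)"
    proof (rule lipschitz_on_realI)
      fix x y :: "real ^ 'n"
      consider "norm x \<le> R" | "norm y \<le> R" | "R < norm x" "R < norm y" by linarith
      then show "\<bar>u x * g x - u y * g y\<bar> \<le> (L * G + B * M) * norm (x - y)"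
      proof cases
        case 2
        then show ?thesis using main[of y x] by (simp add: abs_minus_commute norm_minus_commute)
      next
        case 3
        then show ?thesis using LR B M G0 by simp
      qed (rule main)
    qed (use LR B M G0 in simp)
  qed (use LR in auto)
qed

lemma lip_comp_compose:
  assumes u: "lip_comp u" and v: "\<And>x y. \<bar>v x - v y\<bar> \<le> M * \<bar>u x - u y\<bar>" and 0: "\<And>x. u x = 0 \<Longrightarrow> v x = 0" and M: "0 \<le> M"
  shows "lip_comp v"
proof -
  obtain L R where LR: "L-lipschitz_on UNIV u" "0 \<le> L" "0 \<le> R" "\<And>x. R < norm x \<Longrightarrow> u x = 0"
    using u by (rule lip_compE) blast
  show ?thesis
  proof (rule lip_compI[of "M * L" _ R])
    show "(M * L)-lipschitz_on UNIV v"
    proof (rule lipschitz_on_realI)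
      fix x y
      show "\<bar>v x - v y\<bar> \<le> M * L * norm (x - y)"
        using v[of x y] mult_left_mono[OF lipschitz_on_realD[OF LR(1), of x y] M] by (simp add: mult.assoc)
    qed (use LR M in simp)
  qed (use LR 0 in auto)
qed

lemma lip_comp_affine:
  fixes u :: "real ^ 'n::finite \<Rightarrow> real"
  assumes u: "lip_comp u" and r: "0 < r"
  shows "lip_comp (\<lambda>x. u (c + r *\<^sub>R x))"
proof -
  obtain L R where LR: "L-lipschitz_on UNIV u" "0 \<le> L" "0 \<le> R" "\<And>x. R < norm x \<Longrightarrow> u x = 0"
    using u by (rule lip_compE) blast
  show ?thesis
  proof (rule lip_compI[of "L * r" _ "(R + norm c) / r"])
    show "(L * r)-lipschitz_on UNIV (\<lambda>x. u (c + r *\<^sub>R x))"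
    proof (rule lipschitz_on_realI)
      fix x y
      show "\<bar>u (c + r *\<^sub>R x) - u (c + r *\<^sub>R y)\<bar> \<le> L * r * norm (x - y)"
        using lipschitz_on_realD[OF LR(1), of "c + r *\<^sub>R x" "c + r *\<^sub>R y"] r
        by (simp add: scaleR_diff_right[symmetric])
    qed (use LR r in simp)
    fix x :: "real ^ 'n" assume "(R + norm c) / r < norm x"
    then have "R + norm c < norm (r *\<^sub>R x)" using r by (simp add: field_simps)
    then have "R < norm (c + r *\<^sub>R x)"
      using norm_diff_ineq[of "r *\<^sub>R x" c] by (simp add: add.commute)
    then show "u (c + r *\<^sub>R x) = 0" by (rule LR)
  qed
qed

section \<open>Partial derivatives almost everywhere: rules, measurability, energy\<close>

lemma has_partial_partial_deriv:
  "partial_exists u i x \<Longrightarrow> has_partial u i x (partial_deriv i u x)"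
  unfolding partial_exists_def partial_deriv_def by (simp add: DERIV_deriv_iff_field_differentiable)

lemma has_partial_imp:
  assumes "has_partial u i x l"
  shows "partial_deriv i u x = l"
  using assms unfolding partial_deriv_def by (simp add: DERIV_imp_deriv)

lemma has_partial_exists:
  assumes "has_partial u i x l"
  shows "partial_exists u i x"
  using assms unfolding partial_exists_def by (auto simp: field_differentiable_def)

lemma lipschitz_AE_partials:
  fixes u :: "real ^ 'n::finite \<Rightarrow> real"
  assumes "L-lipschitz_on UNIV u"
  shows "AE x in lborel. \<forall>i. has_partial u i x (partial_deriv i u x)"
proof -
  have "AE x in lborel. \<forall>i\<in>UNIV. partial_exists u i x"
    by (rule AE_finite_allI) (use lipschitz_AE_partial_exists[OF assms] in auto)
  then show ?thesis by (rule AE_mp) (auto intro!: AE_I2 has_partial_partial_deriv)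
qed

lemma lip_comp_AE_partials:
  "lip_comp u \<Longrightarrow> AE x in lborel. \<forall>i. has_partial u i x (partial_deriv i u x)"
  by (erule lip_compE) (rule lipschitz_AE_partials)

lemma has_partial_quotient:
  assumes "has_partial u i x l"
  shows "((\<lambda>h. (u (x + h *\<^sub>R axis i 1) - u x) / h) \<longlongrightarrow> l) (at 0)"
  using assms by (simp add: DERIV_def)

text \<open>Steps along a sequence are what dominated convergence needs; multiplying by the index
  instead of dividing by the step admits s = 0.\<close>

lemma has_partial_quotient_seq:
  assumes "has_partial u i x l"
  shows "(\<lambda>k. (u (x + (s / Suc k) *\<^sub>R axis i 1) - u x) * (real (Suc k))) \<longlonglongrightarrow> s * l"
proof (cases "s = 0")
  case False
  have "filterlim (\<lambda>k. s / real (Suc k)) (at 0) sequentially"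
  proof (rule filterlim_atI)
    show "(\<lambda>k. s / real (Suc k)) \<longlonglongrightarrow> 0"
      using LIMSEQ_Suc[OF lim_const_over_n[of s]] by simp
  qed (use False in simp)
  from filterlim_compose[OF has_partial_quotient[OF assms] this]
  have "(\<lambda>k. s * ((u (x + (s / real (Suc k)) *\<^sub>R axis i 1) - u x) / (s / real (Suc k)))) \<longlonglongrightarrow> s * l"
    by (intro tendsto_mult tendsto_const)
  then show ?thesis using False by (simp del: of_nat_Suc)
qed simp

lemma has_partial_le:
  assumes v: "has_partial v i x l" and u: "has_partial u i x m"
    and le: "\<And>y. \<bar>v y - v x\<bar> \<le> M * \<bar>u y - u x\<bar>"
  shows "\<bar>l\<bar> \<le> M * \<bar>m\<bar>"
proof -
  have "((\<lambda>h. \<bar>(v (x + h *\<^sub>R axis i 1) - v x) / h\<bar>) \<longlongrightarrow> \<bar>l\<bar>) (at 0)"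
    by (intro tendsto_rabs has_partial_quotient v)
  moreover have "((\<lambda>h. M * \<bar>(u (x + h *\<^sub>R axis i 1) - u x) / h\<bar>) \<longlongrightarrow> M * \<bar>m\<bar>) (at 0)"
    by (intro tendsto_intros has_partial_quotient u)
  moreover have "\<bar>(v (x + h *\<^sub>R axis i 1) - v x) / h\<bar> \<le> M * \<bar>(u (x + h *\<^sub>R axis i 1) - u x) / h\<bar>" for h
    using divide_right_mono[OF le[of "x + h *\<^sub>R axis i 1"], of "\<bar>h\<bar>"] by (simp add: abs_divide)
  ultimately show ?thesis
    by (intro tendsto_le[of "at 0"]) auto
qed

lemma has_partial_lipschitz:
  assumes lip: "L-lipschitz_on UNIV u" and u: "has_partial u i x l"
  shows "\<bar>l\<bar> \<le> L"
proof -
  have 1: "((\<lambda>h. \<bar>(u (x + h *\<^sub>R axis i 1) - u x) / h\<bar>) \<longlongrightarrow> \<bar>l\<bar>) (at 0)"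
    by (intro tendsto_rabs has_partial_quotient u)
  have 2: "\<bar>(u (x + h *\<^sub>R axis i 1) - u x) / h\<bar> \<le> L" for h
    using lipschitz_on_realD[OF lip, of "x + h *\<^sub>R axis i 1" x] lipschitz_on_nonneg[OF lip]
    by (cases "h = 0") (auto simp: field_simps)
  show ?thesis
    by (rule tendsto_upperbound[OF 1 always_eventually]) (intro allI 2, simp)
qed

lemma has_partial_local:
  assumes "open S" "x \<in> S" "\<And>y. y \<in> S \<Longrightarrow> u y = v y"
  shows "has_partial u i x l \<longleftrightarrow> has_partial v i x l"
proof (rule DERIV_cong_ev)
  have "((\<lambda>t. x + t *\<^sub>R axis i 1) \<longlongrightarrow> x + 0 *\<^sub>R axis i 1) (at (0::real))"
    by (intro tendsto_intros)
  then have "((\<lambda>t. x + t *\<^sub>R axis i 1) \<longlongrightarrow> x) (nhds (0::real))"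
    by (simp add: tendsto_nhds_iff)
  then have "\<forall>\<^sub>F t in nhds (0::real). x + t *\<^sub>R axis i 1 \<in> S"
    using assms by (auto simp: tendsto_def)
  then show "\<forall>\<^sub>F t in nhds 0. u (x + t *\<^sub>R axis i 1) = v (x + t *\<^sub>R axis i 1)"
    by (rule eventually_mono) (rule assms)
qed simp_all

lemma partial_deriv_zero_outside:
  fixes u :: "real ^ 'n::finite \<Rightarrow> real"
  assumes "x \<notin> supp u"
  shows "partial_deriv i u x = 0"
proof (rule has_partial_imp)
  have "has_partial u i x 0 \<longleftrightarrow> has_partial (\<lambda>_. 0) i x 0"
    by (rule has_partial_local[of "- supp u"]) (use assms closure_subset[of "{x. u x \<noteq> 0}"] in \<open>auto simp: supp_def\<close>)
  then show "has_partial u i x 0" by simp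
qed

lemma partial_deriv_zero_norm:
  fixes u :: "real ^ 'n::finite \<Rightarrow> real"
  assumes "\<And>x. R < norm x \<Longrightarrow> u x = 0" "R < norm x"
  shows "partial_deriv i u x = 0"
proof (rule has_partial_imp)
  have "has_partial u i x 0 \<longleftrightarrow> has_partial (\<lambda>_. 0) i x 0"
    by (rule has_partial_local[of "{x. R < norm x}"])
       (use assms in \<open>auto intro!: open_Collect_less continuous_intros\<close>)
  then show "has_partial u i x 0" by simp
qed

lemma partial_deriv_measurable:
  fixes u :: "real ^ 'n::finite \<Rightarrow> real"
  assumes lip: "L-lipschitz_on UNIV u"
  shows "partial_deriv i u \<in> borel_measurable borel"
proof -
  have [measurable]: "u \<in> borel_measurable borel"
    by (intro borel_measurable_continuous_onI lipschitz_on_continuous_on[OF lip])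
  have P[measurable]: "{x. \<not> partial_exists u i x} \<in> sets borel"
    by (rule partial_exists_borel[OF lip])
  \<comment> \<open>Where no derivative exists, \<open>deriv\<close> chooses from the empty
    predicate, so its value there is one constant; elsewhere the derivative is a pointwise limit of
    measurable quotients.\<close>
  have "partial_deriv i u = (\<lambda>x. if x \<in> {x. \<not> partial_exists u i x} then (SOME D::real. False)
     else lim (\<lambda>k. (u (x + (1 / Suc k) *\<^sub>R axis i 1) - u x) * (real (Suc k))))"
  proof
    fix x
    show "partial_deriv i u x = (if x \<in> {x. \<not> partial_exists u i x} then (SOME D::real. False)
     else lim (\<lambda>k. (u (x + (1 / Suc k) *\<^sub>R axis i 1) - u x) * (real (Suc k))))"
    proof (cases "partial_exists u i x")
      case True
      from has_partial_quotient_seq[OF has_partial_partial_deriv[OF True], of 1] show ?thesis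
        using True by (simp add: limI)
    next
      case False
      then have "\<And>D. \<not> ((\<lambda>t. u (x + t *\<^sub>R axis i 1)) has_field_derivative D) (at 0)"
        by (auto simp: partial_exists_def field_differentiable_def)
      then have "(\<lambda>D. ((\<lambda>t. u (x + t *\<^sub>R axis i 1)) has_field_derivative D) (at 0)) = (\<lambda>D. False)" by auto
      then show ?thesis using False by (simp add: partial_deriv_def deriv_def)
    qed
  qed
  also have "\<dots> \<in> borel_measurable borel"
    by measurable
  finally show ?thesis .
qed

lemma lip_comp_measurable:
  assumes "lip_comp u"
  shows "partial_deriv i u \<in> borel_measurable borel" "u \<in> borel_measurable borel" "continuous_on UNIV u"
  using assms partial_deriv_measurable lipschitz_on_continuous_on borel_measurable_continuous_onI
  by (metis lip_comp_def)+

lemma norm_gradient_eq: "(norm (gradient u x))\<^sup>2 = (\<Sum>i\<in>UNIV. (partial_deriv i u x)\<^sup>2)"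
  by (simp add: gradient_def norm_vec_def L2_set_def sum_nonneg)

lemma norm_gradient_square_measurable:
  assumes "lip_comp u"
  shows "(\<lambda>x. (norm (gradient u x))\<^sup>2) \<in> borel_measurable borel"
  unfolding norm_gradient_eq using lip_comp_measurable[OF assms] by measurable

lemma norm_gradient_measurable:
  assumes "lip_comp u"
  shows "(\<lambda>x. norm (gradient u x)) \<in> borel_measurable borel"
proof -
  have "(\<lambda>x. sqrt ((norm (gradient u x))\<^sup>2)) \<in> borel_measurable borel"
    by (rule measurable_compose[OF norm_gradient_square_measurable[OF assms] borel_measurable_sqrt])
  then show ?thesis by simp
qed

lemma integrable_bounded_compact_support:
  fixes u :: "real ^ 'n::finite \<Rightarrow> real"
  assumes m: "f \<in> borel_measurable borel" and 0: "\<And>x. R < norm x \<Longrightarrow> f x = (0::real)"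
    and bd: "AE x in lborel. \<bar>f x\<bar> \<le> M"
  shows "integrable lborel (f :: real ^ 'n::finite \<Rightarrow> real)"
proof (rule Bochner_Integration.integrable_bound)
  show "integrable lborel (\<lambda>x. M * indicator (cball 0 R) x :: real)"
    by (intro integrable_mult_right integrable_real_indicator emeasure_lborel_cball_finite) auto
  show "f \<in> borel_measurable lborel" using m by simp
  show "AE x in lborel. norm (f x) \<le> norm (M * indicator (cball (0::real^'n) R) x :: real)"
    using bd
  proof (rule AE_mp, intro AE_I2 impI)
    fix x :: "real ^ 'n" assume "\<bar>f x\<bar> \<le> M"
    then show "norm (f x) \<le> norm (M * indicator (cball (0::real^'n) R) x :: real)"
      using 0[of x] by (cases "R < norm x") (auto simp: indicator_def)
  qed
qed

lemma lip_comp_partial_bounded: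
  assumes "lip_comp u"
  obtains L where "0 \<le> L" "AE x in lborel. \<forall>i. \<bar>partial_deriv i u x\<bar> \<le> L"
proof -
  obtain L R where LR: "L-lipschitz_on UNIV u" "0 \<le> L" "0 \<le> R" "\<And>x. R < norm x \<Longrightarrow> u x = 0"
    using assms by (rule lip_compE) blast
  have "AE x in lborel. \<forall>i. \<bar>partial_deriv i u x\<bar> \<le> L"
    using lipschitz_AE_partials[OF LR(1)]
    by (rule AE_mp) (auto intro!: AE_I2 has_partial_lipschitz[OF LR(1)])
  with LR that show ?thesis by blast
qed

lemma integrable_partial_square:
  assumes "lip_comp u"
  shows "integrable lborel (\<lambda>x. (partial_deriv i u x)\<^sup>2)"
proof -
  obtain L R where LR: "L-lipschitz_on UNIV u" "0 \<le> L" "0 \<le> R" "\<And>x. R < norm x \<Longrightarrow> u x = 0"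
    using assms by (rule lip_compE) blast
  obtain M where M: "0 \<le> M" "AE x in lborel. \<forall>i. \<bar>partial_deriv i u x\<bar> \<le> M"
    using assms by (rule lip_comp_partial_bounded) blast
  show ?thesis
  proof (rule integrable_bounded_compact_support)
    show "(\<lambda>x. (partial_deriv i u x)\<^sup>2) \<in> borel_measurable borel"
      using lip_comp_measurable[OF assms] by measurable
    show "(partial_deriv i u x)\<^sup>2 = 0" if "R < norm x" for x
      using partial_deriv_zero_norm[OF LR(4) that] by simp
    show "AE x in lborel. \<bar>(partial_deriv i u x)\<^sup>2\<bar> \<le> M\<^sup>2"
      using M(2) by (rule AE_mp) (auto intro!: AE_I2 simp: abs_le_square_iff[symmetric] M(1))
  qed
qed

lemma integrable_norm_gradient:
  assumes "lip_comp u"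
  shows "integrable lborel (\<lambda>x. (norm (gradient u x))\<^sup>2)"
  unfolding norm_gradient_eq by (intro Bochner_Integration.integrable_sum integrable_partial_square assms)

lemma energy_eq_integral:
  assumes "lip_comp u"
  shows "energy u = ennreal (\<integral>x. (norm (gradient u x))\<^sup>2 \<partial>lborel)"
  unfolding energy_def by (rule nn_integral_eq_integral[OF integrable_norm_gradient[OF assms]]) simp

lemma energy_finite: "lip_comp u \<Longrightarrow> energy u < \<infinity>"
  by (simp add: energy_eq_integral)

lemma energy_eq_sum:
  assumes "lip_comp u"
  shows "energy u = (\<Sum>i\<in>UNIV. \<integral>\<^sup>+x. ennreal ((partial_deriv i u x)\<^sup>2) \<partial>lborel)"
proof -
  note [measurable] = lip_comp_measurable[OF assms]
  show ?thesis
    unfolding energy_def norm_gradient_eq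
    by (subst nn_integral_sum[symmetric]) (auto simp: sum_ennreal)
qed

text \<open>Difference quotients are compared at the points where both functions have partial
  derivatives, so truncations require no chain rule. The uses are M = 1 for truncation alone and M =
  1/t for division by t followed by truncation.\<close>

lemma energy_contraction:
  fixes u v :: "real ^ 'n::finite \<Rightarrow> real"
  assumes u: "lip_comp u" and v: "lip_comp v" and le: "\<And>x y. \<bar>v y - v x\<bar> \<le> M * \<bar>u y - u x\<bar>"
  shows "energy v \<le> ennreal (M\<^sup>2) * energy u"
proof -
  note [measurable] = norm_gradient_square_measurable[OF u]
  have "energy v \<le> (\<integral>\<^sup>+x. ennreal (M\<^sup>2) * ennreal ((norm (gradient u x))\<^sup>2) \<partial>lborel)"
    unfolding energy_def
  proof (rule nn_integral_mono_AE)
    show "AE x in lborel. ennreal ((norm (gradient v x))\<^sup>2) \<le> ennreal (M\<^sup>2) * ennreal ((norm (gradient u x))\<^sup>2)"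
      using lip_comp_AE_partials[OF u] lip_comp_AE_partials[OF v]
    proof eventually_elim
      case (elim x)
      have "(norm (gradient v x))\<^sup>2 \<le> (\<Sum>i\<in>UNIV. M\<^sup>2 * (partial_deriv i u x)\<^sup>2)"
        unfolding norm_gradient_eq
      proof (rule sum_mono)
        fix i :: 'n
        have "\<bar>partial_deriv i v x\<bar> \<le> M * \<bar>partial_deriv i u x\<bar>"
        proof (rule has_partial_le)
          show "has_partial v i x (partial_deriv i v x)" "has_partial u i x (partial_deriv i u x)"
            using elim by simp_all
        qed (rule le)
        then have "\<bar>partial_deriv i v x\<bar>\<^sup>2 \<le> (M * \<bar>partial_deriv i u x\<bar>)\<^sup>2" by (intro power_mono) auto
        then show "(partial_deriv i v x)\<^sup>2 \<le> M\<^sup>2 * (partial_deriv i u x)\<^sup>2" by (simp add: power_mult_distrib)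
      qed
      then show ?case
        by (simp add: norm_gradient_eq sum_distrib_left[symmetric] ennreal_mult''[symmetric] ennreal_leI sum_nonneg)
    qed
  qed
  also have "\<dots> = ennreal (M\<^sup>2) * energy u"
    unfolding energy_def by (rule nn_integral_cmult) measurable
  finally show ?thesis .
qed

section \<open>Translations, dilations and the scaling of capacity\<close>

lemma integral_translate:
  fixes f :: "'a::euclidean_space \<Rightarrow> real"
  assumes [measurable]: "f \<in> borel_measurable borel"
  shows "(\<integral>x. f (x + z) \<partial>lborel) = (\<integral>x. f x \<partial>lborel)"
proof -
  have "(\<integral>x. f x \<partial>lborel) = (\<integral>x. f x \<partial>distr lborel borel ((+) z))"
    by (simp add: lborel_distr_plus)
  also have "\<dots> = (\<integral>x. f (x + z) \<partial>lborel)"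
    by (subst integral_distr) (auto simp: add.commute)
  finally show ?thesis by simp
qed

lemma integrable_translate:
  fixes f :: "'a::euclidean_space \<Rightarrow> real"
  assumes "integrable lborel f"
  shows "integrable lborel (\<lambda>x. f (x + z))"
proof -
  have [measurable]: "f \<in> borel_measurable borel" using assms by (auto dest: borel_measurable_integrable)
  have "integrable (distr lborel borel ((+) z)) f" using assms by (simp add: lborel_distr_plus)
  then have "integrable lborel (\<lambda>x. f (z + x))" by (subst (asm) integrable_distr_eq) auto
  then show ?thesis by (simp add: add.commute)
qed

text \<open>The uniform bound and the common support together provide the majorant for dominated
  convergence.\<close>

lemma lip_comp_quotient:
  fixes u :: "real ^ 'n::finite \<Rightarrow> real" and i :: 'n and s :: real
  assumes "lip_comp u"
  obtains M R where "0 \<le> M"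
    "\<And>k x. R < norm x \<Longrightarrow> (u (x + (s / Suc k) *\<^sub>R axis i 1) - u x) * (real (Suc k)) = 0"
    "\<And>k x. \<bar>(u (x + (s / Suc k) *\<^sub>R axis i 1) - u x) * (real (Suc k))\<bar> \<le> M"
proof -
  obtain L R where LR: "L-lipschitz_on UNIV u" "0 \<le> L" "0 \<le> R" "\<And>x. R < norm x \<Longrightarrow> u x = 0"
    using assms by (rule lip_compE) blast
  show ?thesis
  proof (rule that[of "L * \<bar>s\<bar>" "R + \<bar>s\<bar>"])
    fix k :: nat and x :: "real ^ 'n"
    have "\<bar>s\<bar> / Suc k \<le> \<bar>s\<bar> / 1" by (intro divide_left_mono) auto
    then have n: "norm ((s / Suc k) *\<^sub>R axis i (1::real)) \<le> \<bar>s\<bar>" by simp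
    have "\<bar>u (x + (s / Suc k) *\<^sub>R axis i 1) - u x\<bar> * real (Suc k) \<le> (L * (\<bar>s\<bar> / Suc k)) * real (Suc k)"
      using lipschitz_on_realD[OF LR(1), of "x + (s / Suc k) *\<^sub>R axis i 1" x]
      by (intro mult_right_mono) auto
    also have "\<dots> = L * \<bar>s\<bar>" by simp
    finally show "\<bar>(u (x + (s / Suc k) *\<^sub>R axis i 1) - u x) * (real (Suc k))\<bar> \<le> L * \<bar>s\<bar>"
      by (simp add: abs_mult)
    assume x: "R + \<bar>s\<bar> < norm x"
    have "R < norm (x + (s / Suc k) *\<^sub>R axis i 1)"
      using norm_diff_ineq[of x "(s / Suc k) *\<^sub>R axis i 1"] n x by linarith
    moreover have "R < norm x" using x by linarith
    ultimately show "(u (x + (s / Suc k) *\<^sub>R axis i 1) - u x) * (real (Suc k)) = 0"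
      using LR(4) by simp
  qed (use LR in simp)
qed

text \<open>Every difference quotient has integral zero by translation invariance, and dominated
  convergence carries this over to the derivative. Applied to products it is integration by
  parts.\<close>

lemma integral_partial_deriv_zero:
  fixes u :: "real ^ 'n::finite \<Rightarrow> real" and i :: 'n
  assumes u: "lip_comp u"
  shows "integrable lborel (partial_deriv i u)" "(\<integral>x. partial_deriv i u x \<partial>lborel) = 0"
proof -
  note [measurable] = lip_comp_measurable[OF u]
  obtain L R0 where LR: "L-lipschitz_on UNIV u" "0 \<le> L" "0 \<le> R0" "\<And>x. R0 < norm x \<Longrightarrow> u x = 0"
    using u by (rule lip_compE) blast
  obtain B where B: "0 \<le> B" "\<And>x. \<bar>u x\<bar> \<le> B" using u by (rule lip_comp_bounded) blast
  obtain L' where L': "0 \<le> L'" "AE x in lborel. \<forall>i. \<bar>partial_deriv i u x\<bar> \<le> L'"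
    using u by (rule lip_comp_partial_bounded) blast
  show "integrable lborel (partial_deriv i u)"
    by (rule integrable_bounded_compact_support[of _ R0 L'])
       (use L' partial_deriv_zero_norm[OF LR(4)] in \<open>auto elim: AE_mp\<close>)
  have iu: "integrable lborel u"
    by (rule integrable_bounded_compact_support[of _ R0 B]) (use LR B in auto)
  let ?s = "\<lambda>k x. (u (x + (1 / Suc k) *\<^sub>R axis i 1) - u x) * real (Suc k)"
  obtain M R where M: "0 \<le> M" "\<And>k x. R < norm x \<Longrightarrow> ?s k x = 0" "\<And>k x. \<bar>?s k x\<bar> \<le> M"
    using lip_comp_quotient[OF u, of 1 i] by blast
  have "(\<lambda>k. \<integral>x. ?s k x \<partial>lborel) \<longlonglongrightarrow> (\<integral>x. partial_deriv i u x \<partial>lborel)"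
  proof (rule integral_dominated_convergence[where w = "\<lambda>x. M * indicator (cball 0 R) x"])
    show "integrable lborel (\<lambda>x::real^'n. M * indicator (cball 0 R) x :: real)"
      by (intro integrable_mult_right integrable_real_indicator emeasure_lborel_cball_finite) auto
    show "AE x in lborel. (\<lambda>k. ?s k x) \<longlonglongrightarrow> partial_deriv i u x"
      using lip_comp_AE_partials[OF u]
    proof eventually_elim
      case (elim x)
      then show ?case using has_partial_quotient_seq[of u x i _ 1] by auto
    qed
    show "AE x in lborel. norm (?s k x) \<le> M * indicator (cball 0 R) x" for k
      using M by (intro AE_I2) (auto simp: indicator_def simp del: of_nat_Suc)
  qed measurable
  moreover have "(\<integral>x. ?s k x \<partial>lborel) = 0" for k
    by (simp add: iu integrable_translate integral_translate)
  ultimately show "(\<integral>x. partial_deriv i u x \<partial>lborel) = 0"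
    by (metis (no_types, lifting) LIMSEQ_const_iff LIMSEQ_unique tendsto_const ext)
qed

lemma nn_integral_affine:
  fixes f :: "real ^ 'n::finite \<Rightarrow> ennreal"
  assumes [measurable]: "f \<in> borel_measurable borel" and r: "0 < r"
  shows "(\<integral>\<^sup>+x. f x \<partial>lborel) = ennreal (r ^ CARD('n)) * (\<integral>\<^sup>+x. f (c + r *\<^sub>R x) \<partial>lborel)"
  by (subst lborel_affine[of r c])
     (use r in \<open>auto simp: nn_integral_density nn_integral_distr nn_integral_cmult ennreal_power\<close>)

text \<open>The Jacobian contributes \<open>r^n\<close> and the squared gradient
  \<open>r^(-2)\<close>.\<close>

lemma energy_affine:
  fixes u :: "real ^ 'n::finite \<Rightarrow> real"
  assumes u: "lip_comp u" and r: "0 < r" and n: "2 \<le> CARD('n)"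
  shows "energy u = ennreal (r ^ (CARD('n) - 2)) * energy (\<lambda>x. u (c + r *\<^sub>R x))"
proof -
  let ?v = "\<lambda>x. u (c + r *\<^sub>R x)"
  have v: "lip_comp ?v" by (rule lip_comp_affine[OF u r])
  note [measurable] = norm_gradient_square_measurable[OF u]
  have "energy ?v = (\<integral>\<^sup>+x. ennreal (r\<^sup>2) * ennreal ((norm (gradient u (c + r *\<^sub>R x)))\<^sup>2) \<partial>lborel)"
    unfolding energy_def
  proof (rule nn_integral_cong_AE)
    show "AE x in lborel. ennreal ((norm (gradient ?v x))\<^sup>2) = ennreal (r\<^sup>2) * ennreal ((norm (gradient u (c + r *\<^sub>R x)))\<^sup>2)"
      using lip_comp_AE_partials[OF v]
    proof eventually_elim
      case (elim x)
      have "partial_deriv i u (c + r *\<^sub>R x) = partial_deriv i ?v x / r" for i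
      proof (rule has_partial_imp)
        have "((\<lambda>t. u (c + r *\<^sub>R (x + t *\<^sub>R axis i 1))) has_real_derivative partial_deriv i ?v x) (at 0)"
          using elim by blast
        then have "((\<lambda>t. u (c + r *\<^sub>R (x + (t / r) *\<^sub>R axis i 1))) has_real_derivative (partial_deriv i ?v x * (1 / r))) (at 0)"
          by (intro DERIV_chain2[where g = "\<lambda>t. t / r"]) (use r in \<open>auto intro!: derivative_eq_intros\<close>)
        then show "has_partial u i (c + r *\<^sub>R x) (partial_deriv i ?v x / r)"
          using r by (simp add: scaleR_add_right add.assoc)
      qed
      then have "(norm (gradient ?v x))\<^sup>2 = r\<^sup>2 * (norm (gradient u (c + r *\<^sub>R x)))\<^sup>2"
        using r by (simp add: norm_gradient_eq power_divide sum_divide_distrib[symmetric])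
      then show ?case by (simp add: ennreal_mult'')
    qed
  qed
  also have "\<dots> = ennreal (r\<^sup>2) * (\<integral>\<^sup>+x. ennreal ((norm (gradient u (c + r *\<^sub>R x)))\<^sup>2) \<partial>lborel)"
    by (rule nn_integral_cmult) measurable
  finally have "ennreal (r ^ (CARD('n) - 2)) * energy ?v =
     (ennreal (r ^ (CARD('n) - 2)) * ennreal (r\<^sup>2)) * (\<integral>\<^sup>+x. ennreal ((norm (gradient u (c + r *\<^sub>R x)))\<^sup>2) \<partial>lborel)"
    by (simp add: mult.assoc)
  also have "ennreal (r ^ (CARD('n) - 2)) * ennreal (r\<^sup>2) = ennreal (r ^ CARD('n))"
  proof -
    have "r ^ (CARD('n) - 2) * r\<^sup>2 = r ^ CARD('n)" using n by (simp only: power_add[symmetric] le_add_diff_inverse2)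
    then show ?thesis using r by (simp only: ennreal_mult''[symmetric] zero_le_power2)
  qed
  also have "ennreal (r ^ CARD('n)) * (\<integral>\<^sup>+x. ennreal ((norm (gradient u (c + r *\<^sub>R x)))\<^sup>2) \<partial>lborel) = energy u"
    unfolding energy_def by (rule nn_integral_affine[symmetric, OF _ r]) measurable
  finally show ?thesis by simp
qed

lemma wiener_cap_alt:
  "wiener_cap F = (INF u \<in> {u. lip_comp u \<and> (\<forall>x\<in>F. u x = 1)}. energy u)"
  unfolding wiener_cap_def lip_comp_def energy_def by (simp add: conj_assoc)

lemma wiener_cap_le:
  "lip_comp u \<Longrightarrow> (\<And>x. x \<in> F \<Longrightarrow> u x = 1) \<Longrightarrow> wiener_cap F \<le> energy u"
  unfolding wiener_cap_alt by (rule INF_lower) auto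

lemma wiener_cap_affine_le:
  fixes a c :: "real ^ 'n::finite"
  assumes r: "0 < r" and n: "2 \<le> CARD('n)"
  shows "ennreal (r ^ (CARD('n) - 2)) * wiener_cap (cball a s) \<le> wiener_cap (cball (c + r *\<^sub>R a) (r * s))"
  unfolding wiener_cap_alt[of "cball (c + r *\<^sub>R a) (r * s)"]
proof (rule INF_greatest)
  fix u assume "u \<in> {u. lip_comp u \<and> (\<forall>x\<in>cball (c + r *\<^sub>R a) (r * s). u x = 1)}"
  then have u: "lip_comp u" "\<And>x. x \<in> cball (c + r *\<^sub>R a) (r * s) \<Longrightarrow> u x = 1" by auto
  have "c + r *\<^sub>R x \<in> cball (c + r *\<^sub>R a) (r * s)" if "x \<in> cball a s" for x
    using that r by (simp add: dist_norm scaleR_diff_right[symmetric])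
  then have "wiener_cap (cball a s) \<le> energy (\<lambda>x. u (c + r *\<^sub>R x))"
    by (intro wiener_cap_le lip_comp_affine u r)
  then show "ennreal (r ^ (CARD('n) - 2)) * wiener_cap (cball a s) \<le> energy u"
    unfolding energy_affine[OF u(1) r n, of c] by (rule mult_left_mono) simp
qed

lemma wiener_cap_cball:
  fixes c :: "real ^ 'n::finite"
  assumes r: "0 < r" and n: "2 \<le> CARD('n)"
  shows "wiener_cap (cball c r) = ennreal (r ^ (CARD('n) - 2)) * wiener_cap (cball (0 :: real ^ 'n) 1)"
proof (rule antisym)
  let ?k = "CARD('n) - 2"
  \<comment> \<open>The one-sided estimate for the inverse dilation, of ratio 1/r, supplies the
    second inequality.\<close>
  have "ennreal (r ^ ?k) * (ennreal ((1/r) ^ ?k) * wiener_cap (cball c r)) \<le> ennreal (r ^ ?k) * wiener_cap (cball (0 :: real ^ 'n) 1)"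
    using wiener_cap_affine_le[of "1/r" c r "- (1/r) *\<^sub>R c"] r n by (intro mult_left_mono) auto
  moreover have "ennreal (r ^ ?k) * ennreal ((1/r) ^ ?k) = 1"
    using r by (simp add: ennreal_mult''[symmetric] power_mult_distrib[symmetric])
  ultimately show "wiener_cap (cball c r) \<le> ennreal (r ^ ?k) * wiener_cap (cball (0 :: real ^ 'n) 1)"
    by (simp add: mult.assoc[symmetric])
qed (use wiener_cap_affine_le[OF r n, of 0 1 c] in simp)

text \<open>Here s is the outer radius and h the width of the layer in which the function drops
  linearly from 1 to 0.\<close>

definition cutoff :: "real ^ 'n::finite \<Rightarrow> real \<Rightarrow> real \<Rightarrow> real ^ 'n \<Rightarrow> real" where
  "cutoff c s h x = max 0 (min 1 ((s - dist x c) / h))"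

lemma cutoff_range: "0 \<le> cutoff c s h x" "cutoff c s h x \<le> 1"
  by (auto simp: cutoff_def)

lemma cutoff_eq_1: "dist x c \<le> s - h \<Longrightarrow> 0 < h \<Longrightarrow> cutoff c s h x = 1"
  by (simp add: cutoff_def field_simps)

lemma cutoff_eq_0: "s \<le> dist x c \<Longrightarrow> 0 < h \<Longrightarrow> cutoff c s h x = 0"
  by (simp add: cutoff_def field_simps min_def max_def)

lemma cutoff_lipschitz:
  fixes c :: "real ^ 'n::finite"
  assumes h: "0 < h"
  shows "(1/h)-lipschitz_on UNIV (cutoff c s h)"
proof (rule lipschitz_on_realI)
  fix x y :: "real ^ 'n"
  have "\<bar>cutoff c s h x - cutoff c s h y\<bar> \<le> \<bar>(s - dist x c) / h - (s - dist y c) / h\<bar>"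
    unfolding cutoff_def by linarith
  also have "\<dots> = \<bar>dist x c - dist y c\<bar> / h"
    using h by (simp add: diff_divide_distrib[symmetric] abs_minus_commute)
  also have "\<dots> \<le> dist x y / h"
    using h abs_dist_diff_le[of x c y] by (intro divide_right_mono) (auto simp: dist_commute)
  finally show "\<bar>cutoff c s h x - cutoff c s h y\<bar> \<le> 1 / h * norm (x - y)" by (simp add: dist_norm)
qed (use h in simp)

lemma lip_comp_cutoff:
  fixes c :: "real ^ 'n::finite"
  assumes h: "0 < h"
  shows "lip_comp (cutoff c s h)"
proof (rule lip_compI[OF cutoff_lipschitz[OF h], of "s + norm c"])
  fix x :: "real ^ 'n" assume "s + norm c < norm x"
  then have "s \<le> dist x c" using norm_triangle_ineq2[of x c] by (simp add: dist_norm)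
  then show "cutoff c s h x = 0" using h by (rule cutoff_eq_0)
qed

lemma wiener_cap_cball_finite: "wiener_cap (cball (0 :: real ^ 'n::finite) 1) < \<infinity>"
proof -
  have "wiener_cap (cball (0 :: real ^ 'n) 1) \<le> energy (cutoff (0 :: real ^ 'n) 2 1)"
    by (intro wiener_cap_le lip_comp_cutoff) (auto intro!: cutoff_eq_1 simp: dist_commute)
  then show ?thesis using energy_finite[OF lip_comp_cutoff[of 1 "0 :: real ^ 'n" 2]] by (simp add: le_less_trans)
qed

section \<open>Hardy's inequality and the capacity of balls\<close>

lemma norm_over_one_plus_square: "norm (x :: 'a::real_normed_vector) / (1 + (norm x)\<^sup>2) \<le> 1 / 2"
proof -
  have "0 \<le> (norm x - 1)\<^sup>2" by simp
  then have "2 * norm x \<le> 1 + (norm x)\<^sup>2" by (simp add: power2_eq_square algebra_simps)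
  moreover have "0 < 1 + (norm x)\<^sup>2" by (simp add: add_pos_nonneg)
  ultimately show ?thesis by (simp add: divide_le_eq)
qed

text \<open>The classical weight |x|^(-2) is singular at 0. Adding 1 in the denominator makes it
  Lipschitz, so the vector field in Hardy's inequality has Lipschitz components. In the factored
  difference each summand is at most 1/2, which gives the constant 1.\<close>

lemma hardy_weight_lipschitz:
  "1-lipschitz_on UNIV (\<lambda>x :: 'a::real_normed_vector. 1 / (1 + (norm x)\<^sup>2))"
proof (rule lipschitz_on_realI)
  fix x y :: 'a
  let ?a = "1 + (norm x)\<^sup>2" and ?b = "1 + (norm y)\<^sup>2"
  have pos: "0 < ?a" "0 < ?b" by (simp_all add: add_pos_nonneg)
  have a1: "1 / ?a \<le> 1" "1 / ?b \<le> 1" by (simp_all add: divide_le_eq add_pos_nonneg)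
  have "1 / ?a - 1 / ?b = (norm y - norm x) * (norm x / ?a * (1 / ?b) + norm y / ?b * (1 / ?a))"
    using pos by (simp add: divide_simps) (simp add: power2_eq_square algebra_simps)
  also have "\<bar>\<dots>\<bar> = \<bar>norm y - norm x\<bar> * (norm x / ?a * (1 / ?b) + norm y / ?b * (1 / ?a))"
    using pos by (simp add: abs_mult)
  also have "\<dots> \<le> norm (x - y) * (1/2 * 1 + 1/2 * 1)"
    using pos a1 norm_triangle_ineq3[of y x] norm_over_one_plus_square[of x] norm_over_one_plus_square[of y]
    by (intro mult_mono add_mono) (auto simp: norm_minus_commute simp del: times_divide_eq_left times_divide_eq_right)
  finally show "\<bar>1 / ?a - 1 / ?b\<bar> \<le> 1 * norm (x - y)" by simp
qed simp

lemma norm_square_line: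
  fixes x :: "real ^ 'n::finite"
  shows "(norm (x + t *\<^sub>R axis i 1))\<^sup>2 = (norm x)\<^sup>2 + 2 * t * x $ i + t\<^sup>2"
proof -
  have "(norm (x + t *\<^sub>R axis i 1))\<^sup>2 = (x + t *\<^sub>R axis i 1) \<bullet> (x + t *\<^sub>R axis i 1)"
    by (simp add: power2_norm_eq_inner)
  also have "\<dots> = x \<bullet> x + 2 * t * (x \<bullet> axis i 1) + t\<^sup>2 * (axis i 1 \<bullet> (axis i 1 :: real ^ 'n))"
    by (simp add: inner_add_left inner_add_right inner_commute power2_eq_square algebra_simps)
  finally show ?thesis by (simp add: power2_norm_eq_inner inner_axis)
qed

lemma has_partial_norm_square:
  fixes x :: "real ^ 'n::finite"
  shows "has_partial (\<lambda>x. (norm x)\<^sup>2) i x (2 * x $ i)"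
  unfolding norm_square_line by (auto intro!: derivative_eq_intros)

lemma has_partial_component:
  fixes x :: "real ^ 'n::finite"
  shows "has_partial (\<lambda>x. x $ j) i x (if i = j then 1 else 0)"
  by (auto intro!: derivative_eq_intros simp: axis_def)

lemma has_partial_const: "has_partial (\<lambda>_. c) i x 0"
  by simp

lemma has_partial_mult:
  assumes "has_partial u i x a" "has_partial v i x b"
  shows "has_partial (\<lambda>x. u x * v x) i x (a * v x + b * u x)"
  using DERIV_mult[OF assms] by simp

lemma has_partial_add:
  assumes "has_partial u i x a" "has_partial v i x b"
  shows "has_partial (\<lambda>x. u x + v x) i x (a + b)"
  using DERIV_add[OF assms] by simp

lemma has_partial_diff:
  assumes "has_partial u i x a" "has_partial v i x b"
  shows "has_partial (\<lambda>x. u x - v x) i x (a - b)"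
  using DERIV_diff[OF assms] by simp

lemma integrable_hardy_weight:
  fixes u :: "real ^ 'n::finite \<Rightarrow> real"
  assumes u: "lip_comp u"
  shows "integrable lborel (\<lambda>x. (u x)\<^sup>2 / (1 + (norm x)\<^sup>2))"
proof -
  obtain L R where LR: "L-lipschitz_on UNIV u" "0 \<le> L" "0 \<le> R" "\<And>x. R < norm x \<Longrightarrow> u x = 0"
    using u by (rule lip_compE) blast
  obtain B where B: "0 \<le> B" "\<And>x. \<bar>u x\<bar> \<le> B" using u by (rule lip_comp_bounded) blast
  note [measurable] = lip_comp_measurable[OF u]
  show ?thesis
  proof (rule integrable_bounded_compact_support[of _ R "B\<^sup>2"])
    have "(u x)\<^sup>2 / (1 + (norm x)\<^sup>2) \<le> B\<^sup>2" for x
    proof -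
      have "(u x)\<^sup>2 / (1 + (norm x)\<^sup>2) \<le> (u x)\<^sup>2 / 1" by (intro divide_left_mono) (auto simp: add_pos_nonneg)
      also have "\<dots> \<le> B\<^sup>2" using power_mono[OF B(2)[of x], of 2] by simp
      finally show ?thesis .
    qed
    then show "AE x in lborel. \<bar>(u x)\<^sup>2 / (1 + (norm x)\<^sup>2)\<bar> \<le> B\<^sup>2" by simp
  qed (use LR in auto)
qed

text \<open>Hardy's inequality with the regularised weight: integrate the divergence of
  \<open>u\<^sup>2 x / (1 + \<bar>x\<bar>\<^sup>2)\<close>.\<close>

lemma hardy_inequality:
  fixes u :: "real ^ 'n::finite \<Rightarrow> real"
  assumes u: "lip_comp u" and n: "3 \<le> CARD('n)"
  shows "(\<integral>x. (u x)\<^sup>2 / (1 + (norm x)\<^sup>2) \<partial>lborel) \<le> 4 * (\<integral>x. (norm (gradient u x))\<^sup>2 \<partial>lborel)"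
proof -
  let ?w = "\<lambda>x :: real ^ 'n. 1 / (1 + (norm x)\<^sup>2)"
  obtain L R where LR: "L-lipschitz_on UNIV u" "0 \<le> L" "0 \<le> R" "\<And>x. R < norm x \<Longrightarrow> u x = 0"
    using u by (rule lip_compE) blast
  \<comment> \<open>Ordered so that each new factor is Lipschitz and multiplies a Lipschitz function
    of compact support, as \<open>lip_comp_mult\<close> requires.\<close>
  define g where "g = (\<lambda>i x. u x * ?w x * u x * x $ i)"
  have comp: "1-lipschitz_on UNIV (\<lambda>x :: real ^ 'n. x $ i)" for i
    by (rule lipschitz_on_realI) (use component_le_norm_cart[of "_ - _" i] in auto)
  have g: "lip_comp (g i)" for i
    unfolding g_def
    by (rule lip_comp_mult[OF lip_comp_mult[OF lip_comp_mult[OF u hardy_weight_lipschitz] LR(1)] comp])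
  have int: "integrable lborel (\<lambda>x. \<Sum>i\<in>UNIV. partial_deriv i (g i) x)"
    by (intro Bochner_Integration.integrable_sum integral_partial_deriv_zero g)
  have zero: "(\<integral>x. (\<Sum>i\<in>UNIV. partial_deriv i (g i) x) \<partial>lborel) = 0"
    by (subst Bochner_Integration.integral_sum) (simp_all add: integral_partial_deriv_zero[OF g])
  note int2 = integrable_hardy_weight[OF u]
  note int3 = integrable_norm_gradient[OF u]
  have ae: "AE x in lborel. (u x)\<^sup>2 / (1 + (norm x)\<^sup>2) / 2 - 2 * (norm (gradient u x))\<^sup>2 \<le> (\<Sum>i\<in>UNIV. partial_deriv i (g i) x)"
    using lip_comp_AE_partials[OF u]
  proof eventually_elim
    case (elim x)
    define w where "w = 1 / (1 + (norm x)\<^sup>2)"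
    define d where "d = (\<lambda>i. partial_deriv i u x)"
    have pos: "0 < 1 + (norm x)\<^sup>2" by (simp add: add_pos_nonneg)
    have w0: "0 < w" using pos by (simp add: w_def)
    have xw: "(norm x)\<^sup>2 * w \<le> 1" using pos by (simp add: w_def divide_le_eq)
    have dw: "has_partial ?w i x (- 2 * x $ i * w\<^sup>2)" for i
    proof -
      have "has_partial (\<lambda>x. 1 + (norm x)\<^sup>2) i x (2 * x $ i)"
        using has_partial_add[OF has_partial_const has_partial_norm_square, of 1 x i] by simp
      from DERIV_inverse_fun[OF this] show ?thesis
        using pos by (simp add: w_def inverse_eq_divide power2_eq_square field_simps)
    qed
    have "partial_deriv i (g i) x = 2 * u x * w * x $ i * d i + (u x)\<^sup>2 * w - 2 * (u x)\<^sup>2 * w\<^sup>2 * (x $ i)\<^sup>2" for i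
    proof (rule has_partial_imp)
      have du: "has_partial u i x (d i)" using elim by (simp add: d_def)
      from has_partial_mult[OF has_partial_mult[OF has_partial_mult[OF du dw] du] has_partial_component[where i = i and j = i and x = x]]
      show "has_partial (g i) i x (2 * u x * w * x $ i * d i + (u x)\<^sup>2 * w - 2 * (u x)\<^sup>2 * w\<^sup>2 * (x $ i)\<^sup>2)"
        unfolding g_def w_def[symmetric]
        by (rule back_subst) (simp add: w_def[symmetric] algebra_simps power2_eq_square)
    qed
    then have "(\<Sum>i\<in>UNIV. partial_deriv i (g i) x) =
       (\<Sum>i\<in>UNIV. 2 * u x * w * x $ i * d i) + real CARD('n) * ((u x)\<^sup>2 * w) - 2 * (u x)\<^sup>2 * w\<^sup>2 * (\<Sum>i\<in>UNIV. (x $ i)\<^sup>2)"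
      by (simp add: sum.distrib sum_subtractf sum_distrib_left)
    also have "(\<Sum>i\<in>UNIV. (x $ i)\<^sup>2) = (norm x)\<^sup>2" by (simp add: norm_vec_def L2_set_def sum_nonneg)
    finally have eq: "(\<Sum>i\<in>UNIV. partial_deriv i (g i) x) =
       (\<Sum>i\<in>UNIV. 2 * u x * w * x $ i * d i) + real CARD('n) * ((u x)\<^sup>2 * w) - 2 * (u x)\<^sup>2 * w\<^sup>2 * (norm x)\<^sup>2" .
    \<comment> \<open>The weights are chosen for n = 3: of the coefficient n of
      \<open>u^2 w\<close>, at most 2 is lost to the derivative of w and 1/2 here, so at least 1/2
      remains. Against the 2 in front of the squared gradient this gives the constant 4.\<close>
    have young: "- (1/2 * (u x)\<^sup>2 * w\<^sup>2 * (x $ i)\<^sup>2 + 2 * (d i)\<^sup>2) \<le> 2 * u x * w * x $ i * d i" for i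
    proof -
      have "0 \<le> 1/2 * (u x * w * x $ i + 2 * d i)\<^sup>2" by simp
      then show ?thesis by (simp add: power2_eq_square algebra_simps)
    qed
    have "- (1/2 * (u x)\<^sup>2 * w\<^sup>2 * (norm x)\<^sup>2 + 2 * (norm (gradient u x))\<^sup>2) =
      (\<Sum>i\<in>UNIV. - (1/2 * (u x)\<^sup>2 * w\<^sup>2 * (x $ i)\<^sup>2 + 2 * (d i)\<^sup>2))"
      unfolding norm_gradient_eq d_def norm_vec_def[of x] L2_set_def
      by (simp add: sum_nonneg sum_negf sum_subtractf sum_distrib_left)
    also have "\<dots> \<le> (\<Sum>i\<in>UNIV. 2 * u x * w * x $ i * d i)" by (intro sum_mono young)
    finally have 1: "- (1/2 * (u x)\<^sup>2 * w\<^sup>2 * (norm x)\<^sup>2 + 2 * (norm (gradient u x))\<^sup>2) \<le> (\<Sum>i\<in>UNIV. 2 * u x * w * x $ i * d i)" .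
    have 2: "(u x)\<^sup>2 * w\<^sup>2 * (norm x)\<^sup>2 \<le> (u x)\<^sup>2 * w"
      using mult_left_mono[OF xw, of "(u x)\<^sup>2 * w"] w0 by (simp add: power2_eq_square algebra_simps)
    have 3: "3 * ((u x)\<^sup>2 * w) \<le> real CARD('n) * ((u x)\<^sup>2 * w)"
      using n w0 by (intro mult_right_mono) auto
    have "(u x)\<^sup>2 / (1 + (norm x)\<^sup>2) = (u x)\<^sup>2 * w" by (simp add: w_def)
    then show ?case using eq 1 2 3 by (simp add: algebra_simps)
  qed
  let ?f = "\<lambda>x. (u x)\<^sup>2 / (1 + (norm x)\<^sup>2)" and ?g = "\<lambda>x. (norm (gradient u x))\<^sup>2"
  have i2: "integrable lborel (\<lambda>x. ?f x / 2)" and i3: "integrable lborel (\<lambda>x. 2 * ?g x)"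
    by (rule integrable_divide, rule int2) (rule integrable_mult_right, rule int3)
  have "(\<integral>x. ?f x \<partial>lborel) / 2 - 2 * (\<integral>x. ?g x \<partial>lborel) = (\<integral>x. ?f x / 2 - 2 * ?g x \<partial>lborel)"
    by (simp only: Bochner_Integration.integral_diff[OF i2 i3] integral_divide_zero integral_mult_right_zero)
  also have "\<dots> \<le> (\<integral>x. (\<Sum>i\<in>UNIV. partial_deriv i (g i) x) \<partial>lborel)"
    by (rule integral_mono_AE[OF Bochner_Integration.integrable_diff[OF i2 i3] int ae])
  finally show ?thesis unfolding zero by simp
qed

text \<open>Hardy's weight is at least 1/2 on the unit ball, where admissible functions equal 1.
  Hence the energy is at least one eighth of the volume of the ball.\<close>

lemma wiener_cap_cball_pos:
  assumes n: "3 \<le> CARD('n::finite)"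
  shows "0 < wiener_cap (cball (0 :: real ^ 'n) 1)"
proof -
  let ?c = "measure lborel (cball (0 :: real ^ 'n) 1)"
  have c: "0 < ?c" by (simp add: content_cball_pos)
  have "ennreal (?c / 8) \<le> wiener_cap (cball (0 :: real ^ 'n) 1)"
    unfolding wiener_cap_alt
  proof (rule INF_greatest)
    fix u :: "real ^ 'n \<Rightarrow> real" assume "u \<in> {u. lip_comp u \<and> (\<forall>x\<in>cball 0 1. u x = 1)}"
    then have u: "lip_comp u" and u1: "\<And>x. norm x \<le> 1 \<Longrightarrow> u x = 1" by auto
    note int2 = integrable_hardy_weight[OF u]
    have "?c / 2 = (\<integral>x. indicator (cball (0 :: real ^ 'n) 1) x / 2 \<partial>lborel)"
      by simp
    also have "\<dots> \<le> (\<integral>x. (u x)\<^sup>2 / (1 + (norm x)\<^sup>2) \<partial>lborel)"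
    proof (rule integral_mono[OF _ int2])
      show "integrable lborel (\<lambda>x :: real ^ 'n. indicator (cball (0 :: real ^ 'n) 1) x / 2 :: real)"
        by (intro integrable_divide integrable_real_indicator emeasure_lborel_cball_finite) auto
      fix x :: "real ^ 'n"
      have "norm x \<le> 1 \<Longrightarrow> (norm x)\<^sup>2 \<le> 1" by (simp add: power_le_one)
      then show "indicator (cball (0 :: real ^ 'n) 1) x / 2 \<le> (u x)\<^sup>2 / (1 + (norm x)\<^sup>2)"
        using u1[of x] by (auto simp: indicator_def field_simps add_pos_nonneg)
    qed
    also have "\<dots> \<le> 4 * (\<integral>x. (norm (gradient u x))\<^sup>2 \<partial>lborel)" by (rule hardy_inequality[OF u n])
    finally show "ennreal (?c / 8) \<le> energy u"
      unfolding energy_eq_integral[OF u] by (intro ennreal_leI) simp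
  qed
  then show ?thesis using c by (metis ennreal_less_zero_iff less_le_trans zero_less_divide_iff zero_less_numeral)
qed

section \<open>Smooth bump functions and convolution\<close>

text \<open>The standard flat function exp(-1/t), extended by 0, together with its multiples by
  inverse powers: derivatives of members are combinations of members.\<close>

definition flat :: "nat \<Rightarrow> real \<Rightarrow> real" where
  "flat k t = (if 0 < t then exp (- (1 / t)) / t ^ k else 0)"

lemma flat_tendsto_0: "(flat k \<longlongrightarrow> 0) (at 0)"
proof -
  have "((\<lambda>t. inverse t ^ k / exp (inverse t)) \<longlongrightarrow> 0) (at_right (0::real))"
    by (rule filterlim_compose[OF tendsto_power_div_exp_0 filterlim_inverse_at_top_right])
  then have "(flat k \<longlongrightarrow> 0) (at_right 0)"
  proof (rule Lim_transform_eventually)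
    show "\<forall>\<^sub>F t in at_right 0. inverse t ^ k / exp (inverse t) = flat k t"
      by (rule eventually_mono[OF eventually_at_right_less])
         (simp add: flat_def exp_minus divide_simps)
  qed
  moreover have "(flat k \<longlongrightarrow> 0) (at_left 0)"
    by (rule Lim_transform_eventually[of "\<lambda>_. 0"])
       (auto simp: eventually_at_filter flat_def intro!: always_eventually)
  ultimately show ?thesis by (simp add: filterlim_split_at_real)
qed

lemma flat_has_derivative:
  "(flat k has_real_derivative (flat (k + 2) t - real k * flat (k + 1) t)) (at t)"
proof -
  consider "0 < t" | "t < 0" | "t = 0" by linarith
  then show ?thesis
  proof cases
    case 1
    have "((\<lambda>t. exp (- (1 / t)) / t ^ k) has_real_derivative (flat (k + 2) t - real k * flat (k + 1) t)) (at t)"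
    proof (cases k)
      case 0
      then show ?thesis using 1
        by (auto intro!: derivative_eq_intros simp: flat_def power2_eq_square)
    next
      case (Suc m)
      then show ?thesis using 1
        by (auto intro!: derivative_eq_intros simp: flat_def) (cases m; simp add: divide_simps power2_eq_square algebra_simps)
    qed
    moreover have ev: "\<forall>\<^sub>F s in nhds t. exp (- (1 / s)) / s ^ k = flat k s"
      by (rule eventually_mono[OF eventually_nhds_in_open[of "{0<..}" t]]) (use 1 in \<open>auto simp: flat_def\<close>)
    ultimately show ?thesis using DERIV_cong_ev[OF refl ev refl] by simp
  next
    case 2
    have ev: "\<forall>\<^sub>F s in nhds t. 0 = flat k s"
      by (rule eventually_mono[OF eventually_nhds_in_open[of "{..<0}" t]]) (use 2 in \<open>auto simp: flat_def\<close>)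
    moreover have "((\<lambda>_. 0) has_real_derivative (flat (k + 2) t - real k * flat (k + 1) t)) (at t)"
      using 2 by (simp add: flat_def)
    ultimately show ?thesis using DERIV_cong_ev[OF refl ev refl] by simp
  next
    case 3
    \<comment> \<open>The quotient at 0 is the next member of the family, also for h <= 0, where
      both sides are 0.\<close>
    have "(flat k (0 + h) - flat k 0) / h = flat (k + 1) h" for h by (simp add: flat_def)
    then have "(flat k has_real_derivative 0) (at 0)"
      unfolding DERIV_def using flat_tendsto_0[of "k + 1"] by presburger
    then show ?thesis using 3 by (simp add: flat_def)
  qed
qed

lemma flat_0_bounds: "0 \<le> flat 0 t" "flat 0 t \<le> 1"
  by (auto simp: flat_def)

text \<open>An algebra that contains the bump and is stable under partial derivatives; the
  coordinates arise from differentiating the squared norm. Smoothness of every order then follows by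
  induction.\<close>

inductive bump_algebra :: "real \<Rightarrow> (real ^ 'n::finite \<Rightarrow> real) \<Rightarrow> bool" for h where
  const: "bump_algebra h (\<lambda>_. c)"
| coord: "bump_algebra h (\<lambda>x. x $ i)"
| flat: "bump_algebra h (\<lambda>x. flat k (h\<^sup>2 - (norm x)\<^sup>2))"
| add: "bump_algebra h f \<Longrightarrow> bump_algebra h g \<Longrightarrow> bump_algebra h (\<lambda>x. f x + g x)"
| mult: "bump_algebra h f \<Longrightarrow> bump_algebra h g \<Longrightarrow> bump_algebra h (\<lambda>x. f x * g x)"

lemma bump_algebra_continuous:
  "bump_algebra h f \<Longrightarrow> continuous_on UNIV f"
proof (induction rule: bump_algebra.induct)
  case (flat k)
  have "continuous_on UNIV (flat k)"
    using flat_has_derivative[of k] by (meson DERIV_isCont continuous_at_imp_continuous_on)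
  then show ?case by (rule continuous_on_compose2) (auto intro!: continuous_intros)
qed (auto intro!: continuous_intros)

lemma bump_algebra_partial:
  "bump_algebra h f \<Longrightarrow> \<exists>f'. bump_algebra h f' \<and> (\<forall>x. has_partial f i x (f' x))"
proof (induction rule: bump_algebra.induct)
  case (const c)
  show ?case by (rule exI[of _ "\<lambda>_. 0"]) (auto intro: bump_algebra.const)
next
  case (coord j)
  show ?case
    by (rule exI[of _ "\<lambda>_. if i = j then 1 else 0"])
       (intro conjI allI has_partial_component bump_algebra.const)
next
  case (flat k)
  let ?f = "\<lambda>x :: real ^ 'a. (flat (k + 2) (h\<^sup>2 - (norm x)\<^sup>2) + (- real k) * flat (k + 1) (h\<^sup>2 - (norm x)\<^sup>2)) * (- 2 * x $ i)"
  show ?case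
  proof (intro exI[of _ ?f] conjI allI)
    show "bump_algebra h ?f" by (intro bump_algebra.intros)
    fix x :: "real ^ 'a"
    have "has_partial (\<lambda>x. h\<^sup>2 - (norm x)\<^sup>2) i x (- 2 * x $ i)"
      using has_partial_diff[OF has_partial_const has_partial_norm_square, of "h\<^sup>2" x i] by simp
    from DERIV_chain2[OF _ this, of "flat k"] flat_has_derivative
    show "has_partial (\<lambda>x. flat k (h\<^sup>2 - (norm x)\<^sup>2)) i x (?f x)"
      by simp
  qed
next
  case (add f g)
  then obtain f' g' where "bump_algebra h f'" "\<forall>x. has_partial f i x (f' x)"
    "bump_algebra h g'" "\<forall>x. has_partial g i x (g' x)" by blast
  then show ?case
    by (intro exI[of _ "\<lambda>x. f' x + g' x"] conjI allI has_partial_add bump_algebra.add) auto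
next
  case (mult f g)
  then obtain f' g' where "bump_algebra h f'" "\<forall>x. has_partial f i x (f' x)"
    "bump_algebra h g'" "\<forall>x. has_partial g i x (g' x)" by blast
  with mult.hyps show ?case
    by (intro exI[of _ "\<lambda>x. f' x * g x + g' x * f x"] conjI allI has_partial_mult bump_algebra.add bump_algebra.mult) auto
qed

lemma bump_algebra_partial_deriv:
  assumes "bump_algebra h f"
  shows "bump_algebra h (partial_deriv i f)" "has_partial f i x (partial_deriv i f x)"
proof -
  obtain f' where f': "bump_algebra h f'" "\<forall>x. has_partial f i x (f' x)"
    using bump_algebra_partial[OF assms] by blast
  then have "partial_deriv i f = f'" by (auto simp: has_partial_imp)
  with f' show "bump_algebra h (partial_deriv i f)" "has_partial f i x (partial_deriv i f x)" by auto
qed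

lemma has_partial_line:
  assumes "has_partial u i (x + t *\<^sub>R axis i 1) l"
  shows "((\<lambda>s. u (x + s *\<^sub>R axis i 1)) has_real_derivative l) (at t)"
proof -
  have *: "x + t *\<^sub>R axis i 1 + s *\<^sub>R axis i 1 = x + (t + s) *\<^sub>R axis i 1" for s
    by (simp add: scaleR_add_left)
  from assms show ?thesis unfolding DERIV_def * by simp
qed

lemma axis_expansion: "(\<Sum>i\<in>UNIV. (z $ i) *\<^sub>R axis i 1) = (z :: real ^ 'n::finite)"
  using basis_expansion[of z] by (simp add: scalar_mult_eq_scaleR)

text \<open>Bounded partial derivatives give a Lipschitz bound by moving from y to x one coordinate
  at a time. This places test functions, kernels and mollifications in the Lipschitz class in which
  all estimates are made.\<close>

lemma C1_compact_support_lip_comp: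
  fixes u :: "real ^ 'n::finite \<Rightarrow> real"
  assumes d: "\<And>i x. has_partial u i x (d i x)" and c: "\<And>i. continuous_on UNIV (d i)"
    and R: "\<And>x. R < norm x \<Longrightarrow> u x = 0"
  shows "lip_comp u"
proof -
  have "\<exists>M. \<forall>x. \<bar>d i x\<bar> \<le> M" for i
  proof -
    have "compact (d i ` cball 0 R)"
      by (rule compact_continuous_image) (use c continuous_on_subset in blast, simp)
    then obtain M where M: "\<And>x. x \<in> cball 0 R \<Longrightarrow> norm (d i x) \<le> M"
      by (metis bounded_iff compact_imp_bounded image_eqI)
    have "\<bar>d i x\<bar> \<le> max M 0" for x
    proof (cases "R < norm x")
      case True
      have "partial_deriv i u x = 0" by (rule partial_deriv_zero_norm[OF R True])
      then show ?thesis using has_partial_imp[OF d[of x i]] by simp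
    qed (use M[of x] in auto)
    then show ?thesis by blast
  qed
  then obtain M where M: "\<And>i x. \<bar>d i x\<bar> \<le> M i" by metis
  define K where "K = (\<Sum>i\<in>UNIV. M i)"
  have M0: "0 \<le> M i" for i using M[of i 0] by simp
  have one: "\<bar>u (x + s *\<^sub>R axis i 1) - u x\<bar> \<le> M i * \<bar>s\<bar>" for x s i
  proof -
    have "norm (u (x + s *\<^sub>R axis i 1) - u (x + 0 *\<^sub>R axis i 1)) \<le> M i * norm (s - 0)"
      by (rule field_differentiable_bound[of UNIV "\<lambda>s. u (x + s *\<^sub>R axis i 1)" "\<lambda>s. d i (x + s *\<^sub>R axis i 1)"])
         (auto intro!: has_partial_line d M)
    then show ?thesis by simp
  qed
  have tel: "\<bar>u (x + (\<Sum>i\<in>S. (z $ i) *\<^sub>R axis i 1)) - u x\<bar> \<le> (\<Sum>i\<in>S. M i * \<bar>z $ i\<bar>)" if "finite S" for S x z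
    using that
  proof (induction S)
    case (insert j S)
    let ?y = "x + (\<Sum>i\<in>S. (z $ i) *\<^sub>R axis i 1)"
    have eq: "x + (\<Sum>i\<in>insert j S. (z $ i) *\<^sub>R axis i 1) = ?y + (z $ j) *\<^sub>R axis j 1"
      using insert by (simp add: algebra_simps)
    show ?case
      unfolding eq unfolding sum.insert[OF insert.hyps] using insert.IH one[of ?y "z $ j" j] by linarith
  qed simp
  have "K-lipschitz_on UNIV u"
  proof (rule lipschitz_on_realI)
    fix x y :: "real ^ 'n"
    have "\<bar>u x - u y\<bar> \<le> (\<Sum>i\<in>UNIV. M i * \<bar>(x - y) $ i\<bar>)"
      using tel[of UNIV y "x - y"] by (simp add: axis_expansion del: vector_minus_component)
    also have "\<dots> \<le> (\<Sum>i\<in>UNIV. M i * norm (x - y))"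
      by (intro sum_mono mult_left_mono component_le_norm_cart M0)
    finally show "\<bar>u x - u y\<bar> \<le> K * norm (x - y)" by (simp add: K_def sum_distrib_right)
  qed (simp add: K_def sum_nonneg M0)
  then show ?thesis using R by (rule lip_compI)
qed

lemma test_function_lip_comp:
  fixes u :: "real ^ 'n::finite \<Rightarrow> real"
  assumes "u \<in> test_functions \<Omega>"
  shows "lip_comp u"
proof -
  have C: "Ck (Suc 0) u" "compact (supp u)" using assms by (auto simp: test_functions_def smooth_def)
  then obtain R where R: "\<And>x. R < norm x \<Longrightarrow> u x = 0" unfolding compact_supp_iff by blast
  show ?thesis
    by (rule C1_compact_support_lip_comp[of u "\<lambda>i. partial_deriv i u" R])
       (use C(1) R in \<open>auto intro: has_partial_partial_deriv\<close>)
qed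

section \<open>Convolution with smooth kernels\<close>

definition convolution :: "(real ^ 'n::finite \<Rightarrow> real) \<Rightarrow> (real ^ 'n \<Rightarrow> real) \<Rightarrow> real ^ 'n \<Rightarrow> real" where
  "convolution u f x = (\<integral>y. u y * f (x - y) \<partial>lborel)"

text \<open>The box depends on u alone. A fixed compact domain is what continuity in a parameter and
  the Leibniz rule ask for.\<close>

lemma convolution_eq_integral:
  fixes u :: "real ^ 'n::finite \<Rightarrow> real"
  assumes u: "lip_comp u"
  obtains a b where "\<And>f x. continuous_on UNIV f \<Longrightarrow> convolution u f x = integral (cbox a b) (\<lambda>y. u y * f (x - y))"
proof -
  obtain L R where LR: "L-lipschitz_on UNIV u" "0 \<le> L" "0 \<le> R" "\<And>x. R < norm x \<Longrightarrow> u x = 0"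
    using u by (rule lip_compE) blast
  obtain a where a: "cball (0 :: real ^ 'n) R \<subseteq> cbox (- a) a"
    using bounded_subset_cbox_symmetric[OF bounded_cball] by blast
  show ?thesis
  proof (rule that[of "- a" a])
    fix f :: "real ^ 'n \<Rightarrow> real" and x
    assume f: "continuous_on UNIV f"
    have c: "continuous_on (cbox (- a) a) (\<lambda>y. u y * f (x - y))"
      by (intro continuous_intros continuous_on_compose2[OF f] continuous_on_subset[OF lip_comp_measurable(3)[OF u]]) auto
    have s: "set_integrable lborel (cbox (- a) a) (\<lambda>y. u y * f (x - y))"
      unfolding set_integrable_def using borel_integrable_compact[OF compact_cbox c] by (simp add: indicator_def if_distrib cong: if_cong)
    have "convolution u f x = (LINT y:cbox (- a) a|lborel. u y * f (x - y))"
      unfolding convolution_def set_lebesgue_integral_def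
    proof (rule Bochner_Integration.integral_cong)
      fix y :: "real ^ 'n"
      show "u y * f (x - y) = indicat_real (cbox (- a) a) y *\<^sub>R (u y * f (x - y))"
        using subsetD[OF a, of y] LR(4)[of y] by (cases "R < norm y") (auto simp: indicator_def)
    qed simp
    also have "\<dots> = integral (cbox (- a) a) (\<lambda>y. u y * f (x - y))"
      by (rule set_borel_integral_eq_integral(2)[OF s])
    finally show "convolution u f x = integral (cbox (- a) a) (\<lambda>y. u y * f (x - y))" .
  qed
qed

lemma convolution_continuous:
  fixes u :: "real ^ 'n::finite \<Rightarrow> real"
  assumes u: "lip_comp u" and f: "continuous_on UNIV f"
  shows "continuous_on UNIV (convolution u f)"
proof -
  obtain a b where ab: "\<And>f x. continuous_on UNIV f \<Longrightarrow> convolution u f x = integral (cbox a b) (\<lambda>y. u y * f (x - y))"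
    using convolution_eq_integral[OF u] by blast
  have "continuous_on UNIV (\<lambda>x. integral (cbox a b) (\<lambda>y. u y * f (x - y)))"
    by (rule integral_continuous_on_param)
       (auto simp: split_beta intro!: continuous_intros continuous_on_compose2[OF f] continuous_on_compose2[OF lip_comp_measurable(3)[OF u]])
  then show ?thesis using ab[OF f] by (simp add: ext cong: continuous_on_cong)
qed

lemma convolution_has_partial:
  fixes u :: "real ^ 'n::finite \<Rightarrow> real"
  assumes u: "lip_comp u" and f: "continuous_on UNIV f" and d: "continuous_on UNIV d"
    and fd: "\<And>x. has_partial f i x (d x)"
  shows "has_partial (convolution u f) i x (convolution u d x)"
proof -
  obtain a b where ab: "\<And>f x. continuous_on UNIV f \<Longrightarrow> convolution u f x = integral (cbox a b) (\<lambda>y. u y * f (x - y))"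
    using convolution_eq_integral[OF u] by blast
  have eq: "x + t *\<^sub>R axis i 1 - y = x - y + t *\<^sub>R axis i 1" for t y by simp
  have "((\<lambda>t. integral (cbox a b) (\<lambda>y. u y * f (x + t *\<^sub>R axis i 1 - y))) has_real_derivative
     integral (cbox a b) (\<lambda>y. u y * d (x + 0 *\<^sub>R axis i 1 - y))) (at 0 within UNIV)"
  proof (rule leibniz_rule_field_derivative)
    fix t y
    show "((\<lambda>t. u y * f (x + t *\<^sub>R axis i 1 - y)) has_real_derivative u y * d (x + t *\<^sub>R axis i 1 - y)) (at t within UNIV)"
      unfolding eq using DERIV_cmult[OF has_partial_line[OF fd]] by simp
    show "(\<lambda>y. u y * f (x + t *\<^sub>R axis i 1 - y)) integrable_on cbox a b"
      by (intro integrable_continuous continuous_intros continuous_on_compose2[OF f] continuous_on_compose2[OF lip_comp_measurable(3)[OF u]]) auto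
    show "continuous_on (UNIV \<times> cbox a b) (\<lambda>(t, y). u y * d (x + t *\<^sub>R axis i 1 - y))"
      by (auto simp: split_beta intro!: continuous_intros continuous_on_compose2[OF d] continuous_on_compose2[OF lip_comp_measurable(3)[OF u]])
  qed auto
  then show ?thesis unfolding ab[OF f] ab[OF d] by simp
qed

lemma convolution_partial_deriv:
  assumes u: "lip_comp u" and f: "bump_algebra h f"
  shows "has_partial (convolution u f) i x (convolution u (partial_deriv i f) x)"
  by (rule convolution_has_partial[OF u bump_algebra_continuous[OF f]
        bump_algebra_continuous[OF bump_algebra_partial_deriv(1)[OF f]] bump_algebra_partial_deriv(2)[OF f]])

lemma convolution_smooth:
  assumes u: "lip_comp u" and f: "bump_algebra h f"
  shows "smooth (convolution u f)"
proof -
  \<comment> \<open>Derivatives fall on the kernel, which stays in \<open>bump_algebra\<close>; the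
    induction over the order therefore ranges over all kernels.\<close>
  have "Ck k (convolution u f)" if "bump_algebra h f" for k f
    using that
  proof (induction k arbitrary: f)
    case 0
    then show ?case by (simp add: convolution_continuous[OF u] bump_algebra_continuous)
  next
    case (Suc k)
    have "partial_deriv i (convolution u f) = convolution u (partial_deriv i f)" for i
      by (rule ext, rule has_partial_imp, rule convolution_partial_deriv[OF u Suc.prems])
    then show ?case
      using Suc.IH[OF bump_algebra_partial_deriv(1)[OF Suc.prems]] Suc.prems
        has_partial_exists[OF convolution_partial_deriv[OF u Suc.prems]]
      by (auto simp: convolution_continuous[OF u] bump_algebra_continuous)
  qed
  then show ?thesis using f by (simp add: smooth_def)
qed

section \<open>Mollification\<close>

definition bump :: "real \<Rightarrow> real ^ 'n::finite \<Rightarrow> real" where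
  "bump h x = flat 0 (h\<^sup>2 - (norm x)\<^sup>2)"

text \<open>The type argument carries the dimension, which the radius does not determine.\<close>

definition bump_mass :: "'n::finite itself \<Rightarrow> real \<Rightarrow> real" where
  "bump_mass _ h = (\<integral>x. bump h (x :: real ^ 'n) \<partial>lborel)"

definition mollifier :: "real \<Rightarrow> real ^ 'n::finite \<Rightarrow> real" where
  "mollifier h x = (1 / bump_mass TYPE('n) h) * bump h x"

definition mollify :: "real \<Rightarrow> (real ^ 'n::finite \<Rightarrow> real) \<Rightarrow> real ^ 'n \<Rightarrow> real" where
  "mollify h u = convolution u (mollifier h)"

lemma bump_bounds: "0 \<le> bump h x" "bump h x \<le> 1"
  by (auto simp: bump_def flat_0_bounds)

lemma bump_outside: "h \<le> norm x \<Longrightarrow> 0 \<le> h \<Longrightarrow> bump h x = 0"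
  by (simp add: bump_def flat_def not_less power_mono)

lemma bump_inside: "norm x < h \<Longrightarrow> 0 < bump h x"
  by (simp add: bump_def flat_def power_strict_mono)

lemma bump_algebra_mollifier: "bump_algebra h (mollifier h)"
  unfolding mollifier_def bump_def by (intro bump_algebra.intros)

lemma mollifier_continuous: "continuous_on UNIV (mollifier h)"
  by (rule bump_algebra_continuous[OF bump_algebra_mollifier])

lemma bump_integrable:
  assumes "0 \<le> h"
  shows "integrable lborel (bump h :: real ^ 'n::finite \<Rightarrow> real)"
proof (rule integrable_bounded_compact_support[of _ h 1])
  have "bump_algebra h (bump h :: real ^ 'n \<Rightarrow> real)" unfolding bump_def by (rule bump_algebra.flat)
  then show "(bump h :: real ^ 'n \<Rightarrow> real) \<in> borel_measurable borel"
    by (intro borel_measurable_continuous_onI bump_algebra_continuous)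
qed (use assms in \<open>auto simp: bump_outside bump_bounds abs_le_iff intro!: AE_I2 order_trans[OF _ bump_bounds(1)]\<close>)

lemma bump_mass_pos:
  assumes h: "0 < h"
  shows "0 < bump_mass TYPE('n::finite) h"
proof -
  let ?b = "bump h :: real ^ 'n \<Rightarrow> real"
  have i: "integrable lborel ?b" using h by (intro bump_integrable) simp
  have "0 \<le> bump_mass TYPE('n) h" unfolding bump_mass_def by (intro integral_nonneg_AE) (simp add: bump_bounds)
  moreover have "bump_mass TYPE('n) h \<noteq> 0"
  proof
    assume "bump_mass TYPE('n) h = 0"
    then have "AE x in lborel. ?b x = 0"
      unfolding bump_mass_def using integral_nonneg_eq_0_iff_AE[OF i] by (simp add: bump_bounds)
    then have "AE x in lborel. x \<notin> ball (0 :: real ^ 'n) h"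
      by (rule AE_mp) (auto intro!: AE_I2 dest: bump_inside)
    then have "emeasure lborel (ball (0 :: real ^ 'n) h) = 0"
      by (subst (asm) AE_iff_measurable[OF _ refl]) (auto simp: ball_def)
    then have "ball (0 :: real ^ 'n) h \<in> null_sets lborel" by (auto intro!: null_setsI)
    then have "negligible (ball (0 :: real ^ 'n) h)"
      by (auto simp: negligible_iff_null_sets null_sets_def)
    then show False using h open_not_negligible[of "ball (0 :: real ^ 'n) h"] by auto
  qed
  ultimately show ?thesis by simp
qed

context
  fixes h :: real
  assumes h: "0 < h"
begin

lemma mollifier_nonneg: "0 \<le> mollifier h (x :: real ^ 'n::finite)"
  using bump_mass_pos[OF h, where 'n='n] by (auto simp: mollifier_def bump_bounds less_imp_le)

lemma mollifier_le: "mollifier h (x :: real ^ 'n::finite) \<le> 1 / bump_mass TYPE('n) h"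
  using bump_mass_pos[OF h, where 'n='n] mult_left_mono[OF bump_bounds(2)[of h x], of "1 / bump_mass TYPE('n) h"]
  by (simp add: mollifier_def)

lemma mollifier_outside: "h \<le> norm x \<Longrightarrow> mollifier h x = 0"
  using h by (simp add: mollifier_def bump_outside)

lemma mollifier_sym: "mollifier h (x - y) = mollifier h (y - x)"
  by (simp add: mollifier_def bump_def norm_minus_commute)

lemma mollifier_integrable: "integrable lborel (mollifier h)"
  unfolding mollifier_def using h by (intro integrable_mult_right bump_integrable) simp

lemma mollifier_measurable [measurable]: "mollifier h \<in> borel_measurable borel"
  by (intro borel_measurable_continuous_onI mollifier_continuous)

lemma integral_mollifier: "(\<integral>x. mollifier h (x :: real ^ 'n::finite) \<partial>lborel) = 1"
  using bump_mass_pos[OF h, where 'n='n] by (simp add: mollifier_def) (simp add: bump_mass_def)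

lemma integrable_mollifier_shift: "integrable lborel (\<lambda>y. mollifier h (x - y))"
  using integrable_translate[OF mollifier_integrable, of "- x"] mollifier_sym[of x] by simp

lemma integral_mollifier_shift: "(\<integral>y. mollifier h (x - y :: real ^ 'n::finite) \<partial>lborel) = 1"
  using integral_translate[of "mollifier h" "- x"] integral_mollifier mollifier_sym[of x] by simp

lemma mollifier_lip_comp: "lip_comp (mollifier h)"
  by (rule C1_compact_support_lip_comp[of "mollifier h" "\<lambda>i. partial_deriv i (mollifier h)" h])
     (auto intro: bump_algebra_partial_deriv(2)[OF bump_algebra_mollifier]
        bump_algebra_continuous[OF bump_algebra_partial_deriv(1)[OF bump_algebra_mollifier]] mollifier_outside)

lemma mollifier_shift_lipschitz:
  fixes x :: "real ^ 'n::finite"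
  obtains M where "M-lipschitz_on UNIV (\<lambda>y. mollifier h (x - y))"
proof -
  obtain M where M: "M-lipschitz_on UNIV (mollifier h :: real ^ 'n \<Rightarrow> real)" using mollifier_lip_comp lip_comp_def by blast
  have "M-lipschitz_on UNIV (\<lambda>y. mollifier h (x - y))"
  proof (rule lipschitz_on_realI)
    show "\<bar>mollifier h (x - y) - mollifier h (x - z)\<bar> \<le> M * norm (y - z)" for y z
      using lipschitz_on_realD[OF M, of "x - y" "x - z"] by (simp add: norm_minus_commute)
  qed (rule lipschitz_on_nonneg[OF M])
  then show ?thesis by (rule that)
qed

lemma integrable_mult_mollifier:
  fixes a :: "real ^ 'n::finite \<Rightarrow> real"
  assumes [measurable]: "a \<in> borel_measurable borel" and 0: "\<And>x. R < norm x \<Longrightarrow> a x = 0"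
    and bd: "AE x in lborel. \<bar>a x\<bar> \<le> M" and M: "0 \<le> M"
  shows "integrable lborel (\<lambda>y. a y * mollifier h (x - y))"
proof (rule integrable_bounded_compact_support[of _ R "M * (1 / bump_mass TYPE('n) h)"])
  show "AE y in lborel. \<bar>a y * mollifier h (x - y)\<bar> \<le> M * (1 / bump_mass TYPE('n) h)"
    using bd
  proof eventually_elim
    case (elim y)
    then show ?case
      unfolding abs_mult using mollifier_le[of "x - y"] mollifier_nonneg[of "x - y"] M by (intro mult_mono) auto
  qed
qed (use 0 in auto)

text \<open>Nonnegativity of the variance: the kernel is a probability density, and
  \<open>?m\<close> is the mean of a.\<close>

lemma jensen_mollifier:
  fixes a :: "real ^ 'n::finite \<Rightarrow> real"
  assumes [measurable]: "a \<in> borel_measurable borel" and 0: "\<And>x. R < norm x \<Longrightarrow> a x = 0"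
    and bd: "AE x in lborel. \<bar>a x\<bar> \<le> M" and M: "0 \<le> M"
  shows "(\<integral>y. a y * mollifier h (x - y) \<partial>lborel)\<^sup>2 \<le> (\<integral>y. (a y)\<^sup>2 * mollifier h (x - y) \<partial>lborel)"
proof -
  let ?m = "\<integral>y. a y * mollifier h (x - y) \<partial>lborel"
  have i1: "integrable lborel (\<lambda>y. a y * mollifier h (x - y))"
    by (rule integrable_mult_mollifier[OF _ 0 bd M]) simp
  have i2: "integrable lborel (\<lambda>y. (a y)\<^sup>2 * mollifier h (x - y))"
  proof (rule integrable_mult_mollifier[of _ R "M\<^sup>2"])
    show "AE x in lborel. \<bar>(a x)\<^sup>2\<bar> \<le> M\<^sup>2"
      using bd by (rule AE_mp) (auto intro!: AE_I2 simp: abs_le_square_iff[symmetric] M)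
  qed (use 0 in auto)
  have i3: "integrable lborel (\<lambda>y. mollifier h (x - y))" by (rule integrable_mollifier_shift)
  have "0 \<le> (\<integral>y. (a y - ?m)\<^sup>2 * mollifier h (x - y) \<partial>lborel)"
    by (intro integral_nonneg_AE AE_I2 mult_nonneg_nonneg mollifier_nonneg) simp
  also have "\<dots> = (\<integral>y. (a y)\<^sup>2 * mollifier h (x - y) - 2 * ?m * (a y * mollifier h (x - y)) + ?m\<^sup>2 * mollifier h (x - y) \<partial>lborel)"
    by (intro Bochner_Integration.integral_cong) (auto simp: power2_eq_square algebra_simps)
  also have "\<dots> = (\<integral>y. (a y)\<^sup>2 * mollifier h (x - y) \<partial>lborel) - 2 * ?m * ?m + ?m\<^sup>2 * 1"
    using i1 i2 i3
    by (simp only: Bochner_Integration.integral_add Bochner_Integration.integral_diff integrable_mult_right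
        Bochner_Integration.integrable_diff integral_mult_right_zero integral_mollifier_shift)
  finally show ?thesis by (simp add: power2_eq_square)
qed

lemma mollify_smooth: "lip_comp u \<Longrightarrow> smooth (mollify h u)"
  unfolding mollify_def by (rule convolution_smooth[OF _ bump_algebra_mollifier])

lemma mollify_support:
  assumes "\<And>y. dist x y < h \<Longrightarrow> u y = 0"
  shows "mollify h u x = 0"
proof -
  have eq: "u y * mollifier h (x - y) = 0" for y
    using assms[of y] mollifier_outside[of "x - y"] by (cases "dist x y < h") (auto simp: dist_norm)
  show ?thesis unfolding mollify_def convolution_def eq by simp
qed

lemma mollify_nonneg: "(\<And>x. 0 \<le> u x) \<Longrightarrow> 0 \<le> mollify h u x"
  unfolding mollify_def convolution_def by (intro integral_nonneg_AE AE_I2 mult_nonneg_nonneg mollifier_nonneg)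

lemma mollify_lip_comp:
  fixes u :: "real ^ 'n::finite \<Rightarrow> real"
  assumes u: "lip_comp u"
  shows "lip_comp (mollify h u)"
proof -
  obtain L R where LR: "L-lipschitz_on UNIV u" "0 \<le> L" "0 \<le> R" "\<And>x. R < norm x \<Longrightarrow> u x = 0"
    using u by (rule lip_compE) blast
  show ?thesis
  proof (rule C1_compact_support_lip_comp)
    show "has_partial (mollify h u) i x (convolution u (partial_deriv i (mollifier h)) x)" for i x
      unfolding mollify_def by (rule convolution_partial_deriv[OF u bump_algebra_mollifier])
    show "continuous_on UNIV (convolution u (partial_deriv i (mollifier h)))" for i
      by (rule convolution_continuous[OF u bump_algebra_continuous[OF bump_algebra_partial_deriv(1)[OF bump_algebra_mollifier]]])
    show "mollify h u x = 0" if "R + h < norm x" for x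
    proof (rule mollify_support)
      fix y assume "dist x y < h"
      then have "R < norm y" using that norm_triangle_ineq2[of x y] by (simp add: dist_norm)
      then show "u y = 0" by (rule LR)
    qed
  qed
qed

lemma integrable_u_mollifier:
  assumes u: "lip_comp u"
  shows "integrable lborel (\<lambda>y. u y * mollifier h (x - y))"
proof -
  obtain L R where LR: "L-lipschitz_on UNIV u" "0 \<le> L" "0 \<le> R" "\<And>x. R < norm x \<Longrightarrow> u x = 0"
    using u by (rule lip_compE) blast
  obtain B where B: "0 \<le> B" "\<And>x. \<bar>u x\<bar> \<le> B" using u by (rule lip_comp_bounded) blast
  show ?thesis
    by (rule integrable_mult_mollifier[where R = R and M = B]) (use B LR lip_comp_measurable(2)[OF u] in auto)
qed

lemma mollify_minus_const:
  fixes u :: "real ^ 'n::finite \<Rightarrow> real"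
  assumes u: "lip_comp u"
  shows "integrable lborel (\<lambda>y. (c - u y) * mollifier h (x - y))"
    "c - mollify h u x = (\<integral>y. (c - u y) * mollifier h (x - y) \<partial>lborel)"
proof -
  have eq: "(c - u y) * mollifier h (x - y) = c * mollifier h (x - y) - u y * mollifier h (x - y)" for y
    by (simp add: algebra_simps)
  note i = integrable_mult_right[OF integrable_mollifier_shift[of x], of c] integrable_u_mollifier[OF u, of x]
  show "integrable lborel (\<lambda>y. (c - u y) * mollifier h (x - y))"
    unfolding eq by (rule Bochner_Integration.integrable_diff[OF i])
  show "c - mollify h u x = (\<integral>y. (c - u y) * mollifier h (x - y) \<partial>lborel)"
    unfolding eq Bochner_Integration.integral_diff[OF i]
    by (simp add: mollify_def convolution_def integral_mollifier_shift)
qed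

lemma mollify_close:
  fixes u :: "real ^ 'n::finite \<Rightarrow> real"
  assumes u: "lip_comp u" and L: "L-lipschitz_on UNIV u"
  shows "\<bar>mollify h u x - u x\<bar> \<le> L * h"
proof -
  have "\<bar>u x - mollify h u x\<bar> = \<bar>\<integral>y. (u x - u y) * mollifier h (x - y) \<partial>lborel\<bar>"
    by (simp add: mollify_minus_const[OF u])
  also have "\<dots> \<le> (\<integral>y. \<bar>(u x - u y) * mollifier h (x - y)\<bar> \<partial>lborel)"
    by (rule integral_abs_bound)
  also have "\<dots> \<le> (\<integral>y. (L * h) * mollifier h (x - y) \<partial>lborel)"
  proof (rule integral_mono)
    show "integrable lborel (\<lambda>y. \<bar>(u x - u y) * mollifier h (x - y)\<bar>)"
      by (intro integrable_abs mollify_minus_const u)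
    show "integrable lborel (\<lambda>y. (L * h) * mollifier h (x - y))"
      by (intro integrable_mult_right integrable_mollifier_shift)
    fix y
    show "\<bar>(u x - u y) * mollifier h (x - y)\<bar> \<le> (L * h) * mollifier h (x - y)"
    proof (cases "h \<le> norm (x - y)")
      case False
      have "\<bar>u x - u y\<bar> \<le> L * norm (x - y)" by (rule lipschitz_on_realD[OF L])
      also have "\<dots> \<le> L * h" using False lipschitz_on_nonneg[OF L] by (intro mult_left_mono) auto
      finally show ?thesis using mollifier_nonneg[of "x - y"] by (simp add: abs_mult mult_right_mono)
    qed (simp add: mollifier_outside)
  qed
  also have "\<dots> = L * h" by (simp add: integral_mollifier_shift)
  finally show ?thesis by (simp add: abs_minus_commute)
qed

text \<open>Moves the derivative from the kernel to u. The product of u and the shifted kernel is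
  Lipschitz with compact support, so its partial derivative integrates to 0.\<close>

lemma mollify_partial_deriv:
  fixes u :: "real ^ 'n::finite \<Rightarrow> real"
  assumes u: "lip_comp u"
  shows "partial_deriv i (mollify h u) x = (\<integral>y. partial_deriv i u y * mollifier h (x - y) \<partial>lborel)"
proof -
  let ?d = "partial_deriv i (mollifier h)"
  obtain L R where LR: "L-lipschitz_on UNIV u" "0 \<le> L" "0 \<le> R" "\<And>x. R < norm x \<Longrightarrow> u x = 0"
    using u by (rule lip_compE) blast
  obtain B where B: "0 \<le> B" "\<And>x. \<bar>u x\<bar> \<le> B" using u by (rule lip_comp_bounded) blast
  obtain M where M: "0 \<le> M" "AE x in lborel. \<forall>i. \<bar>partial_deriv i u x\<bar> \<le> M"
    using u by (rule lip_comp_partial_bounded) blast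
  obtain K where K: "K-lipschitz_on UNIV (mollifier h :: real ^ 'n \<Rightarrow> real)" using mollifier_lip_comp lip_comp_def by blast
  obtain K' where K': "K'-lipschitz_on UNIV (\<lambda>y. mollifier h (x - y))" by (rule mollifier_shift_lipschitz)
  note [measurable] = lip_comp_measurable[OF u]
  have dc: "continuous_on UNIV ?d"
    by (rule bump_algebra_continuous[OF bump_algebra_partial_deriv(1)[OF bump_algebra_mollifier]])
  have [measurable]: "?d \<in> borel_measurable borel" using dc by (rule borel_measurable_continuous_onI)
  have dK: "\<bar>?d y\<bar> \<le> K" for y
    by (rule has_partial_lipschitz[OF K bump_algebra_partial_deriv(2)[OF bump_algebra_mollifier]])
  define g where "g = (\<lambda>y. u y * mollifier h (x - y))"
  have g: "lip_comp g" unfolding g_def by (rule lip_comp_mult[OF u K'])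
  have i1: "integrable lborel (\<lambda>y. partial_deriv i u y * mollifier h (x - y))"
  proof (rule integrable_mult_mollifier[of _ R M])
    show "AE x in lborel. \<bar>partial_deriv i u x\<bar> \<le> M" using M(2) by (rule AE_mp) simp
  qed (use M partial_deriv_zero_norm[OF LR(4)] in auto)
  have i2: "integrable lborel (\<lambda>y. u y * ?d (x - y))"
  proof (rule integrable_bounded_compact_support[of _ R "B * K"])
    show "AE y in lborel. \<bar>u y * ?d (x - y)\<bar> \<le> B * K"
      unfolding abs_mult using B dK by (intro AE_I2 mult_mono) auto
  qed (use LR in auto)
  have ae: "AE y in lborel. partial_deriv i g y = partial_deriv i u y * mollifier h (x - y) - u y * ?d (x - y)"
    using lip_comp_AE_partials[OF u]
  proof eventually_elim
    case (elim y)
    have eq: "x - (y + t *\<^sub>R axis i 1) = x - y + (- t) *\<^sub>R axis i 1" for t by simp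
    have "((\<lambda>t. mollifier h (x - y + (- t) *\<^sub>R axis i 1)) has_real_derivative ?d (x - y) * (- 1)) (at 0)"
    proof (rule DERIV_chain2[where f = "\<lambda>t. mollifier h (x - y + t *\<^sub>R axis i 1)" and g = uminus])
      show "((\<lambda>t. mollifier h (x - y + t *\<^sub>R axis i 1)) has_real_derivative ?d (x - y)) (at (- 0))"
        using bump_algebra_partial_deriv(2)[OF bump_algebra_mollifier, of h "x - y" i] by simp
    qed (auto intro!: derivative_eq_intros)
    then have "has_partial (\<lambda>y. mollifier h (x - y)) i y (- ?d (x - y))"
      unfolding eq by simp
    from has_partial_mult[OF elim[rule_format] this]
    show ?case unfolding g_def by (intro has_partial_imp) (simp add: algebra_simps)
  qed
  have "0 = (\<integral>y. partial_deriv i g y \<partial>lborel)" by (simp add: integral_partial_deriv_zero[OF g])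
  also have "\<dots> = (\<integral>y. partial_deriv i u y * mollifier h (x - y) - u y * ?d (x - y) \<partial>lborel)"
    using lip_comp_measurable[OF g] ae by (intro integral_cong_AE) auto
  also have "\<dots> = (\<integral>y. partial_deriv i u y * mollifier h (x - y) \<partial>lborel) - convolution u ?d x"
    unfolding convolution_def by (rule Bochner_Integration.integral_diff[OF i1 i2])
  also have "convolution u ?d x = partial_deriv i (mollify h u) x"
    unfolding mollify_def by (rule has_partial_imp[symmetric, OF convolution_partial_deriv[OF u bump_algebra_mollifier]])
  finally show ?thesis by simp
qed

text \<open>Jensen's inequality for each partial derivative, then Fubini: the kernel has mass one in
  the variable x as well.\<close>

lemma energy_mollify:
  fixes u :: "real ^ 'n::finite \<Rightarrow> real"
  assumes u: "lip_comp u"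
  shows "energy (mollify h u) \<le> energy u"
  unfolding energy_eq_sum[OF u] energy_eq_sum[OF mollify_lip_comp[OF u]]
proof (rule sum_mono)
  fix i :: 'n
  obtain L R where LR: "L-lipschitz_on UNIV u" "0 \<le> L" "0 \<le> R" "\<And>x. R < norm x \<Longrightarrow> u x = 0"
    using u by (rule lip_compE) blast
  obtain M where M: "0 \<le> M" "AE x in lborel. \<forall>i. \<bar>partial_deriv i u x\<bar> \<le> M"
    using u by (rule lip_comp_partial_bounded) blast
  have M2: "AE x in lborel. \<bar>partial_deriv i u x\<bar> \<le> M" using M(2) by (rule AE_mp) simp
  note [measurable] = lip_comp_measurable[OF u]
  have zero: "partial_deriv i u x = 0" if "R < norm x" for x by (rule partial_deriv_zero_norm[OF LR(4) that])
  have "(\<integral>\<^sup>+x. ennreal ((partial_deriv i (mollify h u) x)\<^sup>2) \<partial>lborel)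
    \<le> (\<integral>\<^sup>+x. (\<integral>\<^sup>+y. ennreal ((partial_deriv i u y)\<^sup>2 * mollifier h (x - y)) \<partial>lborel) \<partial>lborel)"
  proof (rule nn_integral_mono)
    fix x
    have "integrable lborel (\<lambda>y. (partial_deriv i u y)\<^sup>2 * mollifier h (x - y))"
    proof (rule integrable_mult_mollifier[of _ R "M\<^sup>2"])
      show "AE x in lborel. \<bar>(partial_deriv i u x)\<^sup>2\<bar> \<le> M\<^sup>2"
        using M2 by (rule AE_mp) (auto intro!: AE_I2 simp: abs_le_square_iff[symmetric] M)
    qed (use zero in auto)
    then have "(\<integral>\<^sup>+y. ennreal ((partial_deriv i u y)\<^sup>2 * mollifier h (x - y)) \<partial>lborel) =
        ennreal (\<integral>y. (partial_deriv i u y)\<^sup>2 * mollifier h (x - y) \<partial>lborel)"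
      by (rule nn_integral_eq_integral) (simp add: mollifier_nonneg)
    then show "ennreal ((partial_deriv i (mollify h u) x)\<^sup>2) \<le> (\<integral>\<^sup>+y. ennreal ((partial_deriv i u y)\<^sup>2 * mollifier h (x - y)) \<partial>lborel)"
      unfolding mollify_partial_deriv[OF u]
      using jensen_mollifier[OF _ zero M2 M(1)] by (simp add: ennreal_leI)
  qed
  also have "\<dots> = (\<integral>\<^sup>+y. (\<integral>\<^sup>+x. ennreal ((partial_deriv i u y)\<^sup>2 * mollifier h (x - y)) \<partial>lborel) \<partial>lborel)"
    by (rule lborel_pair.Fubini') measurable
  also have "\<dots> = (\<integral>\<^sup>+y. ennreal ((partial_deriv i u y)\<^sup>2) \<partial>lborel)"
  proof (rule nn_integral_cong)
    fix y :: "real ^ 'n"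
    have "(\<integral>\<^sup>+x. ennreal ((partial_deriv i u y)\<^sup>2 * mollifier h (x - y)) \<partial>lborel) =
      ennreal ((partial_deriv i u y)\<^sup>2) * (\<integral>\<^sup>+x. ennreal (mollifier h (x + (- y))) \<partial>lborel)"
      by (subst nn_integral_cmult[symmetric]) (auto simp: ennreal_mult mollifier_nonneg)
    also have "(\<integral>\<^sup>+x. ennreal (mollifier h (x + (- y))) \<partial>lborel) = (\<integral>\<^sup>+x. ennreal (mollifier h (x :: real ^ 'n)) \<partial>lborel)"
      by (rule nn_integral_translate) measurable
    also have "\<dots> = 1"
      by (subst nn_integral_eq_integral) (auto simp: mollifier_integrable mollifier_nonneg integral_mollifier)
    finally show "(\<integral>\<^sup>+x. ennreal ((partial_deriv i u y)\<^sup>2 * mollifier h (x - y)) \<partial>lborel) = ennreal ((partial_deriv i u y)\<^sup>2)"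
      by simp
  qed
  finally show "(\<integral>\<^sup>+x. ennreal ((partial_deriv i (mollify h u) x)\<^sup>2) \<partial>lborel) \<le> (\<integral>\<^sup>+y. ennreal ((partial_deriv i u y)\<^sup>2) \<partial>lborel)" .
qed

end

section \<open>The capacitary Poincare inequality\<close>

text \<open>The step s is split into N equal pieces. Cauchy-Schwarz and translation invariance bound
  the left side by \<open>N^2\<close> times the integral of the squared increments over s/N, and the
  limit in N produces the derivative.\<close>

lemma coordinate_translation_estimate:
  fixes u :: "real ^ 'n::finite \<Rightarrow> real"
  assumes u: "lip_comp u"
  shows "(\<integral>\<^sup>+x. ennreal ((u (x + s *\<^sub>R axis i 1) - u x)\<^sup>2) \<partial>lborel)
    \<le> ennreal (s\<^sup>2) * (\<integral>\<^sup>+x. ennreal ((partial_deriv i u x)\<^sup>2) \<partial>lborel)"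
proof -
  note [measurable] = lip_comp_measurable[OF u]
  have [measurable]: "cball (0 :: real ^ 'n) R \<in> sets borel" for R by simp
  let ?e = "axis i (1::real) :: real ^ 'n"
  let ?s = "\<lambda>k x. (u (x + (s / Suc k) *\<^sub>R ?e) - u x) * real (Suc k)"
  obtain M R where M: "0 \<le> M" "\<And>k x. R < norm x \<Longrightarrow> ?s k x = 0" "\<And>k x. \<bar>?s k x\<bar> \<le> M"
    using lip_comp_quotient[OF u, of s i] by blast
  have le: "(\<integral>\<^sup>+x. ennreal ((u (x + s *\<^sub>R ?e) - u x)\<^sup>2) \<partial>lborel) \<le> (\<integral>\<^sup>+x. ennreal ((?s k x)\<^sup>2) \<partial>lborel)" for k
  proof -
    define N where "N = Suc k"
    define a where "a = s / N"
    let ?D = "\<lambda>x. (u (x + a *\<^sub>R ?e) - u x)\<^sup>2"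
    have pt: "(u (x + s *\<^sub>R ?e) - u x)\<^sup>2 \<le> real N * (\<Sum>j<N. ?D (x + (real j * a) *\<^sub>R ?e))" for x
    proof -
      have "u (x + s *\<^sub>R ?e) - u x = (\<Sum>j<N. u (x + (real (Suc j) * a) *\<^sub>R ?e) - u (x + (real j * a) *\<^sub>R ?e))"
        by (subst sum_lessThan_telescope) (simp add: a_def N_def del: of_nat_Suc)
      also have "\<dots> = (\<Sum>j<N. u (x + (real j * a) *\<^sub>R ?e + a *\<^sub>R ?e) - u (x + (real j * a) *\<^sub>R ?e))"
        by (simp add: algebra_simps)
      finally show ?thesis
        using sum_squared_le_sum_of_squares[of "\<lambda>j. u (x + (real j * a) *\<^sub>R ?e + a *\<^sub>R ?e) - u (x + (real j * a) *\<^sub>R ?e)" "{..<N}"]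
        by (simp add: mult.commute)
    qed
    have "(\<integral>\<^sup>+x. ennreal ((u (x + s *\<^sub>R ?e) - u x)\<^sup>2) \<partial>lborel)
      \<le> (\<integral>\<^sup>+x. ennreal (real N) * (\<Sum>j<N. ennreal (?D (x + (real j * a) *\<^sub>R ?e))) \<partial>lborel)"
      by (intro nn_integral_mono) (simp add: ennreal_mult''[symmetric] sum_nonneg ennreal_leI pt)
    also have "\<dots> = ennreal (real N) * (\<integral>\<^sup>+x. (\<Sum>j<N. ennreal (?D (x + (real j * a) *\<^sub>R ?e))) \<partial>lborel)"
      by (rule nn_integral_cmult) measurable
    also have "(\<integral>\<^sup>+x. (\<Sum>j<N. ennreal (?D (x + (real j * a) *\<^sub>R ?e))) \<partial>lborel) = (\<Sum>j<N. \<integral>\<^sup>+x. ennreal (?D (x + (real j * a) *\<^sub>R ?e)) \<partial>lborel)"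
      by (rule nn_integral_sum) measurable
    also have "ennreal (real N) * (\<Sum>j<N. \<integral>\<^sup>+x. ennreal (?D (x + (real j * a) *\<^sub>R ?e)) \<partial>lborel) = ennreal (real N) * (\<Sum>j<N. \<integral>\<^sup>+x. ennreal (?D x) \<partial>lborel)"
      by (intro arg_cong2[where f = "(*)"] refl sum.cong nn_integral_translate) measurable
    also have "\<dots> = ennreal ((real N)\<^sup>2) * (\<integral>\<^sup>+x. ennreal (?D x) \<partial>lborel)"
      by (simp add: power2_eq_square ennreal_mult ennreal_of_nat_eq_real_of_nat mult.assoc)
    also have "\<dots> = (\<integral>\<^sup>+x. ennreal ((real N)\<^sup>2) * ennreal (?D x) \<partial>lborel)"
      by (rule nn_integral_cmult[symmetric]) measurable
    also have "\<dots> = (\<integral>\<^sup>+x. ennreal ((?s k x)\<^sup>2) \<partial>lborel)"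
      by (intro nn_integral_cong) (simp add: ennreal_mult''[symmetric] power_mult_distrib a_def N_def mult.commute del: of_nat_Suc)
    finally show ?thesis .
  qed
  have "(\<lambda>k. \<integral>\<^sup>+x. ennreal ((?s k x)\<^sup>2) \<partial>lborel) \<longlonglongrightarrow> (\<integral>\<^sup>+x. ennreal ((s * partial_deriv i u x)\<^sup>2) \<partial>lborel)"
  proof (rule nn_integral_dominated_convergence[where w = "\<lambda>x. ennreal (M\<^sup>2) * indicator (cball 0 R) x"])
    show "AE x in lborel. (\<lambda>k. ennreal ((?s k x)\<^sup>2)) \<longlonglongrightarrow> ennreal ((s * partial_deriv i u x)\<^sup>2)"
      using lip_comp_AE_partials[OF u]
    proof eventually_elim
      case (elim x)
      then show ?case by (intro tendsto_ennrealI tendsto_power has_partial_quotient_seq) auto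
    qed
    show "AE x in lborel. ennreal ((?s k x)\<^sup>2) \<le> ennreal (M\<^sup>2) * indicator (cball 0 R) x" for k
    proof (rule AE_I2)
      fix x :: "real ^ 'n"
      have "(?s k x)\<^sup>2 \<le> M\<^sup>2" using power_mono[OF M(3)[where k = k and x = x], of 2] by simp
      then show "ennreal ((?s k x)\<^sup>2) \<le> ennreal (M\<^sup>2) * indicator (cball 0 R) x"
        using M(2)[where k = k and x = x] by (cases "R < norm x") (auto simp: indicator_def intro: ennreal_leI simp del: of_nat_Suc)
    qed
    show "(\<integral>\<^sup>+x. ennreal (M\<^sup>2) * indicator (cball (0 :: real ^ 'n) R) x \<partial>lborel) < \<infinity>"
      using emeasure_lborel_cball_finite[of "0 :: real ^ 'n" R] by (subst nn_integral_cmult_indicator) (auto simp: ennreal_mult_less_top)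
  qed measurable
  then have "(\<integral>\<^sup>+x. ennreal ((u (x + s *\<^sub>R ?e) - u x)\<^sup>2) \<partial>lborel) \<le> (\<integral>\<^sup>+x. ennreal ((s * partial_deriv i u x)\<^sup>2) \<partial>lborel)"
    by (rule LIMSEQ_le_const) (use le in blast)
  also have "\<dots> = ennreal (s\<^sup>2) * (\<integral>\<^sup>+x. ennreal ((partial_deriv i u x)\<^sup>2) \<partial>lborel)"
    by (subst nn_integral_cmult[symmetric]) (auto simp: power_mult_distrib ennreal_mult)
  finally show ?thesis .
qed

text \<open>Coordinates are moved one at a time. Each splitting
  \<open>(a - c)^2 <= 2 (a - b)^2 + 2 (b - c)^2\<close> costs a factor 2, hence
  \<open>2^n\<close>.\<close>

lemma translation_estimate:
  fixes u :: "real ^ 'n::finite \<Rightarrow> real"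
  assumes u: "lip_comp u"
  shows "(\<integral>\<^sup>+x. ennreal ((u (x + z) - u x)\<^sup>2) \<partial>lborel) \<le> ennreal (2 ^ CARD('n) * (norm z)\<^sup>2) * energy u"
proof -
  note [measurable] = lip_comp_measurable[OF u]
  let ?E = "\<lambda>i. \<integral>\<^sup>+x. ennreal ((partial_deriv i u x)\<^sup>2) \<partial>lborel"
  let ?z = "\<lambda>S. \<Sum>i\<in>S. (z $ i) *\<^sub>R axis i (1::real)"
  have "(\<integral>\<^sup>+x. ennreal ((u (x + ?z S) - u x)\<^sup>2) \<partial>lborel) \<le> ennreal (2 ^ card S * (norm z)\<^sup>2) * (\<Sum>i\<in>S. ?E i)"
    if "finite S" for S
    using that
  proof (induction S)
    case (insert j S)
    let ?c = "2 ^ card S * (norm z)\<^sup>2"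
    let ?D = "\<lambda>x. (u (x + (z $ j) *\<^sub>R axis j 1) - u x)\<^sup>2"
    have zj: "(z $ j)\<^sup>2 \<le> ?c"
    proof -
      have "(z $ j)\<^sup>2 \<le> (norm z)\<^sup>2" using power_mono[OF component_le_norm_cart[of z j], of 2] by simp
      also have "\<dots> \<le> ?c" using mult_right_mono[OF one_le_power[of 2 "card S"], of "(norm z)\<^sup>2"] by simp
      finally show ?thesis .
    qed
    have "(\<integral>\<^sup>+x. ennreal ((u (x + ?z (insert j S)) - u x)\<^sup>2) \<partial>lborel)
      \<le> (\<integral>\<^sup>+x. ennreal 2 * ennreal (?D (x + ?z S)) + ennreal 2 * ennreal ((u (x + ?z S) - u x)\<^sup>2) \<partial>lborel)"
    proof (rule nn_integral_mono)
      fix x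
      have e: "x + ?z (insert j S) = (x + ?z S) + (z $ j) *\<^sub>R axis j 1"
        using insert by (simp add: algebra_simps)
      have "(a - c)\<^sup>2 \<le> 2 * (a - b)\<^sup>2 + 2 * (b - c)\<^sup>2" for a b c :: real
        using zero_le_power2[of "a - b - (b - c)"] by (simp add: power2_eq_square algebra_simps)
      from ennreal_leI[OF this]
      show "ennreal ((u (x + ?z (insert j S)) - u x)\<^sup>2) \<le> ennreal 2 * ennreal (?D (x + ?z S)) + ennreal 2 * ennreal ((u (x + ?z S) - u x)\<^sup>2)"
        unfolding e by (simp only: ennreal_mult''[symmetric] ennreal_plus[symmetric] zero_le_power2 mult_nonneg_nonneg zero_le_numeral)
    qed
    also have "\<dots> = ennreal 2 * (\<integral>\<^sup>+x. ennreal (?D (x + ?z S)) \<partial>lborel) + ennreal 2 * (\<integral>\<^sup>+x. ennreal ((u (x + ?z S) - u x)\<^sup>2) \<partial>lborel)"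
      by (subst nn_integral_add) (auto simp: nn_integral_cmult)
    also have "(\<integral>\<^sup>+x. ennreal (?D (x + ?z S)) \<partial>lborel) = (\<integral>\<^sup>+x. ennreal (?D x) \<partial>lborel)"
      by (rule nn_integral_translate) measurable
    also have "ennreal 2 * (\<integral>\<^sup>+x. ennreal (?D x) \<partial>lborel) + ennreal 2 * (\<integral>\<^sup>+x. ennreal ((u (x + ?z S) - u x)\<^sup>2) \<partial>lborel)
      \<le> ennreal 2 * (ennreal ?c * ?E j) + ennreal 2 * (ennreal ?c * (\<Sum>i\<in>S. ?E i))"
      using coordinate_translation_estimate[OF u, of "z $ j" j] zj insert.IH
      by (intro add_mono mult_left_mono order_trans[OF coordinate_translation_estimate[OF u] mult_right_mono] ennreal_leI) auto
    also have "\<dots> = (ennreal 2 * ennreal ?c) * (?E j + (\<Sum>i\<in>S. ?E i))"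
      by (simp add: distrib_left mult.assoc)
    also have "ennreal 2 * ennreal ?c = ennreal (2 ^ card (insert j S) * (norm z)\<^sup>2)"
      using insert by (simp add: ennreal_mult''[symmetric] mult.assoc del: ennreal_numeral)
    finally show ?case using insert by simp
  qed simp
  from this[of UNIV] show ?thesis by (simp add: axis_expansion energy_eq_sum[OF u])
qed

text \<open>Serves both directions: with \<open>1 - u / u y\<close> to test a capacity and with
  \<open>1 - u\<close> to build a trial function. The factors 2 come from squaring the two terms of
  the product rule, and \<open>n / h^2\<close> from bounding each of the n partial derivatives of
  the cutoff by 1/h.\<close>

lemma energy_cutoff:
  fixes u :: "real ^ 'n::finite \<Rightarrow> real"
  assumes u: "lip_comp u" and h: "0 < h"
  shows "lip_comp (\<lambda>x. cutoff c s h x * (a + b * u x))"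
    "energy (\<lambda>x. cutoff c s h x * (a + b * u x)) \<le>
      (\<integral>\<^sup>+x. indicator (cball c s) x * ennreal (2 * b\<^sup>2 * (norm (gradient u x))\<^sup>2 + (2 * real CARD('n) / h\<^sup>2) * (a + b * u x)\<^sup>2) \<partial>lborel)"
proof -
  let ?f = "\<lambda>x. cutoff c s h x * (a + b * u x)"
  let ?\<eta> = "cutoff c s h"
  obtain L R where LR: "L-lipschitz_on UNIV u" "0 \<le> L" "0 \<le> R" "\<And>x. R < norm x \<Longrightarrow> u x = 0"
    using u by (rule lip_compE) blast
  have "(\<bar>b\<bar> * L)-lipschitz_on UNIV (\<lambda>x. a + b * u x)"
  proof (rule lipschitz_on_realI)
    fix x y
    show "\<bar>a + b * u x - (a + b * u y)\<bar> \<le> \<bar>b\<bar> * L * norm (x - y)"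
      using mult_left_mono[OF lipschitz_on_realD[OF LR(1), of x y], of "\<bar>b\<bar>"]
      by (simp add: abs_mult[symmetric] algebra_simps)
  qed (use LR in simp)
  then show f: "lip_comp ?f" by (rule lip_comp_mult[OF lip_comp_cutoff[OF h]])
  show "energy ?f \<le> (\<integral>\<^sup>+x. indicator (cball c s) x * ennreal (2 * b\<^sup>2 * (norm (gradient u x))\<^sup>2 + (2 * real CARD('n) / h\<^sup>2) * (a + b * u x)\<^sup>2) \<partial>lborel)"
    unfolding energy_def
  proof (rule nn_integral_mono_AE)
    show "AE x in lborel. ennreal ((norm (gradient ?f x))\<^sup>2) \<le>
      indicator (cball c s) x * ennreal (2 * b\<^sup>2 * (norm (gradient u x))\<^sup>2 + (2 * real CARD('n) / h\<^sup>2) * (a + b * u x)\<^sup>2)"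
      using lip_comp_AE_partials[OF u] lipschitz_AE_partials[OF cutoff_lipschitz[OF h, of c s]]
    proof eventually_elim
      case (elim x)
      define g where "g = a + b * u x"
      have pf: "partial_deriv i ?f x = partial_deriv i ?\<eta> x * g + b * partial_deriv i u x * ?\<eta> x" for i
      proof (rule has_partial_imp)
        have "has_partial (\<lambda>x. a + b * u x) i x (0 + b * partial_deriv i u x)"
          by (intro has_partial_add has_partial_const DERIV_cmult elim(1)[rule_format])
        from has_partial_mult[OF elim(2)[rule_format] this]
        show "has_partial ?f i x (partial_deriv i ?\<eta> x * g + b * partial_deriv i u x * ?\<eta> x)"
          by (simp add: g_def)
      qed
      show ?case
      proof (cases "x \<in> cball c s")
        case False
        \<comment> \<open>The complement of the closed ball is open and the cutoff vanishes on it,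
          so the derivative is 0 there; this confines the integral to the ball.\<close>
        have "partial_deriv i ?\<eta> x = 0" for i
        proof (rule has_partial_imp)
          have "has_partial ?\<eta> i x 0 \<longleftrightarrow> has_partial (\<lambda>_. 0) i x 0"
            by (rule has_partial_local[of "- cball c s"])
               (use False h in \<open>auto intro!: cutoff_eq_0 simp: dist_commute\<close>)
          then show "has_partial ?\<eta> i x 0" by simp
        qed
        moreover have "?\<eta> x = 0" using False h by (intro cutoff_eq_0) (auto simp: dist_commute)
        ultimately show ?thesis by (simp add: norm_gradient_eq pf)
      next
        case True
        have each: "(partial_deriv i ?f x)\<^sup>2 \<le> 2 * b\<^sup>2 * (partial_deriv i u x)\<^sup>2 + 2 / h\<^sup>2 * g\<^sup>2" for i
        proof -
          have "(p + q)\<^sup>2 \<le> 2 * p\<^sup>2 + 2 * q\<^sup>2" for p q :: real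
            using zero_le_power2[of "p - q"] by (simp add: power2_eq_square algebra_simps)
          then have "(partial_deriv i ?f x)\<^sup>2 \<le> 2 * (partial_deriv i ?\<eta> x * g)\<^sup>2 + 2 * (b * partial_deriv i u x * ?\<eta> x)\<^sup>2"
            unfolding pf .
          moreover have "(partial_deriv i ?\<eta> x)\<^sup>2 \<le> (1 / h)\<^sup>2"
            using has_partial_lipschitz[OF cutoff_lipschitz[OF h, of c s] elim(2)[rule_format]] by (rule abs_le_square_iff[THEN iffD1, OF order_trans]) (use h in simp)
          then have "(partial_deriv i ?\<eta> x * g)\<^sup>2 \<le> 1 / h\<^sup>2 * g\<^sup>2"
            unfolding power_mult_distrib by (intro mult_right_mono) (auto simp: power_divide)
          moreover have "(?\<eta> x)\<^sup>2 \<le> 1" using cutoff_range[of c s h x] by (simp add: power_le_one)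
          then have "(b * partial_deriv i u x * ?\<eta> x)\<^sup>2 \<le> b\<^sup>2 * (partial_deriv i u x)\<^sup>2"
            unfolding power_mult_distrib by (intro mult_left_le) auto
          ultimately show ?thesis by simp
        qed
        have "(norm (gradient ?f x))\<^sup>2 \<le> (\<Sum>i\<in>UNIV. 2 * b\<^sup>2 * (partial_deriv i u x)\<^sup>2 + 2 / h\<^sup>2 * g\<^sup>2)"
          unfolding norm_gradient_eq by (intro sum_mono each)
        also have "\<dots> = 2 * b\<^sup>2 * (norm (gradient u x))\<^sup>2 + (2 * real CARD('n) / h\<^sup>2) * g\<^sup>2"
          by (simp add: norm_gradient_eq sum.distrib sum_distrib_left)
        finally have "ennreal ((norm (gradient ?f x))\<^sup>2) \<le> ennreal (2 * b\<^sup>2 * (norm (gradient u x))\<^sup>2 + (2 * real CARD('n) / h\<^sup>2) * g\<^sup>2)"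
          by (rule ennreal_leI)
        then show ?thesis using True unfolding g_def by (simp del: ennreal_plus)
      qed
    qed
  qed
qed

lemma integral_over_open_test:
  fixes u :: "real ^ 'n::finite \<Rightarrow> real"
  assumes "u \<in> test_functions \<Omega>"
  shows "(\<integral>\<^sup>+x\<in>\<Omega>. ennreal ((norm (gradient u x))\<^sup>2) \<partial>lborel) = energy u"
    "(\<integral>\<^sup>+x\<in>\<Omega>. ennreal (\<bar>u x\<bar>\<^sup>2) \<partial>lborel) = (\<integral>\<^sup>+x. ennreal ((u x)\<^sup>2) \<partial>lborel)"
proof -
  have s: "supp u \<subseteq> \<Omega>" using assms by (simp add: test_functions_def)
  have g: "norm (gradient u x) = 0" if "x \<notin> \<Omega>" for x
  proof -
    have "partial_deriv i u x = 0" for i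
      by (rule partial_deriv_zero_outside) (use s that in auto)
    then have "(norm (gradient u x))\<^sup>2 = 0"
      unfolding norm_gradient_eq by simp
    then show ?thesis by simp
  qed
  have 0: "u x = 0" if "x \<notin> \<Omega>" for x
    using s that closure_subset[of "{x. u x \<noteq> 0}"] by (auto simp: supp_def)
  show "(\<integral>\<^sup>+x\<in>\<Omega>. ennreal ((norm (gradient u x))\<^sup>2) \<partial>lborel) = energy u"
    unfolding energy_def by (intro nn_integral_cong) (auto simp: indicator_def g)
  show "(\<integral>\<^sup>+x\<in>\<Omega>. ennreal (\<bar>u x\<bar>\<^sup>2) \<partial>lborel) = (\<integral>\<^sup>+x. ennreal ((u x)\<^sup>2) \<partial>lborel)"
    by (intro nn_integral_cong) (auto simp: indicator_def 0)
qed

lemma integrable_square: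
  fixes u :: "real ^ 'n::finite \<Rightarrow> real"
  assumes u: "lip_comp u"
  shows "integrable lborel (\<lambda>x. (u x)\<^sup>2)" "integrable lborel u"
proof -
  obtain L R where LR: "L-lipschitz_on UNIV u" "0 \<le> L" "0 \<le> R" "\<And>x. R < norm x \<Longrightarrow> u x = 0"
    using u by (rule lip_compE) blast
  obtain B where B: "0 \<le> B" "\<And>x. \<bar>u x\<bar> \<le> B" using u by (rule lip_comp_bounded) blast
  note [measurable] = lip_comp_measurable[OF u]
  show "integrable lborel u"
    by (rule integrable_bounded_compact_support[of _ R B]) (use LR B in auto)
  have "\<bar>(u x)\<^sup>2\<bar> \<le> B\<^sup>2" for x using power_mono[OF B(2)[of x], of 2] by simp
  then show "integrable lborel (\<lambda>x. (u x)\<^sup>2)"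
    by (intro integrable_bounded_compact_support[of _ R "B\<^sup>2"]) (use LR in auto)
qed

lemma capacity_poincare_pointwise:
  fixes u :: "real ^ 'n::finite \<Rightarrow> real"
  assumes u: "lip_comp u" and r: "0 < r" and cap: "\<kappa> \<le> wiener_cap F"
    and F: "F \<subseteq> cball y r" "\<And>x. x \<in> F \<Longrightarrow> u x = 0"
  shows "\<kappa> * ennreal ((u y)\<^sup>2) \<le>
    (\<integral>\<^sup>+x. indicator (cball y (2 * r)) x * ennreal (2 * (norm (gradient u x))\<^sup>2 + (2 * real CARD('n) / r\<^sup>2) * (u y - u x)\<^sup>2) \<partial>lborel)"
proof (cases "u y = 0")
  case False
  note [measurable] = lip_comp_measurable[OF u] norm_gradient_measurable[OF u]
  have [measurable]: "cball y (2 * r) \<in> sets borel" by simp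
  \<comment> \<open>Outer radius 2 r and width r make the cutoff equal to 1 on
    \<open>cball y r\<close>, so the function is 1 on F, where u vanishes.\<close>
  let ?f = "\<lambda>x. cutoff y (2 * r) r x * (1 + (- 1 / u y) * u x)"
  have "\<kappa> \<le> energy ?f"
  proof (rule order_trans[OF cap wiener_cap_le[OF energy_cutoff(1)[OF u r]]])
    fix x assume x: "x \<in> F"
    then have "dist x y \<le> 2 * r - r" using F by (auto simp: dist_commute)
    then show "cutoff y (2 * r) r x * (1 + (- 1 / u y) * u x) = 1"
      using F(2)[OF x] r by (simp add: cutoff_eq_1)
  qed
  also have "\<dots> \<le> (\<integral>\<^sup>+x. indicator (cball y (2 * r)) x * ennreal (2 * (- 1 / u y)\<^sup>2 * (norm (gradient u x))\<^sup>2 + (2 * real CARD('n) / r\<^sup>2) * (1 + (- 1 / u y) * u x)\<^sup>2) \<partial>lborel)"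
    by (rule energy_cutoff(2)[OF u r])
  \<comment> \<open>Multiplication by \<open>(u y)^2\<close> clears the denominators and leaves
    \<open>u y - u x\<close>, which can be integrated in y.\<close>
  finally have "\<kappa> * ennreal ((u y)\<^sup>2) \<le> (\<integral>\<^sup>+x. indicator (cball y (2 * r)) x * ennreal (2 * (- 1 / u y)\<^sup>2 * (norm (gradient u x))\<^sup>2 + (2 * real CARD('n) / r\<^sup>2) * (1 + (- 1 / u y) * u x)\<^sup>2) \<partial>lborel) * ennreal ((u y)\<^sup>2)"
    by (rule mult_right_mono) simp
  also have "\<dots> = (\<integral>\<^sup>+x. indicator (cball y (2 * r)) x * ennreal (2 * (- 1 / u y)\<^sup>2 * (norm (gradient u x))\<^sup>2 + (2 * real CARD('n) / r\<^sup>2) * (1 + (- 1 / u y) * u x)\<^sup>2) * ennreal ((u y)\<^sup>2) \<partial>lborel)"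
    by (rule nn_integral_multc[symmetric]) measurable
  also have "\<dots> = (\<integral>\<^sup>+x. indicator (cball y (2 * r)) x * ennreal (2 * (norm (gradient u x))\<^sup>2 + (2 * real CARD('n) / r\<^sup>2) * (u y - u x)\<^sup>2) \<partial>lborel)"
  proof (rule nn_integral_cong)
    fix x
    have "(2 * (- 1 / u y)\<^sup>2 * (norm (gradient u x))\<^sup>2 + (2 * real CARD('n) / r\<^sup>2) * (1 + (- 1 / u y) * u x)\<^sup>2) * (u y)\<^sup>2
      = 2 * (norm (gradient u x))\<^sup>2 * ((- 1 / u y) * u y)\<^sup>2 + (2 * real CARD('n) / r\<^sup>2) * ((1 + (- 1 / u y) * u x) * u y)\<^sup>2"
    proof -
      have "(2 * q * G + k * S) * w = 2 * G * (q * w) + k * (S * w)" for q G k S w :: real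
        by (simp add: algebra_simps)
      then show ?thesis unfolding power_mult_distrib .
    qed
    also have "(1 + (- 1 / u y) * u x) * u y = u y - u x" using False by (simp add: field_simps)
    also have "((- 1 / u y) * u y)\<^sup>2 = 1" using False by simp
    finally have e: "(2 * (- 1 / u y)\<^sup>2 * (norm (gradient u x))\<^sup>2 + (2 * real CARD('n) / r\<^sup>2) * (1 + (- 1 / u y) * u x)\<^sup>2) * (u y)\<^sup>2
      = 2 * (norm (gradient u x))\<^sup>2 + (2 * real CARD('n) / r\<^sup>2) * (u y - u x)\<^sup>2"
      by (simp only: mult_1_right)
    have "ennreal (2 * (- 1 / u y)\<^sup>2 * (norm (gradient u x))\<^sup>2 + (2 * real CARD('n) / r\<^sup>2) * (1 + (- 1 / u y) * u x)\<^sup>2) * ennreal ((u y)\<^sup>2)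
      = ennreal (2 * (norm (gradient u x))\<^sup>2 + (2 * real CARD('n) / r\<^sup>2) * (u y - u x)\<^sup>2)"
      by (simp only: ennreal_mult''[symmetric, OF zero_le_power2] e)
    then show "indicator (cball y (2 * r)) x * ennreal (2 * (- 1 / u y)\<^sup>2 * (norm (gradient u x))\<^sup>2 + (2 * real CARD('n) / r\<^sup>2) * (1 + (- 1 / u y) * u x)\<^sup>2) * ennreal ((u y)\<^sup>2)
      = indicator (cball y (2 * r)) x * ennreal (2 * (norm (gradient u x))\<^sup>2 + (2 * real CARD('n) / r\<^sup>2) * (u y - u x)\<^sup>2)"
      by (subst mult.assoc) (simp only:)
  qed
  finally show ?thesis .
qed simp

text \<open>Integrates the pointwise bound over y. In the gradient term each x is counted once for
  every centre within distance 2 r, a set of volume V. In the difference term the substitution x = z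
  + y leaves translations with |z| <= 2 r, to which \<open>translation_estimate\<close>
  applies.\<close>

lemma capacity_poincare:
  fixes u :: "real ^ 'n::finite \<Rightarrow> real"
  assumes u: "lip_comp u" and r: "0 < r" and cap: "\<And>y. \<kappa> \<le> wiener_cap (F y)"
    and F: "\<And>y. F y \<subseteq> cball y r" "\<And>x y. x \<in> F y \<Longrightarrow> u x = 0"
  defines "V \<equiv> unit_ball_vol (real CARD('n)) * (2 * r) ^ CARD('n)"
  shows "\<kappa> * (\<integral>\<^sup>+x. ennreal ((u x)\<^sup>2) \<partial>lborel) \<le>
     ennreal (2 * V + 2 * real CARD('n) / r\<^sup>2 * V * (2 ^ CARD('n) * (2 * r)\<^sup>2)) * energy u"
proof -
  note [measurable] = lip_comp_measurable[OF u] norm_gradient_measurable[OF u]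
  have V: "emeasure lborel (cball c (2 * r)) = ennreal V" for c :: "real ^ 'n"
    unfolding V_def using r by (simp add: emeasure_cball)
  have V0: "0 \<le> V" using r by (simp add: V_def)
  have [measurable]: "cball c (2 * r) \<in> sets borel" for c :: "real ^ 'n" by simp
  \<comment> \<open>As a function of x - y the indicator is visibly measurable in the pair, and it
    becomes a function of z alone after the substitution.\<close>
  let ?I = "\<lambda>x y. indicator (cball (0 :: real ^ 'n) (2 * r)) (x - y) :: ennreal"
  define k where "k = 2 * real CARD('n) / r\<^sup>2"
  have k: "0 \<le> k" by (simp add: k_def)
  have "\<kappa> * (\<integral>\<^sup>+y. ennreal ((u y)\<^sup>2) \<partial>lborel) = (\<integral>\<^sup>+y. \<kappa> * ennreal ((u y)\<^sup>2) \<partial>lborel)"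
    by (rule nn_integral_cmult[symmetric]) measurable
  also have "\<dots> \<le> (\<integral>\<^sup>+y. \<integral>\<^sup>+x. ?I x y * ennreal (2 * (norm (gradient u x))\<^sup>2) + ?I x y * ennreal (k * (u y - u x)\<^sup>2) \<partial>lborel \<partial>lborel)"
  proof (rule nn_integral_mono)
    fix y
    have "(\<integral>\<^sup>+x. indicator (cball y (2 * r)) x * ennreal (2 * (norm (gradient u x))\<^sup>2 + k * (u y - u x)\<^sup>2) \<partial>lborel)
      = (\<integral>\<^sup>+x. ?I x y * ennreal (2 * (norm (gradient u x))\<^sup>2) + ?I x y * ennreal (k * (u y - u x)\<^sup>2) \<partial>lborel)"
      using k by (intro nn_integral_cong) (auto simp: indicator_def dist_norm norm_minus_commute)
    then show "\<kappa> * ennreal ((u y)\<^sup>2) \<le> (\<integral>\<^sup>+x. ?I x y * ennreal (2 * (norm (gradient u x))\<^sup>2) + ?I x y * ennreal (k * (u y - u x)\<^sup>2) \<partial>lborel)"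
      using capacity_poincare_pointwise[OF u r cap F(1) F(2), of y] unfolding k_def by simp
  qed
  also have "\<dots> = (\<integral>\<^sup>+y. \<integral>\<^sup>+x. ?I x y * ennreal (2 * (norm (gradient u x))\<^sup>2) \<partial>lborel \<partial>lborel)
      + (\<integral>\<^sup>+y. \<integral>\<^sup>+x. ?I x y * ennreal (k * (u y - u x)\<^sup>2) \<partial>lborel \<partial>lborel)"
    by (simp add: nn_integral_add)
  also have "(\<integral>\<^sup>+y. \<integral>\<^sup>+x. ?I x y * ennreal (2 * (norm (gradient u x))\<^sup>2) \<partial>lborel \<partial>lborel) = ennreal (2 * V) * energy u"
  proof -
    have "(\<integral>\<^sup>+y. \<integral>\<^sup>+x. ?I x y * ennreal (2 * (norm (gradient u x))\<^sup>2) \<partial>lborel \<partial>lborel) =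
       (\<integral>\<^sup>+x. \<integral>\<^sup>+y. ?I x y * ennreal (2 * (norm (gradient u x))\<^sup>2) \<partial>lborel \<partial>lborel)"
      by (rule lborel_pair.Fubini') measurable
    also have "\<dots> = (\<integral>\<^sup>+x. ennreal (2 * V) * ennreal ((norm (gradient u x))\<^sup>2) \<partial>lborel)"
    proof (rule nn_integral_cong)
      fix x :: "real ^ 'n"
      have "(\<integral>\<^sup>+y. ?I x y \<partial>lborel) = (\<integral>\<^sup>+y. indicator (cball x (2 * r)) y \<partial>lborel)"
        by (intro nn_integral_cong) (auto simp: indicator_def dist_norm norm_minus_commute)
      then have "(\<integral>\<^sup>+y. ?I x y \<partial>lborel) = ennreal V" by (simp add: V)
      moreover have "(\<integral>\<^sup>+y. ?I x y * ennreal (2 * (norm (gradient u x))\<^sup>2) \<partial>lborel) = (\<integral>\<^sup>+y. ?I x y \<partial>lborel) * ennreal (2 * (norm (gradient u x))\<^sup>2)"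
        by (rule nn_integral_multc) measurable
      ultimately show "(\<integral>\<^sup>+y. ?I x y * ennreal (2 * (norm (gradient u x))\<^sup>2) \<partial>lborel) = ennreal (2 * V) * ennreal ((norm (gradient u x))\<^sup>2)"
        using V0 by (simp add: ennreal_mult''[symmetric] mult_ac)
    qed
    also have "\<dots> = ennreal (2 * V) * energy u" unfolding energy_def by (rule nn_integral_cmult) measurable
    finally show ?thesis .
  qed
  also have "(\<integral>\<^sup>+y. \<integral>\<^sup>+x. ?I x y * ennreal (k * (u y - u x)\<^sup>2) \<partial>lborel \<partial>lborel) \<le> ennreal (k * V * (2 ^ CARD('n) * (2 * r)\<^sup>2)) * energy u"
  proof -
    let ?J = "\<lambda>z. indicator (cball (0 :: real ^ 'n) (2 * r)) z :: ennreal"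
    let ?c = "k * (2 ^ CARD('n) * (2 * r)\<^sup>2)"
    have "(\<integral>\<^sup>+y. \<integral>\<^sup>+x. ?I x y * ennreal (k * (u y - u x)\<^sup>2) \<partial>lborel \<partial>lborel) =
      (\<integral>\<^sup>+y. \<integral>\<^sup>+z. ?J z * ennreal (k * (u y - u (z + y))\<^sup>2) \<partial>lborel \<partial>lborel)"
    proof (rule nn_integral_cong)
      fix y
      show "(\<integral>\<^sup>+x. ?I x y * ennreal (k * (u y - u x)\<^sup>2) \<partial>lborel) = (\<integral>\<^sup>+z. ?J z * ennreal (k * (u y - u (z + y))\<^sup>2) \<partial>lborel)"
        by (subst nn_integral_translate[of _ y, symmetric]) auto
    qed
    also have "\<dots> = (\<integral>\<^sup>+z. \<integral>\<^sup>+y. ?J z * ennreal (k * (u y - u (z + y))\<^sup>2) \<partial>lborel \<partial>lborel)"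
      by (rule lborel_pair.Fubini') measurable
    also have "\<dots> \<le> (\<integral>\<^sup>+z. ?J z * (ennreal ?c * energy u) \<partial>lborel)"
    proof (rule nn_integral_mono)
      fix z :: "real ^ 'n"
      show "(\<integral>\<^sup>+y. ?J z * ennreal (k * (u y - u (z + y))\<^sup>2) \<partial>lborel) \<le> ?J z * (ennreal ?c * energy u)"
      proof (cases "z \<in> cball 0 (2 * r)")
        case True
        have "(\<integral>\<^sup>+y. ?J z * ennreal (k * (u y - u (z + y))\<^sup>2) \<partial>lborel) = (\<integral>\<^sup>+y. ennreal k * ennreal ((u (y + z) - u y)\<^sup>2) \<partial>lborel)"
          using True k by (intro nn_integral_cong) (simp add: ennreal_mult''[symmetric] power2_commute add.commute)
        also have "\<dots> = ennreal k * (\<integral>\<^sup>+y. ennreal ((u (y + z) - u y)\<^sup>2) \<partial>lborel)"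
          by (rule nn_integral_cmult) measurable
        also have "\<dots> \<le> ennreal k * (ennreal (2 ^ CARD('n) * (2 * r)\<^sup>2) * energy u)"
          using True r by (intro mult_left_mono order_trans[OF translation_estimate[OF u]] mult_right_mono ennreal_leI power_mono) auto
        also have "\<dots> = ennreal ?c * energy u" using k by (simp add: ennreal_mult''[symmetric] mult.assoc[symmetric])
        finally show ?thesis using True by simp
      qed simp
    qed
    also have "\<dots> = ennreal V * (ennreal ?c * energy u)"
      by (subst nn_integral_multc) (auto simp: V)
    also have "\<dots> = (ennreal V * ennreal ?c) * energy u"
      by (rule mult.assoc[symmetric])
    also have "ennreal V * ennreal ?c = ennreal (V * ?c)"
      using k by (intro ennreal_mult''[symmetric]) simp
    also have "V * ?c = k * V * (2 ^ CARD('n) * (2 * r)\<^sup>2)"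
      by (rule mult.left_commute[THEN trans]) (rule mult.assoc[symmetric])
    finally show ?thesis .
  qed
  finally show ?thesis
    using V0 k unfolding k_def[symmetric] by (simp add: distrib_right add_left_mono)
qed

section \<open>The interior capacitary radius\<close>

lemma power_diff_2: "2 \<le> m \<Longrightarrow> r ^ (m - 2) * r\<^sup>2 = (r :: real) ^ m"
  by (simp only: power_add[symmetric] le_add_diff_inverse2)

lemma wiener_cap_cball_real:
  assumes n: "3 \<le> CARD('n::finite)"
  obtains K where "0 < K" "\<And>(c :: real ^ 'n) r. 0 < r \<Longrightarrow> wiener_cap (cball c r) = ennreal (r ^ (CARD('n) - 2) * K)"
proof -
  obtain K where K: "wiener_cap (cball (0 :: real ^ 'n) 1) = ennreal K" "0 \<le> K"
    using wiener_cap_cball_finite[where 'n='n] by (cases "wiener_cap (cball (0 :: real ^ 'n) 1)") auto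
  have "0 < K" using wiener_cap_cball_pos[OF n] K by simp
  moreover have "wiener_cap (cball c r) = ennreal (r ^ (CARD('n) - 2) * K)" if "0 < r" for c :: "real ^ 'n" and r
    using wiener_cap_cball[OF that, of c] n K that by (simp add: ennreal_mult)
  ultimately show ?thesis using that by blast
qed

section \<open>Finite radius: a positive spectral bottom\<close>

lemma nn_integral_square_pos:
  fixes u :: "real ^ 'n::finite \<Rightarrow> real"
  assumes u: "lip_comp u" and x: "u x \<noteq> 0"
  shows "(\<integral>\<^sup>+x. ennreal ((u x)\<^sup>2) \<partial>lborel) \<noteq> 0"
proof
  assume "(\<integral>\<^sup>+x. ennreal ((u x)\<^sup>2) \<partial>lborel) = 0"
  then have ae: "AE x in lborel. u x = 0"
    using lip_comp_measurable(2)[OF u] by (subst (asm) nn_integral_0_iff_AE) auto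
  have o: "open {x. u x \<noteq> 0}"
    using lip_comp_measurable(3)[OF u] by (intro open_Collect_neq) (auto intro: continuous_intros)
  have "{x. u x \<noteq> 0} \<in> null_sets lborel"
    using ae o by (subst (asm) AE_iff_null) auto
  then have "negligible {x. u x \<noteq> 0}"
    by (auto simp: negligible_iff_null_sets null_sets_def)
  then show False using open_not_negligible[OF o] x by blast
qed

lemma dirichlet_bottom_pos:
  fixes \<Omega> :: "(real ^ 'n::finite) set"
  assumes n: "3 \<le> CARD('n)" and g: "0 < \<gamma>" and op: "open \<Omega>"
    and fin: "interior_cap_radius \<gamma> \<Omega> < \<infinity>"
  shows "0 < dirichlet_bottom \<Omega>"
proof -
  obtain K where K: "0 < K" "\<And>(c :: real ^ 'n) r. 0 < r \<Longrightarrow> wiener_cap (cball c r) = ennreal (r ^ (CARD('n) - 2) * K)"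
    using wiener_cap_cball_real[OF n] by blast
  obtain R where R: "interior_cap_radius \<gamma> \<Omega> = ennreal R" "0 \<le> R"
    using fin by (cases "interior_cap_radius \<gamma> \<Omega>") auto
  \<comment> \<open>One radius beyond the supremum is enough: no ball of that radius has a
    negligible part outside Omega, which bounds the capacities below uniformly in the
    centre.\<close>
  define r where "r = R + 1"
  have r: "0 < r" using R by (simp add: r_def)
  define \<kappa> where "\<kappa> = \<gamma> * (r ^ (CARD('n) - 2) * K)"
  have k: "0 < \<kappa>" using r K g by (simp add: \<kappa>_def)
  let ?F = "\<lambda>y. cball y r - \<Omega>"
  have cap: "ennreal \<kappa> \<le> wiener_cap (?F y)" for y
  proof (rule ccontr)
    assume "\<not> ?thesis"
    then have "negligible_in_cball \<gamma> y r (?F y)"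
      unfolding negligible_in_cball_def K(2)[OF r] \<kappa>_def using op g
      by (auto simp: ennreal_mult' compact_diff)
    then have "ennreal r \<le> interior_cap_radius \<gamma> \<Omega>"
      unfolding interior_cap_radius_def using r by (intro SUP_upper) auto
    then show False using R r by (simp add: r_def)
  qed
  define V where "V = unit_ball_vol (real CARD('n)) * (2 * r) ^ CARD('n)"
  define C where "C = 2 * V + 2 * real CARD('n) / r\<^sup>2 * V * (2 ^ CARD('n) * (2 * r)\<^sup>2)"
  have V0: "0 < V" using r by (simp add: V_def)
  have C: "0 < C" using V0 r by (simp add: C_def add_pos_nonneg)
  have "ennreal (\<kappa> / C) \<le> dirichlet_bottom \<Omega>"
    unfolding dirichlet_bottom_def
  proof (rule INF_greatest)
    fix u assume "u \<in> {u \<in> test_functions \<Omega>. \<exists>x. u x \<noteq> 0}"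
    then obtain x0 where u: "u \<in> test_functions \<Omega>" and x0: "u x0 \<noteq> 0" by blast
    have lu: "lip_comp u" by (rule test_function_lip_comp[OF u])
    have 0: "u x = 0" if "x \<notin> \<Omega>" for x
      using u that closure_subset[of "{x. u x \<noteq> 0}"] by (auto simp: supp_def test_functions_def)
    have main: "ennreal \<kappa> * (\<integral>\<^sup>+x. ennreal ((u x)\<^sup>2) \<partial>lborel) \<le> ennreal C * energy u"
      unfolding C_def V_def by (rule capacity_poincare[OF lu r cap]) (auto intro: 0)
    define d where "d = (\<integral>x. (u x)\<^sup>2 \<partial>lborel)"
    have D: "(\<integral>\<^sup>+x. ennreal ((u x)\<^sup>2) \<partial>lborel) = ennreal d"
      unfolding d_def by (rule nn_integral_eq_integral) (auto intro: integrable_square lu)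
    have d: "0 < d" using nn_integral_square_pos[OF lu x0] unfolding D by (simp add: ennreal_eq_0_iff not_le)
    obtain e where E: "energy u = ennreal e" "0 \<le> e"
      using energy_finite[OF lu] by (cases "energy u") auto
    have "\<kappa> * d \<le> C * e"
      using main d k C E unfolding D E by (simp add: ennreal_mult''[symmetric] ennreal_le_iff)
    then have "\<kappa> / C \<le> e / d" using d C by (simp add: field_simps)
    then show "ennreal (\<kappa> / C) \<le> (\<integral>\<^sup>+x\<in>\<Omega>. ennreal ((norm (gradient u x))\<^sup>2) \<partial>lborel) / (\<integral>\<^sup>+x\<in>\<Omega>. ennreal (\<bar>u x\<bar>\<^sup>2) \<partial>lborel)"
      unfolding integral_over_open_test[OF u] D E using d E by (simp add: divide_ennreal ennreal_leI)
  qed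
  moreover have "0 < ennreal (\<kappa> / C)" using k C by simp
  ultimately show ?thesis by (rule less_le_trans[rotated])
qed

section \<open>Infinite radius: trial functions with small Rayleigh quotient\<close>

lemma dirichlet_bottom_le:
  fixes w :: "real ^ 'n::finite \<Rightarrow> real"
  assumes w: "lip_comp w" and op: "open \<Omega>" and nonneg: "\<And>x. 0 \<le> w x" and 0: "\<And>x. x \<notin> \<Omega> \<Longrightarrow> w x = 0"
    and m: "0 < m" "ennreal m \<le> (\<integral>\<^sup>+x. ennreal ((w x)\<^sup>2) \<partial>lborel)"
    and E: "energy w \<le> ennreal e" "0 \<le> e"
  shows "dirichlet_bottom \<Omega> \<le> ennreal (2 * e / m)"
proof -
  obtain L R where LR: "L-lipschitz_on UNIV w" "0 \<le> L" "0 \<le> R" "\<And>x. R < norm x \<Longrightarrow> w x = 0"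
    using w by (rule lip_compE) blast
  note sq = integrable_square[OF w]
  define J where "J = (\<integral>x. w x \<partial>lborel)"
  have J: "0 \<le> J" unfolding J_def by (intro integral_nonneg_AE) (simp add: nonneg)
  have I: "m \<le> (\<integral>x. (w x)\<^sup>2 \<partial>lborel)"
  proof -
    have "ennreal m \<le> ennreal (\<integral>x. (w x)\<^sup>2 \<partial>lborel)"
      using m(2) nn_integral_eq_integral[OF sq(1)] by simp
    then show ?thesis by (simp add: ennreal_le_iff)
  qed
  \<comment> \<open>The final function v satisfies \<open>v >= w - tau\<close>, which costs at most
    \<open>2 tau J\<close> of mass. The choice keeps the loss below m/2, whence the factor 2 in the
    conclusion.\<close>
  define \<tau> where "\<tau> = m / (4 * (J + 1))"
  have t: "0 < \<tau>" using m J by (simp add: \<tau>_def)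
  have tJ: "2 * \<tau> * J \<le> m / 2" using m J by (simp add: \<tau>_def field_simps)
  define \<epsilon> where "\<epsilon> = \<tau> / 2"
  have eps: "0 < \<epsilon>" using t by (simp add: \<epsilon>_def)
  \<comment> \<open>The support of w may touch the boundary of Omega. Lowering w by epsilon moves it
    into the compact set where \<open>epsilon <= w\<close>, at positive distance from the
    complement, and leaves room for mollification.\<close>
  define we where "we = (\<lambda>x. max 0 (w x - \<epsilon>))"
  have we_contr: "\<bar>we x - we y\<bar> \<le> 1 * \<bar>w x - w y\<bar>" for x y
    unfolding we_def by (simp add: max_def abs_if)
  have lwe: "lip_comp we"
    by (rule lip_comp_compose[OF w we_contr]) (use eps in \<open>auto simp: we_def\<close>)
  have Lwe: "L-lipschitz_on UNIV we"
    by (rule lipschitz_on_realI) (use order_trans[OF we_contr] lipschitz_on_realD[OF LR(1)] LR in auto)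
  let ?C = "{x. \<epsilon> \<le> w x}"
  have "compact ?C"
  proof -
    have "?C \<subseteq> cball 0 R"
    proof
      fix x assume "x \<in> ?C"
      then have "w x \<noteq> 0" using eps by auto
      then have "\<not> R < norm x" using LR(4) by blast
      then show "x \<in> cball 0 R" by simp
    qed
    moreover have "closed ?C"
      by (intro closed_Collect_le continuous_intros lip_comp_measurable(3)[OF w])
    ultimately show ?thesis by (meson bounded_cball bounded_subset compact_eq_bounded_closed)
  qed
  moreover have "?C \<inter> - \<Omega> = {}" using 0 eps by force
  ultimately obtain d where d: "0 < d" "\<And>x y. x \<in> ?C \<Longrightarrow> y \<in> - \<Omega> \<Longrightarrow> d \<le> dist x y"
    using separate_compact_closed[of ?C "- \<Omega>"] op by (auto simp: closed_Compl)
  \<comment> \<open>Half of d is spent on the mollification radius and half on the closure in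
    \<open>supp\<close>; the second bound keeps the mollification within epsilon of
    \<open>we\<close>, and L + 1 covers the case L = 0.\<close>
  define h where "h = min (d / 2) (\<epsilon> / (L + 1))"
  have h: "0 < h" using d eps LR by (simp add: h_def)
  have Lh: "L * h \<le> \<epsilon>"
  proof -
    have "L * h \<le> (L + 1) * (\<epsilon> / (L + 1))" using LR eps h by (intro mult_mono) (auto simp: h_def)
    then show ?thesis using LR by simp
  qed
  define v where "v = mollify h we"
  have lv: "lip_comp v" unfolding v_def by (rule mollify_lip_comp[OF h lwe])
  have vt: "v \<in> test_functions \<Omega>"
    unfolding test_functions_def
  proof (intro CollectI conjI)
    show "smooth v" unfolding v_def by (rule mollify_smooth[OF h lwe])
    show "compact (supp v)" using lv by (simp add: lip_comp_def)
    show "supp v \<subseteq> \<Omega>"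
    proof
      fix x assume "x \<in> supp v"
      then obtain x' where x': "v x' \<noteq> 0" "dist x' x < d / 2"
        unfolding supp_def closure_approachable using d by (metis half_gt_zero mem_Collect_eq)
      obtain y where y: "dist x' y < h" "we y \<noteq> 0"
        using mollify_support[OF h, of x' we] x'(1) unfolding v_def by blast
      then have "y \<in> ?C" by (auto simp: we_def max_def split: if_splits)
      moreover have "dist y x < d"
        using x'(2) y(1) dist_triangle[of y x x'] by (simp add: h_def dist_commute)
      ultimately show "x \<in> \<Omega>" using d(2)[of y x] by force
    qed
  qed
  have v0: "0 \<le> v x" for x unfolding v_def by (rule mollify_nonneg[OF h]) (simp add: we_def)
  have vw: "w x - \<tau> \<le> v x" for x
  proof -
    have "\<bar>v x - we x\<bar> \<le> \<epsilon>" unfolding v_def using mollify_close[OF h lwe Lwe, of x] Lh by linarith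
    moreover have "w x - \<epsilon> \<le> we x" by (simp add: we_def)
    moreover have "\<tau> = 2 * \<epsilon>" by (simp add: \<epsilon>_def)
    ultimately show ?thesis by linarith
  qed
  \<comment> \<open>Squaring \<open>w - tau <= v\<close> is legitimate where w exceeds tau;
    elsewhere the left side is nonpositive because w is nonnegative.\<close>
  have pt: "(w x)\<^sup>2 - 2 * \<tau> * w x \<le> (v x)\<^sup>2" for x
  proof (cases "w x \<le> \<tau>")
    case True
    have "w x * (w x - 2 * \<tau>) \<le> 0" using True nonneg[of x] t by (intro mult_nonneg_nonpos) auto
    also have "0 \<le> (v x)\<^sup>2" by simp
    finally show ?thesis by (simp add: power2_eq_square algebra_simps)
  next
    case False
    have "(w x)\<^sup>2 - 2 * \<tau> * w x \<le> (w x - \<tau>)\<^sup>2" by (simp add: power2_eq_square algebra_simps)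
    also have "\<dots> \<le> (v x)\<^sup>2" using vw[of x] False by (intro power_mono) auto
    finally show ?thesis .
  qed
  define D where "D = (\<integral>x. (v x)\<^sup>2 \<partial>lborel)"
  have i2: "integrable lborel (\<lambda>x. 2 * \<tau> * w x)" by (rule integrable_mult_right[OF sq(2)])
  have "m / 2 \<le> (\<integral>x. (w x)\<^sup>2 \<partial>lborel) - 2 * \<tau> * J" using I tJ by simp
  also have "\<dots> = (\<integral>x. (w x)\<^sup>2 - 2 * \<tau> * w x \<partial>lborel)"
    unfolding J_def by (simp only: Bochner_Integration.integral_diff[OF sq(1) i2] integral_mult_right_zero)
  also have "\<dots> \<le> D" unfolding D_def
    by (rule integral_mono[OF Bochner_Integration.integrable_diff[OF sq(1) i2] integrable_square(1)[OF lv]]) (rule pt)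
  finally have D: "m / 2 \<le> D" .
  have De: "(\<integral>\<^sup>+x. ennreal ((v x)\<^sup>2) \<partial>lborel) = ennreal D"
    unfolding D_def by (rule nn_integral_eq_integral[OF integrable_square(1)[OF lv]]) simp
  have "\<exists>x. v x \<noteq> 0"
  proof (rule ccontr)
    assume "\<not> ?thesis"
    then have "D = 0" by (simp add: D_def)
    then show False using D m by simp
  qed
  then have "dirichlet_bottom \<Omega> \<le> energy v / ennreal D"
    unfolding dirichlet_bottom_def using vt integral_over_open_test[OF vt] De
    by (intro INF_lower2[of v]) auto
  also have "\<dots> \<le> ennreal e / ennreal D"
  proof (rule divide_right_mono_ennreal)
    have "energy v \<le> energy we" unfolding v_def by (rule energy_mollify[OF h lwe])
    also have "\<dots> \<le> ennreal (1\<^sup>2) * energy w"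
      by (rule energy_contraction[OF w lwe we_contr])
    finally show "energy v \<le> ennreal e" using E by simp
  qed
  also have "\<dots> \<le> ennreal (2 * e / m)"
  proof -
    have "e / D \<le> e / (m / 2)" using D m E by (intro divide_left_mono) auto
    then show ?thesis using D m E by (simp add: divide_ennreal ennreal_leI mult.commute)
  qed
  finally show ?thesis .
qed

text \<open>If \<open>1 - u\<close> were small in \<open>L\<^sup>2\<close>, the mollification of \<open>u\<close> divided by a constant slightly
  below 1 would be admissible for a ball slightly smaller than the unit ball, and its energy
  would violate the scaling law of the capacity of balls.\<close>

lemma capacity_deficit:
  assumes n: "3 \<le> CARD('n::finite)" and K: "wiener_cap (cball (0 :: real ^ 'n) 1) = ennreal K" "0 < K"
    and g: "0 < \<gamma>" "\<gamma> < 1"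
  obtains h \<delta> where "0 < h" "h < 1 / 2" "0 < \<delta>"
    "\<And>u :: real ^ 'n \<Rightarrow> real. lip_comp u \<Longrightarrow> (\<And>x. 0 \<le> u x \<and> u x \<le> 1) \<Longrightarrow> energy u \<le> ennreal (\<gamma> * K) \<Longrightarrow>
       ennreal \<delta> \<le> (\<integral>\<^sup>+x. indicator (cball 0 (1 - h)) x * ennreal ((1 - u x)\<^sup>2) \<partial>lborel)"
proof -
  \<comment> \<open>By Bernoulli \<open>(1 - s)^n >= 1 - n s = (1 + gamma) / 2 > gamma\<close>,
    which is what the scaling law will contradict.\<close>
  define s where "s = (1 - \<gamma>) / (2 * real CARD('n))"
  define t where "t = 1 - s"
  \<comment> \<open>Since t + h = 1 - h, the mollification at points of the ball of radius t sees u
    only in the ball of radius 1 - h, where the deficit is measured.\<close>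
  define h where "h = s / 2"
  define Z where "Z = bump_mass TYPE('n) h"
  \<comment> \<open>Solves \<open>s / 2 + delta / (2 s Z) = s\<close>, where the left side bounds
    \<open>1 - mollify h u\<close> on the ball of radius t.\<close>
  define \<delta> where "\<delta> = s\<^sup>2 * Z"
  have s: "0 < s" "s < 1"
  proof -
    show "0 < s" using g n by (simp add: s_def)
    have "s \<le> (1 - \<gamma>) / 1" unfolding s_def using g n by (intro divide_left_mono) auto
    then show "s < 1" using g by simp
  qed
  have h: "0 < h" "h < 1 / 2" using s by (auto simp: h_def)
  have Z: "0 < Z" unfolding Z_def by (rule bump_mass_pos[OF h(1)])
  have d: "0 < \<delta>" using s Z by (simp add: \<delta>_def)
  have t: "0 < t" "t < 1" using s by (auto simp: t_def)
  have tn: "\<gamma> < t ^ CARD('n)"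
  proof -
    have "\<gamma> < 1 + real CARD('n) * (- s)" using g n by (simp add: s_def field_simps)
    also have "\<dots> \<le> (1 + (- s)) ^ CARD('n)" using s by (intro Bernoulli_inequality) simp
    finally show ?thesis by (simp add: t_def)
  qed
  show ?thesis
  proof (rule that[OF h d])
    fix u :: "real ^ 'n \<Rightarrow> real"
    assume u: "lip_comp u" and u01: "\<And>x. 0 \<le> u x \<and> u x \<le> 1" and E: "energy u \<le> ennreal (\<gamma> * K)"
    note [measurable] = lip_comp_measurable[OF u]
    let ?B = "cball (0 :: real ^ 'n) (1 - h)"
    have [measurable]: "?B \<in> sets borel" by simp
    have iB: "integrable lborel (\<lambda>x. indicator ?B x * (1 - u x)\<^sup>2)"
    proof (rule integrable_bounded_compact_support[of _ "1 - h" 1])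
      have "(1 - u x)\<^sup>2 \<le> 1" for x using u01[of x] by (simp add: power_le_one)
      then show "AE x in lborel. \<bar>indicator ?B x * (1 - u x)\<^sup>2\<bar> \<le> 1"
        by (intro AE_I2) (auto simp: indicator_def)
    qed auto
    define I where "I = (\<integral>x. indicator ?B x * (1 - u x)\<^sup>2 \<partial>lborel)"
    have "(\<integral>\<^sup>+x. indicator ?B x * ennreal ((1 - u x)\<^sup>2) \<partial>lborel) = (\<integral>\<^sup>+x. ennreal (indicator ?B x * (1 - u x)\<^sup>2) \<partial>lborel)"
      by (intro nn_integral_cong) (simp add: indicator_def)
    also have "\<dots> = ennreal I" unfolding I_def by (rule nn_integral_eq_integral[OF iB]) simp
    finally have II: "(\<integral>\<^sup>+x. indicator ?B x * ennreal ((1 - u x)\<^sup>2) \<partial>lborel) = ennreal I" .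
    have "\<delta> \<le> I"
    proof (rule ccontr)
      assume "\<not> \<delta> \<le> I"
      then have Id: "I < \<delta>" by simp
      let ?v = "mollify h u"
      have lv: "lip_comp ?v" by (rule mollify_lip_comp[OF h(1) u])
      have v1: "t \<le> ?v x" if x: "norm x \<le> t" for x
      proof -
        have "1 - ?v x = (\<integral>y. (1 - u y) * mollifier h (x - y) \<partial>lborel)"
          by (rule mollify_minus_const[OF h(1) u])
        also have "\<dots> \<le> (\<integral>y. s / 2 * mollifier h (x - y) + 1 / (2 * s * Z) * (indicator ?B y * (1 - u y)\<^sup>2) \<partial>lborel)"
        proof (rule integral_mono)
          show "integrable lborel (\<lambda>y. (1 - u y) * mollifier h (x - y))" by (rule mollify_minus_const[OF h(1) u])
          show "integrable lborel (\<lambda>y. s / 2 * mollifier h (x - y) + 1 / (2 * s * Z) * (indicator ?B y * (1 - u y)\<^sup>2))"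
            by (intro Bochner_Integration.integrable_add integrable_mult_right integrable_mollifier_shift[OF h(1)] iB)
          fix y
          show "(1 - u y) * mollifier h (x - y) \<le> s / 2 * mollifier h (x - y) + 1 / (2 * s * Z) * (indicator ?B y * (1 - u y)\<^sup>2)"
          proof (cases "h \<le> norm (x - y)")
            case True
            then show ?thesis using mollifier_outside[OF h(1) True] s Z by (simp add: indicator_def)
          next
            case False
            have "norm y \<le> norm x + norm (x - y)" using norm_triangle_sub[of y x] by (simp add: norm_minus_commute)
            then have y: "y \<in> ?B" using False x by (simp add: t_def h_def)
            let ?\<phi> = "mollifier h (x - y)"
            \<comment> \<open>Young's inequality with weight s trades the linear deficit in the
              mollification for the quadratic one in the hypothesis.\<close>
            have "1 - u y \<le> s / 2 + (1 - u y)\<^sup>2 / (2 * s)"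
            proof -
              have "0 \<le> (1 - u y - s)\<^sup>2" by simp
              then have "2 * s * (1 - u y) \<le> s * s + (1 - u y)\<^sup>2" by (simp add: power2_eq_square algebra_simps)
              then show ?thesis using s by (simp add: field_simps power2_eq_square)
            qed
            then have "(1 - u y) * ?\<phi> \<le> (s / 2 + (1 - u y)\<^sup>2 / (2 * s)) * ?\<phi>"
              by (rule mult_right_mono) (rule mollifier_nonneg[OF h(1)])
            also have "\<dots> = s / 2 * ?\<phi> + (1 - u y)\<^sup>2 / (2 * s) * ?\<phi>" by (rule distrib_right)
            also have "(1 - u y)\<^sup>2 / (2 * s) * ?\<phi> \<le> (1 - u y)\<^sup>2 / (2 * s) * (1 / Z)"
              using mollifier_le[OF h(1), of "x - y"] s unfolding Z_def by (intro mult_left_mono) auto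
            finally show ?thesis using y by (simp add: mult_ac)
          qed
        qed
        also have "\<dots> = s / 2 + 1 / (2 * s * Z) * I"
          unfolding I_def
          by (subst Bochner_Integration.integral_add)
             (auto intro!: integrable_mult_right integrable_mollifier_shift[OF h(1)] iB simp: integral_mollifier_shift[OF h(1)] simp del: times_divide_eq_left)
        also have "\<dots> \<le> s / 2 + 1 / (2 * s * Z) * \<delta>"
          using Id s Z by (intro add_left_mono mult_left_mono) auto
        also have "\<dots> = s" using s Z by (simp add: \<delta>_def field_simps power2_eq_square)
        finally show ?thesis by (simp add: t_def)
      qed
      \<comment> \<open>Dividing by t costs at most a factor \<open>t^(-2)\<close> in energy.
        Against the capacity \<open>t^(n-2) K\<close> of the ball of radius t this yields
        \<open>t^n <= gamma\<close>.\<close>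
      let ?w = "\<lambda>x. min 1 (?v x / t)"
      have contr: "\<bar>?w x - ?w y\<bar> \<le> 1 / t * \<bar>?v x - ?v y\<bar>" for x y
      proof -
        have "\<bar>?w x - ?w y\<bar> \<le> \<bar>?v x / t - ?v y / t\<bar>" by linarith
        also have "\<dots> = 1 / t * \<bar>?v x - ?v y\<bar>" using t by (simp add: diff_divide_distrib[symmetric])
        finally show ?thesis .
      qed
      have lw: "lip_comp ?w" by (rule lip_comp_compose[OF lv contr]) (use t in auto)
      have "ennreal (t ^ (CARD('n) - 2) * K) = wiener_cap (cball (0 :: real ^ 'n) t)"
        using wiener_cap_cball[OF t(1), of "0 :: real ^ 'n"] n K t by (simp add: ennreal_mult)
      also have "\<dots> \<le> energy ?w"
        by (rule wiener_cap_le[OF lw]) (use v1 t in \<open>auto simp: min_def field_simps\<close>)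
      also have "\<dots> \<le> ennreal ((1 / t)\<^sup>2) * energy ?v" by (rule energy_contraction[OF lv lw contr])
      also have "\<dots> \<le> ennreal ((1 / t)\<^sup>2) * ennreal (\<gamma> * K)"
        by (intro mult_left_mono order_trans[OF energy_mollify[OF h(1) u] E]) simp
      also have "\<dots> = ennreal ((1 / t)\<^sup>2 * (\<gamma> * K))" by (rule ennreal_mult''[symmetric]) (use g K in simp)
      finally have "t ^ (CARD('n) - 2) * K \<le> (1 / t)\<^sup>2 * (\<gamma> * K)"
        using g K t by (simp add: ennreal_le_iff)
      then have "t ^ (CARD('n) - 2) \<le> (1 / t)\<^sup>2 * \<gamma>" using K by (simp add: mult.assoc[symmetric])
      then have "t ^ (CARD('n) - 2) * t\<^sup>2 \<le> \<gamma>" using t by (simp add: power_divide field_simps)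
      moreover have "t ^ (CARD('n) - 2) * t\<^sup>2 = t ^ CARD('n)" using n by (intro power_diff_2) simp
      ultimately show False using tn by simp
    qed
    then show "ennreal \<delta> \<le> (\<integral>\<^sup>+x. indicator ?B x * ennreal ((1 - u x)\<^sup>2) \<partial>lborel)"
      unfolding II by (rule ennreal_leI)
  qed
qed

text \<open>The order of quantifiers matters: C is fixed before Omega, the centre and the radius, so
  letting r grow drives the bottom of the spectrum to 0.\<close>

lemma dirichlet_bottom_large_radius:
  assumes n: "3 \<le> CARD('n::finite)" and g: "0 < \<gamma>" "\<gamma> < 1"
  obtains C where "0 < C"
    "\<And>(\<Omega> :: (real ^ 'n) set) c r. open \<Omega> \<Longrightarrow> 0 < r \<Longrightarrow> negligible_in_cball \<gamma> c r (cball c r - \<Omega>) \<Longrightarrow>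
       dirichlet_bottom \<Omega> \<le> ennreal (C / r\<^sup>2)"
proof -
  define k where "k = CARD('n) - 2"
  have kn: "r ^ k * r\<^sup>2 = r ^ CARD('n)" for r :: real
    unfolding k_def using n by (intro power_diff_2) simp
  obtain K where K: "0 < K" "\<And>(c :: real ^ 'n) r. 0 < r \<Longrightarrow> wiener_cap (cball c r) = ennreal (r ^ k * K)"
    using wiener_cap_cball_real[OF n] unfolding k_def by blast
  \<comment> \<open>The infimum in the capacity need not be attained. A constant strictly between
    gamma and 1 leaves room for a near minimiser, and \<open>capacity_deficit\<close> still applies
    to it.\<close>
  define \<gamma>' where "\<gamma>' = (1 + \<gamma>) / 2"
  have g': "0 < \<gamma>'" "\<gamma>' < 1" "\<gamma> < \<gamma>'" using g by (auto simp: \<gamma>'_def)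
  have K1: "wiener_cap (cball (0 :: real ^ 'n) 1) = ennreal K" using K(2)[of 1 0] by simp
  obtain h \<delta> where h: "0 < h" "h < 1 / 2" and d: "0 < \<delta>" and key:
    "\<And>u :: real ^ 'n \<Rightarrow> real. lip_comp u \<Longrightarrow> (\<And>x. 0 \<le> u x \<and> u x \<le> 1) \<Longrightarrow> energy u \<le> ennreal (\<gamma>' * K) \<Longrightarrow>
       ennreal \<delta> \<le> (\<integral>\<^sup>+x. indicator (cball 0 (1 - h)) x * ennreal ((1 - u x)\<^sup>2) \<partial>lborel)"
    by (rule capacity_deficit[OF n K1 K(1) g'(1,2)]) blast
  define V where "V = unit_ball_vol (real CARD('n))"
  have V0: "0 < V" by (simp add: V_def)
  \<comment> \<open>This is the bound of \<open>energy_cutoff\<close> with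
    \<open>0 <= 1 - u <= 1\<close> on the unit ball, whose volume is V.\<close>
  define C1 where "C1 = 2 * (\<gamma>' * K) + 2 * real CARD('n) / h\<^sup>2 * V"
  have C1: "0 < C1" using g' K V0 h by (simp add: C1_def add_pos_nonneg)
  show ?thesis
  proof (rule that[of "2 * C1 / \<delta>"])
    show "0 < 2 * C1 / \<delta>" using C1 d by simp
    fix \<Omega> :: "(real ^ 'n) set" and c :: "real ^ 'n" and r :: real
    assume op: "open \<Omega>" and r: "0 < r" and neg: "negligible_in_cball \<gamma> c r (cball c r - \<Omega>)"
    let ?F = "cball c r - \<Omega>"
    have "wiener_cap ?F \<le> ennreal \<gamma> * ennreal (r ^ k * K)"
      using neg unfolding negligible_in_cball_def K(2)[OF r] by simp
    also have "\<dots> = ennreal (\<gamma> * (r ^ k * K))" using g r K by (intro ennreal_mult''[symmetric]) simp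
    also have "\<dots> < ennreal (\<gamma>' * (r ^ k * K))" using g g' r K by (intro ennreal_lessI) auto
    finally obtain u0 where u0: "lip_comp u0" "\<And>x. x \<in> ?F \<Longrightarrow> u0 x = 1" "energy u0 < ennreal (\<gamma>' * (r ^ k * K))"
      unfolding wiener_cap_alt INF_less_iff by auto
    \<comment> \<open>Truncation to [0, 1] keeps the value 1 on F and does not increase the energy;
      the bounds are needed for \<open>capacity_deficit\<close>.\<close>
    define u1 where "u1 = (\<lambda>x. max 0 (min 1 (u0 x)))"
    have contr: "\<bar>u1 x - u1 y\<bar> \<le> 1 * \<bar>u0 x - u0 y\<bar>" for x y by (auto simp: u1_def max_def min_def abs_if)
    have u1: "lip_comp u1" by (rule lip_comp_compose[OF u0(1) contr]) (auto simp: u1_def)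
    have Eu1: "energy u1 \<le> ennreal (\<gamma>' * (r ^ k * K))"
    proof -
      have "energy u1 \<le> ennreal (1\<^sup>2) * energy u0" by (rule energy_contraction[OF u0(1) u1 contr])
      then show ?thesis using u0(3) by simp
    qed
    define u where "u = (\<lambda>x. u1 (c + r *\<^sub>R x))"
    have u: "lip_comp u" unfolding u_def by (rule lip_comp_affine[OF u1 r])
    note [measurable] = lip_comp_measurable[OF u] norm_gradient_measurable[OF u]
    have u01: "0 \<le> u x \<and> u x \<le> 1" for x by (auto simp: u_def u1_def)
    have Eu: "energy u \<le> ennreal (\<gamma>' * K)"
    proof -
      obtain e where e: "energy u = ennreal e" "0 \<le> e" using energy_finite[OF u] by (cases "energy u") auto
      have "ennreal (r ^ k) * ennreal e \<le> ennreal (\<gamma>' * (r ^ k * K))"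
        using Eu1 energy_affine[OF u1 r, of c] n e by (simp add: k_def u_def)
      then have "r ^ k * e \<le> \<gamma>' * (r ^ k * K)" using r e g' K by (simp add: ennreal_mult''[symmetric] ennreal_le_iff)
      then have "r ^ k * e \<le> r ^ k * (\<gamma>' * K)" by (simp add: mult_ac)
      then have "e \<le> \<gamma>' * K" using r by simp
      then show ?thesis using e by (simp add: ennreal_leI)
    qed
    \<comment> \<open>The cutoff equals 1 on the ball of radius 1 - h, so it leaves intact the mass
      that \<open>capacity_deficit\<close> provides there.\<close>
    define wt where "wt = (\<lambda>x. cutoff 0 1 h x * (1 + (- 1) * u x))"
    have wt: "lip_comp wt" unfolding wt_def by (rule energy_cutoff(1)[OF u h(1)])
    have Ewt: "energy wt \<le> ennreal C1"
    proof -
      let ?B = "cball (0 :: real ^ 'n) 1" and ?k = "2 * real CARD('n) / h\<^sup>2"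
      have [measurable]: "?B \<in> sets borel" by simp
      have "energy wt \<le> (\<integral>\<^sup>+x. indicator ?B x * ennreal (2 * (- 1)\<^sup>2 * (norm (gradient u x))\<^sup>2 + ?k * (1 + (- 1) * u x)\<^sup>2) \<partial>lborel)"
        unfolding wt_def by (rule energy_cutoff(2)[OF u h(1)])
      also have "\<dots> \<le> (\<integral>\<^sup>+x. ennreal 2 * ennreal ((norm (gradient u x))\<^sup>2) + ennreal ?k * indicator ?B x \<partial>lborel)"
      proof (rule nn_integral_mono)
        fix x
        have "(1 + (- 1) * u x)\<^sup>2 \<le> 1" using u01[of x] by (simp add: power_le_one)
        then have "?k * (1 + (- 1) * u x)\<^sup>2 \<le> ?k" by (intro mult_left_le) auto
        then have "ennreal (2 * (- 1)\<^sup>2 * (norm (gradient u x))\<^sup>2 + ?k * (1 + (- 1) * u x)\<^sup>2) \<le> ennreal (2 * (norm (gradient u x))\<^sup>2 + ?k)"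
          by (intro ennreal_leI) simp
        also have "\<dots> = ennreal 2 * ennreal ((norm (gradient u x))\<^sup>2) + ennreal ?k"
          by (subst ennreal_plus) (auto simp: ennreal_mult)
        finally show "indicator ?B x * ennreal (2 * (- 1)\<^sup>2 * (norm (gradient u x))\<^sup>2 + ?k * (1 + (- 1) * u x)\<^sup>2)
           \<le> ennreal 2 * ennreal ((norm (gradient u x))\<^sup>2) + ennreal ?k * indicator ?B x"
          by (cases "x \<in> ?B") auto
      qed
      also have "\<dots> = (\<integral>\<^sup>+x. ennreal 2 * ennreal ((norm (gradient u x))\<^sup>2) \<partial>lborel) + (\<integral>\<^sup>+x. ennreal ?k * indicator ?B x \<partial>lborel)"
        by (rule nn_integral_add) measurable
      also have "(\<integral>\<^sup>+x. ennreal 2 * ennreal ((norm (gradient u x))\<^sup>2) \<partial>lborel) = ennreal 2 * energy u"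
        unfolding energy_def by (rule nn_integral_cmult) measurable
      also have "(\<integral>\<^sup>+x. ennreal ?k * indicator ?B x \<partial>lborel) = ennreal ?k * ennreal V"
        by (subst nn_integral_cmult_indicator) (auto simp: emeasure_cball V_def)
      also have "ennreal 2 * energy u + ennreal ?k * ennreal V \<le> ennreal 2 * ennreal (\<gamma>' * K) + ennreal ?k * ennreal V"
        by (intro add_right_mono mult_left_mono Eu) simp
      also have "\<dots> = ennreal C1"
      proof -
        have "ennreal 2 * ennreal (\<gamma>' * K) = ennreal (2 * (\<gamma>' * K))"
          by (rule ennreal_mult''[symmetric]) (use g' K in simp)
        moreover have "ennreal ?k * ennreal V = ennreal (?k * V)"
          by (rule ennreal_mult''[symmetric]) (use V0 in simp)
        ultimately show ?thesis
          unfolding C1_def by (subst ennreal_plus) (use g' K V0 in auto)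
      qed
      finally show ?thesis .
    qed
    define w where "w = (\<lambda>x. wt (- (1 / r) *\<^sub>R c + (1 / r) *\<^sub>R x))"
    have w: "lip_comp w" unfolding w_def by (rule lip_comp_affine[OF wt]) (use r in simp)
    note [measurable] = lip_comp_measurable[OF w] lip_comp_measurable[OF wt]
    have arg: "- (1 / r) *\<^sub>R c + (1 / r) *\<^sub>R (c + r *\<^sub>R x) = x" for x
      using r by (simp add: scaleR_add_right)
    have wwt: "w (c + r *\<^sub>R x) = wt x" for x unfolding w_def arg ..
    have Ew: "energy w \<le> ennreal (r ^ k * C1)"
    proof -
      have "energy w = ennreal (r ^ k) * energy wt"
        using energy_affine[OF w r, of c] n unfolding k_def wwt by simp
      also have "\<dots> \<le> ennreal (r ^ k) * ennreal C1" by (intro mult_left_mono Ewt) simp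
      finally show ?thesis using C1 r by (simp add: ennreal_mult)
    qed
    have mass: "ennreal (r ^ CARD('n) * \<delta>) \<le> (\<integral>\<^sup>+x. ennreal ((w x)\<^sup>2) \<partial>lborel)"
    proof -
      have "ennreal \<delta> \<le> (\<integral>\<^sup>+x. indicator (cball 0 (1 - h)) x * ennreal ((1 - u x)\<^sup>2) \<partial>lborel)"
        by (rule key[OF u u01 Eu])
      also have "\<dots> \<le> (\<integral>\<^sup>+x. ennreal ((wt x)\<^sup>2) \<partial>lborel)"
      proof (rule nn_integral_mono)
        fix x :: "real ^ 'n"
        have "cutoff 0 1 h x = 1" if "norm x \<le> 1 - h" using that h by (intro cutoff_eq_1) auto
        then show "indicator (cball 0 (1 - h)) x * ennreal ((1 - u x)\<^sup>2) \<le> ennreal ((wt x)\<^sup>2)"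
          by (auto simp: wt_def indicator_def)
      qed
      finally have "ennreal (r ^ CARD('n)) * ennreal \<delta> \<le> ennreal (r ^ CARD('n)) * (\<integral>\<^sup>+x. ennreal ((wt x)\<^sup>2) \<partial>lborel)"
        by (rule mult_left_mono) simp
      also have "\<dots> = (\<integral>\<^sup>+x. ennreal ((w x)\<^sup>2) \<partial>lborel)"
        by (subst nn_integral_affine[OF _ r, of "\<lambda>x. ennreal ((w x)\<^sup>2)" c]) (simp_all add: wwt)
      finally show ?thesis using r d by (simp add: ennreal_mult)
    qed
    have "dirichlet_bottom \<Omega> \<le> ennreal (2 * (r ^ k * C1) / (r ^ CARD('n) * \<delta>))"
    proof (rule dirichlet_bottom_le[OF w op _ _ _ mass Ew])
      show "0 \<le> w x" for x
        using u01[of "- (1 / r) *\<^sub>R c + (1 / r) *\<^sub>R x"] unfolding w_def wt_def by (intro mult_nonneg_nonneg cutoff_range) simp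
      show "w x = 0" if x: "x \<notin> \<Omega>" for x
      proof -
        define y where "y = - (1 / r) *\<^sub>R c + (1 / r) *\<^sub>R x"
        have xy: "x = c + r *\<^sub>R y" using r by (simp add: y_def scaleR_diff_right)
        show ?thesis
        proof (cases "x \<in> cball c r")
          case True
          then have "u0 x = 1" using x by (intro u0(2)) auto
          then have "u y = 1" unfolding u_def xy[symmetric] by (simp add: u1_def)
          then show ?thesis unfolding w_def y_def[symmetric] wt_def by simp
        next
          case False
          then have "r * 1 \<le> r * norm y" using r unfolding xy by (simp add: dist_norm)
          then have "1 \<le> dist y 0" using r by simp
          then have "cutoff 0 1 h y = 0" using h by (intro cutoff_eq_0)
          then show ?thesis unfolding w_def y_def[symmetric] wt_def by simp
        qed
      qed
    qed (use r d C1 in auto)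
    also have "2 * (r ^ k * C1) / (r ^ CARD('n) * \<delta>) = 2 * C1 / \<delta> / r\<^sup>2"
      unfolding kn[symmetric] using r d by (simp add: field_simps)
    finally show "dirichlet_bottom \<Omega> \<le> ennreal (2 * C1 / \<delta> / r\<^sup>2)" .
  qed
qed

lemma dirichlet_bottom_eq_0:
  fixes \<Omega> :: "(real ^ 'n::finite) set"
  assumes n: "3 \<le> CARD('n)" and g: "0 < \<gamma>" "\<gamma> < 1" and op: "open \<Omega>"
    and inf: "interior_cap_radius \<gamma> \<Omega> = \<infinity>"
  shows "dirichlet_bottom \<Omega> = 0"
proof -
  obtain C where C: "0 < C"
    "\<And>(\<Omega> :: (real ^ 'n) set) c r. open \<Omega> \<Longrightarrow> 0 < r \<Longrightarrow> negligible_in_cball \<gamma> c r (cball c r - \<Omega>) \<Longrightarrow>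
       dirichlet_bottom \<Omega> \<le> ennreal (C / r\<^sup>2)"
    using dirichlet_bottom_large_radius[OF n g] by blast
  have "dirichlet_bottom \<Omega> \<le> 0 + ennreal e" if e: "0 < e" for e
  proof -
    \<comment> \<open>The summand 1 ensures r > 1, hence \<open>r^2 >= r >= C / e\<close>.\<close>
    define R where "R = C / e + 1"
    have R: "1 < R" using C e by (simp add: R_def)
    have "ennreal R < interior_cap_radius \<gamma> \<Omega>" unfolding inf by simp
    then obtain r c where r: "0 < r" "ennreal R < ennreal r" "negligible_in_cball \<gamma> c r (cball c r - \<Omega>)"
      unfolding interior_cap_radius_def less_SUP_iff by blast
    have Rr: "R < r" using r R by (simp add: ennreal_less_iff)
    have "C / e \<le> r" using Rr by (simp add: R_def)
    also have "r * 1 \<le> r * r" using Rr R by (intro mult_left_mono) auto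
    finally have "C / r\<^sup>2 \<le> e" using e r by (simp add: power2_eq_square field_simps)
    then have "ennreal (C / r\<^sup>2) \<le> ennreal e" by (rule ennreal_leI)
    then show ?thesis using C(2)[OF op r(1,3)] by simp
  qed
  then have "dirichlet_bottom \<Omega> \<le> 0" by (rule ennreal_le_epsilon)
  then show ?thesis by simp
qed

theorem corollary1p2:
  fixes \<Omega> :: "(real ^ 'n::finite) set" and \<gamma> :: real
  assumes "CARD('n) \<ge> 3"
    and "0 < \<gamma>" and "\<gamma> < 1"
    and "open \<Omega>"
  shows "dirichlet_bottom \<Omega> > 0 \<longleftrightarrow> interior_cap_radius \<gamma> \<Omega> < \<infinity>"
proof
  assume "dirichlet_bottom \<Omega> > 0"
  then show "interior_cap_radius \<gamma> \<Omega> < \<infinity>"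
    using dirichlet_bottom_eq_0[OF assms] by (auto simp: less_top[symmetric])
next
  assume "interior_cap_radius \<gamma> \<Omega> < \<infinity>"
  then show "dirichlet_bottom \<Omega> > 0"
    by (rule dirichlet_bottom_pos[OF assms(1,2,4)])
qed

end
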